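(* Let $\Gamma$ be a countable group generated by $s_1,\dots,s_r$ ($r\ge1$), let $\mathtt{A}$ be a finite nonempty alphabet, and let $J:\mathtt{A}^2\to\mathbb{R}$ be symmetric and $h:\mathtt{A}\to\mathbb{R}$. Suppose $\mu\in\mathrm{Prob}^\Gamma(\mathtt{A}^\Gamma)$ is shift-invariant, and let $\mu_t=\mu S^\Gamma(t)$ denote its evolution under Glauber dynamics. If there exist $s\ge 0$ and a sequence $\Sigma=(\sigma_n)_{n\in\mathbb{N}}$ of homomorphisms $\sigma_n:\Gamma\to\mathrm{Sym}(V_n)$, with $V_n$ finite nonempty, $|V_n|\to\infty$, $\Delta^{\sigma_n}\to0$, such that $\mathrm{a}_\Sigma(\mu_s)<+\infty$, then $\mu_t$ converges weakly to the set of Gibbs measures as $t\to\infty$ (i.e. every weak limit point of $\mu_t$ as $t\to\infty$ is a Gibbs measure; equivalently, $\mu_t$ eventually lies in each weak-open neighborhood of the set of Gibbs measures).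
   Context: $\Gamma$ is identified with its left Cayley graph: vertex set $\Gamma$ and an $i$-labeled directed edge $(\gamma,s_i\gamma)$ for each $i\in\{1,\dots,r\}$, $\gamma\in\Gamma$. $\Gamma$ acts on $\mathtt{A}^\Gamma$ by $(\beta\mathbf{y})(\gamma)=\mathbf{y}(\gamma\beta)$; $\mathrm{Prob}^\Gamma(\mathtt{A}^\Gamma)$ is the set of Borel probability measures invariant under this action. For a homomorphism $\sigma:\Gamma\to\mathrm{Sym}(V)$ ($V$ finite nonempty), write $\sigma^\gamma$ for the image of $\gamma$; the graph of $\sigma$ has vertex set $V$ and an $i$-labeled directed edge $(v,\sigma^{s_i}v)$ for each $i,v$. Graph distances ignore directions; $\mathrm{B}^\sigma(v,R)$, $\mathrm{B}^\Gamma(\gamma,R)$ are closed balls. $\mathrm{B}^\sigma(v,R)\cong \mathrm{B}^\Gamma(e,R)$ means the induced subgraphs are isomorphic respecting edge labels and directions. Define, for integers $R\ge 0$, $$\delta_R^\sigma=\frac{1}{|V|}\big|\{v\in V: \mathrm{B}^\sigma(v,R)\not\cong \mathrm{B}^\Gamma(e,R)\}\big|,\qquad \Delta^\sigma=\inf_R\big(9(2/3)^R+6\delta_R^\sigma\big).$$ Empirical distributions: for $\mathbf{x}\in\mathtt{A}^V$, $v\in V$, let $(\Pi_v^\sigma\mathbf{x})(\gamma)=\mathbf{x}(\sigma^\gamma v)$, $P_{\mathbf{x}}^\sigma=\frac{1}{|V|}\sum_{v\in V}\delta_{\Pi_v^\sigma\mathbf{x}}\in\mathrm{Prob}(\mathtt{A}^\Gamma)$;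 for $\zeta\in\mathrm{Prob}(\mathtt{A}^V)$ let $P_\zeta^\sigma=\int P_{\mathbf{x}}^\sigma\,\zeta(d\mathbf{x})$. For a weak-open set $\mathcal{O}\subset\mathrm{Prob}(\mathtt{A}^\Gamma)$ let $\mathbf{\Omega}(\sigma,\mathcal{O})=\{\zeta\in\mathrm{Prob}(\mathtt{A}^V): P_\zeta^\sigma\in\mathcal{O}\}$. Free energy density: for $\mathbf{x}\in\mathtt{A}^V$ let $U(\mathbf{x})=\sum_{v\in V}h(\mathbf{x}(v))+\sum_{v\in V}\sum_{i=1}^r J(\mathbf{x}(v),\mathbf{x}(\sigma^{s_i}v))$; $\zeta(U)$ is the $\zeta$-mean of $U$ and $\mathrm{H}(\zeta)$ is Shannon entropy (natural log). Define $$\mathrm{a}_\Sigma(\mu)=\sup_{\mathcal{O}\ni\mu}\ \limsup_{n\to\infty}\ \inf_{\zeta\in\mathbf{\Omega}(\sigma_n,\mathcal{O})}\frac{1}{|V_n|}\big[\zeta(U)-\mathrm{H}(\zeta)\big],$$ the supremum over weak-open neighborhoods of $\mu$, with $\inf\varnothing=+\infty$. Glauber dynamics: for $\gamma\in\Gamma$, $\mathbf{x}\in\mathtt{A}^\Gamma$, let $\Phi_\gamma(\mathbf{x})=h(\mathbf{x}(\gamma))+\sum_{i=1}^r\big[J(\mathbf{x}(\gamma),\mathbf{x}(s_i\gamma))+J(\mathbf{x}(\gamma),\mathbf{x}(s_i^{-1}\gamma))\big]$. Let $\mathbf{x}^{\gamma\to\mathtt{a}}$ be $\mathbf{x}$ with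 its value at $\gamma$ replaced by $\mathtt{a}$, and $c_\gamma(\mathbf{x},\mathtt{a})=\exp\{-\Phi_\gamma(\mathbf{x}^{\gamma\to\mathtt{a}})\}/\sum_{\mathtt{b}\in\mathtt{A}}\exp\{-\Phi_\gamma(\mathbf{x}^{\gamma\to\mathtt{b}})\}$. $S^\Gamma(t)$, $t\ge0$, is the Markov semigroup on $C(\mathtt{A}^\Gamma)$ whose generator is the closure of $\Omega^\Gamma f(\mathbf{x})=\sum_{\gamma\in\Gamma}\sum_{\mathtt{a}\in\mathtt{A}}c_\gamma(\mathbf{x},\mathtt{a})[f(\mathbf{x}^{\gamma\to\mathtt{a}})-f(\mathbf{x})]$, defined on continuous $f$ with $\sum_{\gamma}\sup\{|f(\eta_1)-f(\eta_2)|:\eta_1=\eta_2\text{ off }\gamma\}<\infty$. $\mu S^\Gamma(t)$ is the measure with $[\mu S^\Gamma(t)]f=\mu[S^\Gamma(t)f]$. Gibbs measures: $\mu\in\mathrm{Prob}(\mathtt{A}^\Gamma)$ is Gibbs if for each $\gamma\in\Gamma$, $\mathtt{a}\in\mathtt{A}$, the function $\mathbf{y}\mapsto c_\gamma(\mathbf{y},\mathtt{a})$ is a version of $\mu(\mathbf{x}(\gamma)=\mathtt{a}\mid\mathscr{T}_\gamma)(\mathbf{y})$, where $\mathscr{T}_\gamma$ is the $\sigma$-algebra generated by all coordinates other than $\gamma$. *)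

theory Defs
  imports "HOL-Probability.Probability" "HOL-Combinatorics.Permutations"
begin

text \<open>
  Conventions. The group \<open>\<Gamma>\<close> is a type of class \<^class>\<open>group_add\<close> (no commutativity), so the product
  \<open>\<gamma>\<beta>\<close> is written \<open>\<gamma> + \<beta>\<close>, the inverse \<open>- \<gamma>\<close> and the identity \<open>0\<close>. The generators are
  \<open>s 1, \<dots>, s r\<close>. The alphabet is a finite type with the discrete topology, so \<open>'g \<Rightarrow> 'a\<close> carries the
  (compact) product topology, the type of bounded continuous real functions on it is \<open>C(A\<^sup>\<Gamma>)\<close>, and
  \<^const>\<open>borel\<close> is its Borel sigma-algebra.
\<close>

class finite_discrete = finite + discrete_topology

instance finite_discrete \<subseteq> second_countable_topology
proof
  have "open = generate_topology (UNIV :: 'a set set)"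
    by (intro ext) (simp add: discrete_topology_class.open_discrete generate_topology.Basis)
  then show "\<exists>B::'a set set. countable B \<and> open = generate_topology B"
    by (intro exI[of _ UNIV]) (auto intro: countable_finite)
qed

inductive_set generated_subgroup :: "'g::group_add set \<Rightarrow> 'g set" for X where
  zero: "0 \<in> generated_subgroup X"
| incl: "x \<in> X \<Longrightarrow> x \<in> generated_subgroup X"
| minus: "x \<in> generated_subgroup X \<Longrightarrow> - x \<in> generated_subgroup X"
| plus: "x \<in> generated_subgroup X \<Longrightarrow> y \<in> generated_subgroup X \<Longrightarrow> x + y \<in> generated_subgroup X"


section \<open>Labelled directed graphs and sofic approximation\<close>

text \<open>A labelled directed graph is given by its set of edges \<open>(source, label, target)\<close>.\<close>

type_synonym 'v lgraph = "('v \<times> nat \<times> 'v) set"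

definition cayley_graph :: "nat \<Rightarrow> (nat \<Rightarrow> 'g::group_add) \<Rightarrow> 'g lgraph" where
  "cayley_graph r s = {(\<gamma>, i, s i + \<gamma>) | \<gamma> i. i \<in> {1..r}}"

definition action_graph :: "nat \<Rightarrow> (nat \<Rightarrow> 'g) \<Rightarrow> 'v set \<Rightarrow> ('g \<Rightarrow> 'v \<Rightarrow> 'v) \<Rightarrow> 'v lgraph" where
  "action_graph r s V \<sigma> = {(v, i, \<sigma> (s i) v) | v i. v \<in> V \<and> i \<in> {1..r}}"

definition adjacency :: "'v lgraph \<Rightarrow> ('v \<times> 'v) set" where
  "adjacency E = {(v, w). \<exists>i. (v, i, w) \<in> E \<or> (w, i, v) \<in> E}"

definition graph_dist :: "'v lgraph \<Rightarrow> 'v \<Rightarrow> 'v \<Rightarrow> enat" where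
  "graph_dist E v w = (INF k\<in>{k. (v, w) \<in> adjacency E ^^ k}. enat k)"

definition graph_ball :: "'v lgraph \<Rightarrow> 'v \<Rightarrow> nat \<Rightarrow> 'v set" where
  "graph_ball E v R = {w. graph_dist E v w \<le> enat R}"

definition induced_isomorphic :: "'v lgraph \<Rightarrow> 'v set \<Rightarrow> 'w lgraph \<Rightarrow> 'w set \<Rightarrow> bool" where
  "induced_isomorphic E A F B \<longleftrightarrow>
    (\<exists>\<phi>. bij_betw \<phi> A B \<and>
         (\<forall>x\<in>A. \<forall>y\<in>A. \<forall>i. (x, i, y) \<in> E \<longleftrightarrow> (\<phi> x, i, \<phi> y) \<in> F))"

definition hom_to_Sym :: "'v set \<Rightarrow> ('g::group_add \<Rightarrow> 'v \<Rightarrow> 'v) \<Rightarrow> bool" where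
  "hom_to_Sym V \<sigma> \<longleftrightarrow>
    (\<forall>\<gamma>. \<sigma> \<gamma> permutes V) \<and> (\<forall>\<gamma> \<beta>. \<sigma> (\<gamma> + \<beta>) = \<sigma> \<gamma> \<circ> \<sigma> \<beta>)"

definition sofic_delta ::
  "nat \<Rightarrow> (nat \<Rightarrow> 'g::group_add) \<Rightarrow> 'v set \<Rightarrow> ('g \<Rightarrow> 'v \<Rightarrow> 'v) \<Rightarrow> nat \<Rightarrow> real" where
  "sofic_delta r s V \<sigma> R =
    real (card {v \<in> V. \<not> induced_isomorphic
                 (action_graph r s V \<sigma>) (graph_ball (action_graph r s V \<sigma>) v R)
                 (cayley_graph r s) (graph_ball (cayley_graph r s) 0 R)})
    / real (card V)"

definition sofic_Delta ::
  "nat \<Rightarrow> (nat \<Rightarrow> 'g::group_add) \<Rightarrow> 'v set \<Rightarrow> ('g \<Rightarrow> 'v \<Rightarrow> 'v) \<Rightarrow> real" where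
  "sofic_Delta r s V \<sigma> = (INF R::nat. 9 * (2/3) ^ R + 6 * sofic_delta r s V \<sigma> R)"


section \<open>Probability measures and the weak topology\<close>

abbreviation Prob :: "'x::topological_space measure set" where
  "Prob \<equiv> space (prob_algebra borel)"

definition shift :: "'g::group_add \<Rightarrow> ('g \<Rightarrow> 'a) \<Rightarrow> 'g \<Rightarrow> 'a" where
  "shift \<beta> y = (\<lambda>\<gamma>. y (\<gamma> + \<beta>))"

definition invariant_Prob :: "('g::group_add \<Rightarrow> 'a::topological_space) measure set" where
  "invariant_Prob = {\<mu> \<in> Prob. \<forall>\<beta>. distr \<mu> borel (shift \<beta>) = \<mu>}"

text \<open>
  The coarsest topology on \<open>Prob\<close> for which all \<open>\<mu> \<mapsto> \<integral>f d\<mu>\<close>, with \<open>f\<close> bounded and continuous, are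
  continuous: the initial topology of the joint map into the product space of real-valued functions of \<open>f\<close>.
\<close>

definition weak_topology :: "'x::topological_space measure topology" where
  "weak_topology =
    pullback_topology Prob (\<lambda>\<mu> (f :: 'x \<Rightarrow>\<^sub>C real). \<integral>x. apply_bcontfun f x \<partial>\<mu>) euclidean"

definition weak_limit_points_at_top ::
  "(real \<Rightarrow> 'x::topological_space measure) \<Rightarrow> 'x measure set" where
  "weak_limit_points_at_top m =
    {\<nu> \<in> Prob. \<forall>\<O>. openin weak_topology \<O> \<and> \<nu> \<in> \<O> \<longrightarrow> (\<exists>\<^sub>F t in at_top. m t \<in> \<O>)}"


section \<open>Empirical distributions and free energy density\<close>

definition pullback_name :: "('g \<Rightarrow> 'v \<Rightarrow> 'v) \<Rightarrow> ('v \<Rightarrow> 'a) \<Rightarrow> 'v \<Rightarrow> 'g \<Rightarrow> 'a" where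
  "pullback_name \<sigma> x v = (\<lambda>\<gamma>. x (\<sigma> \<gamma> v))"

text \<open>
  The average of the Dirac masses at \<open>pullback_name \<sigma> x v\<close> over \<open>v \<in> V\<close>, written as the image of the
  uniform distribution on \<open>V\<close>.
\<close>

definition empirical ::
  "'v set \<Rightarrow> ('g \<Rightarrow> 'v \<Rightarrow> 'v) \<Rightarrow> ('v \<Rightarrow> 'a::topological_space) \<Rightarrow> ('g \<Rightarrow> 'a) measure" where
  "empirical V \<sigma> x = distr (measure_pmf (pmf_of_set V)) borel (pullback_name \<sigma> x)"

text \<open>The mixture of the measures \<open>empirical V \<sigma> x\<close> over \<open>x\<close> distributed as \<open>\<zeta>\<close>.\<close>

definition mean_empirical ::
  "'v set \<Rightarrow> ('g \<Rightarrow> 'v \<Rightarrow> 'v) \<Rightarrow> ('v \<Rightarrow> 'a::topological_space) pmf \<Rightarrow> ('g \<Rightarrow> 'a) measure" where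
  "mean_empirical V \<sigma> \<zeta> = measure_pmf \<zeta> \<bind> empirical V \<sigma>"

text \<open>
  Configurations in \<open>A\<^sup>V\<close> are the extensional functions \<open>V \<rightarrow>\<^sub>E UNIV\<close>; elements of \<open>Prob(A\<^sup>V)\<close> are mass
  functions supported there.
\<close>

definition Omega_set ::
  "'v set \<Rightarrow> ('g \<Rightarrow> 'v \<Rightarrow> 'v) \<Rightarrow> ('g \<Rightarrow> 'a::topological_space) measure set \<Rightarrow> ('v \<Rightarrow> 'a) pmf set" where
  "Omega_set V \<sigma> \<O> = {\<zeta>. set_pmf \<zeta> \<subseteq> (V \<rightarrow>\<^sub>E UNIV) \<and> mean_empirical V \<sigma> \<zeta> \<in> \<O>}"

definition energy ::
  "nat \<Rightarrow> (nat \<Rightarrow> 'g) \<Rightarrow> ('a \<Rightarrow> 'a \<Rightarrow> real) \<Rightarrow> ('a \<Rightarrow> real) \<Rightarrow>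
   'v set \<Rightarrow> ('g \<Rightarrow> 'v \<Rightarrow> 'v) \<Rightarrow> ('v \<Rightarrow> 'a) \<Rightarrow> real" where
  "energy r s J h V \<sigma> x =
    (\<Sum>v\<in>V. h (x v)) + (\<Sum>v\<in>V. \<Sum>i=1..r. J (x v) (x (\<sigma> (s i) v)))"

definition shannon_entropy :: "'v set \<Rightarrow> ('v \<Rightarrow> 'a) pmf \<Rightarrow> real" where
  "shannon_entropy V \<zeta> = - (\<Sum>x\<in>V \<rightarrow>\<^sub>E UNIV. pmf \<zeta> x * ln (pmf \<zeta> x))"

definition free_energy_density ::
  "nat \<Rightarrow> (nat \<Rightarrow> 'g) \<Rightarrow> ('a::topological_space \<Rightarrow> 'a \<Rightarrow> real) \<Rightarrow> ('a \<Rightarrow> real) \<Rightarrow>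
   (nat \<Rightarrow> 'v set) \<Rightarrow> (nat \<Rightarrow> 'g \<Rightarrow> 'v \<Rightarrow> 'v) \<Rightarrow> ('g \<Rightarrow> 'a) measure \<Rightarrow> ereal" where
  "free_energy_density r s J h V \<sigma> \<mu> =
    (SUP \<O>\<in>{\<O>. openin weak_topology \<O> \<and> \<mu> \<in> \<O>}.
      limsup (\<lambda>n. INF \<zeta>\<in>Omega_set (V n) (\<sigma> n) \<O>.
        ereal ((measure_pmf.expectation \<zeta> (energy r s J h (V n) (\<sigma> n)) - shannon_entropy (V n) \<zeta>)
               / real (card (V n)))))"


section \<open>Glauber dynamics\<close>

definition local_energy ::
  "nat \<Rightarrow> (nat \<Rightarrow> 'g::group_add) \<Rightarrow> ('a \<Rightarrow> 'a \<Rightarrow> real) \<Rightarrow> ('a \<Rightarrow> real) \<Rightarrow> 'g \<Rightarrow> ('g \<Rightarrow> 'a) \<Rightarrow> real" where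
  "local_energy r s J h \<gamma> x =
    h (x \<gamma>) + (\<Sum>i=1..r. J (x \<gamma>) (x (s i + \<gamma>)) + J (x \<gamma>) (x (- s i + \<gamma>)))"

definition flip_rate ::
  "nat \<Rightarrow> (nat \<Rightarrow> 'g::group_add) \<Rightarrow> ('a::finite \<Rightarrow> 'a \<Rightarrow> real) \<Rightarrow> ('a \<Rightarrow> real) \<Rightarrow>
   'g \<Rightarrow> ('g \<Rightarrow> 'a) \<Rightarrow> 'a \<Rightarrow> real" where
  "flip_rate r s J h \<gamma> x a =
    exp (- local_energy r s J h \<gamma> (x(\<gamma> := a))) /
    (\<Sum>b\<in>UNIV. exp (- local_energy r s J h \<gamma> (x(\<gamma> := b))))"

definition osc :: "(('g \<Rightarrow> 'a) \<Rightarrow> real) \<Rightarrow> 'g \<Rightarrow> real" where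
  "osc f \<gamma> = Sup {\<bar>f x - f y\<bar> | x y. \<forall>\<beta>. \<beta> \<noteq> \<gamma> \<longrightarrow> x \<beta> = y \<beta>}"

text \<open>Unbounded operators on \<open>C(A\<^sup>\<Gamma>)\<close> are represented by their graphs.\<close>

definition glauber_pregenerator ::
  "nat \<Rightarrow> (nat \<Rightarrow> 'g::group_add) \<Rightarrow> ('a::finite_discrete \<Rightarrow> 'a \<Rightarrow> real) \<Rightarrow> ('a \<Rightarrow> real) \<Rightarrow>
   ((('g \<Rightarrow> 'a) \<Rightarrow>\<^sub>C real) \<times> (('g \<Rightarrow> 'a) \<Rightarrow>\<^sub>C real)) set" where
  "glauber_pregenerator r s J h =
    {(f, g). osc (apply_bcontfun f) summable_on UNIV \<and>
       (\<forall>x. apply_bcontfun g x =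
         (\<Sum>\<^sub>\<infinity>\<gamma>. \<Sum>a\<in>UNIV. flip_rate r s J h \<gamma> x a *
            (apply_bcontfun f (x(\<gamma> := a)) - apply_bcontfun f x)))}"

definition markov_semigroup ::
  "(real \<Rightarrow> ('x::topological_space \<Rightarrow>\<^sub>C real) \<Rightarrow> ('x \<Rightarrow>\<^sub>C real)) \<Rightarrow> bool" where
  "markov_semigroup S \<longleftrightarrow>
    (\<forall>t\<ge>0. linear (S t)) \<and>
    S 0 = id \<and>
    (\<forall>t\<ge>0. \<forall>u\<ge>0. S (t + u) = S t \<circ> S u) \<and>
    (\<forall>f. \<forall>t\<ge>0. ((\<lambda>u. S u f) \<longlongrightarrow> S t f) (at_right t)) \<and>
    (\<forall>t\<ge>0. S t (const_bcontfun 1) = const_bcontfun 1) \<and>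
    (\<forall>t\<ge>0. \<forall>f. (\<forall>x. 0 \<le> apply_bcontfun f x) \<longrightarrow> (\<forall>x. 0 \<le> apply_bcontfun (S t f) x))"

definition semigroup_generator ::
  "(real \<Rightarrow> 'b::real_normed_vector \<Rightarrow> 'b) \<Rightarrow> ('b \<times> 'b) set" where
  "semigroup_generator S = {(f, g). ((\<lambda>t. (S t f - f) /\<^sub>R t) \<longlongrightarrow> g) (at_right 0)}"

definition glauber_semigroup ::
  "nat \<Rightarrow> (nat \<Rightarrow> 'g::group_add) \<Rightarrow> ('a::finite_discrete \<Rightarrow> 'a \<Rightarrow> real) \<Rightarrow> ('a \<Rightarrow> real) \<Rightarrow>
   (real \<Rightarrow> (('g \<Rightarrow> 'a) \<Rightarrow>\<^sub>C real) \<Rightarrow> (('g \<Rightarrow> 'a) \<Rightarrow>\<^sub>C real)) \<Rightarrow> bool" where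
  "glauber_semigroup r s J h S \<longleftrightarrow>
    markov_semigroup S \<and> semigroup_generator S = closure (glauber_pregenerator r s J h)"

text \<open>
  The measure \<open>\<mu>T\<close> with \<open>(\<mu>T)f = \<mu>(Tf)\<close>; it exists and is unique by the Riesz representation theorem
  when \<open>T\<close> is a linear, positive and unital operator on \<open>C(X)\<close> with \<open>X\<close> compact metrizable.
\<close>

definition act_on_measure ::
  "'x::topological_space measure \<Rightarrow> (('x \<Rightarrow>\<^sub>C real) \<Rightarrow> ('x \<Rightarrow>\<^sub>C real)) \<Rightarrow> 'x measure" where
  "act_on_measure \<mu> T =
    (THE \<nu>. \<nu> \<in> Prob \<and>
       (\<forall>f. (\<integral>x. apply_bcontfun f x \<partial>\<nu>) = (\<integral>x. apply_bcontfun (T f) x \<partial>\<mu>)))"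


section \<open>Gibbs measures\<close>

definition outside_algebra :: "'g \<Rightarrow> ('g \<Rightarrow> 'a) measure" where
  "outside_algebra \<gamma> = sigma UNIV {{x. x \<beta> \<in> B} | \<beta> B. \<beta> \<noteq> \<gamma>}"

definition gibbs_measures ::
  "nat \<Rightarrow> (nat \<Rightarrow> 'g::group_add) \<Rightarrow> ('a::finite_discrete \<Rightarrow> 'a \<Rightarrow> real) \<Rightarrow> ('a \<Rightarrow> real) \<Rightarrow>
   ('g \<Rightarrow> 'a) measure set" where
  "gibbs_measures r s J h =
    {\<mu> \<in> Prob. \<forall>\<gamma> a.
       (\<lambda>y. flip_rate r s J h \<gamma> y a) \<in> borel_measurable (outside_algebra \<gamma>) \<and>
       (AE y in \<mu>. real_cond_exp \<mu> (outside_algebra \<gamma>) (indicator {x. x \<gamma> = a}) y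
                  = flip_rate r s J h \<gamma> y a)}"

end

theory Submission
  imports Defs
begin

text \<open>
  Finiteness of the free energy only says that \<open>\<mu>\<^sub>s\<close> is approximated by empirical distributions
  \<open>P\<^bsub>\<zeta>\<^esub>\<close> with \<open>\<zeta> \<in> Prob(A\<^sup>V)\<close> on sofic models. Such a \<open>\<zeta>\<close> is run through the backward Euler scheme
  \<open>\<zeta>\<^sub>0 = \<zeta>\<close>, \<open>\<zeta>\<^bsub>j+1\<^esub> - \<tau> \<zeta>\<^bsub>j+1\<^esub>\<Omega> = \<zeta>\<^sub>j\<close> of the Glauber dynamics on the finite model.

  (1) The free energy \<open>\<zeta>(U) - H(\<zeta>)\<close> drops in each step by at least
  \<open>(\<tau>/4) \<Sum>\<^bsub>v\<^esub> \<parallel>\<zeta>\<^bsub>j+1\<^esub> - \<zeta>\<^bsub>j+1\<^esub>K\<^sub>v\<parallel>\<^sub>1\<^sup>2\<close>, where \<open>K\<^sub>v\<close> resamples the spin at \<open>v\<close>: this is convexity together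
  with a Hellinger bound on the relative entropy. As the free energy is \<open>O(|V|)\<close>, the
  total dissipation per vertex is bounded independently of the model and of the running time.

  (2) For \<open>\<psi> = K\<^sub>\<gamma>f - f\<close> with \<open>f\<close> local, \<open>P\<^bsub>\<zeta>\<^esub>(\<psi>)\<close> is controlled by the dissipation of \<open>\<zeta>\<close>, up to
  vertices whose neighbourhood in the model is degenerate.

  (3) \<open>P\<^bsub>\<zeta>\<^sub>j\<^esub>\<close> tracks \<open>\<mu>\<^bsub>s+j\<tau>\<^esub>\<close>, because \<open>S(j\<tau>)\<psi>\<close> satisfies the same scheme up to \<open>o(\<tau>)\<close> and is
  approximated in the graph norm of the generator by local functions.

  If a limit point \<open>\<nu>\<close> were not Gibbs, some such \<open>\<psi>\<close> would have \<open>\<nu>(\<psi>) \<noteq> 0\<close>; then \<open>\<mu>\<^sub>t(\<psi>)\<close> stays away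
  from \<open>0\<close> on infinitely many disjoint time intervals of a fixed length, which by (2) and (3)
  exceeds the dissipation allowed by (1).
\<close>

section \<open>Heat-bath dynamics on a finite set\<close>

text \<open>The bound \<open>ln u \<le> u - 1\<close> at the square root of the likelihood ratio
  bounds the squared Hellinger distance by the relative entropy; Cauchy-Schwarz on \<open>\<bar>p -
  q\<bar> = \<bar>sqrt p - sqrt q\<bar> * (sqrt p + sqrt q)\<close> then gives the factor 4.
  Hypothesis \<open>ac\<close> excludes points with \<open>p x > 0\<close> where the default
  \<open>p x / 0 = 0\<close> would hide an infinite term.\<close>

lemma kl_lower_bound:
  fixes p q :: "'x \<Rightarrow> real"
  assumes p: "\<And>x. x \<in> X \<Longrightarrow> 0 \<le> p x" "sum p X = 1"
    and q: "\<And>x. x \<in> X \<Longrightarrow> 0 \<le> q x" "sum q X = 1"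
    and ac: "\<And>x. x \<in> X \<Longrightarrow> q x = 0 \<Longrightarrow> p x = 0"
  shows "(\<Sum>x\<in>X. \<bar>p x - q x\<bar>)\<^sup>2 \<le> 4 * (\<Sum>x\<in>X. p x * ln (p x / q x))"
proof -
  have pt: "(sqrt (p x) - sqrt (q x))\<^sup>2 \<le> p x * ln (p x / q x) - p x + q x" if x: "x \<in> X" for x
  proof (cases "p x = 0")
    case True
    then show ?thesis using q(1)[OF x] by simp
  next
    case False
    then have pp: "p x > 0" using p(1)[OF x] by simp
    have qp: "q x > 0" using ac[OF x] False q(1)[OF x] by fastforce
    define u where "u = sqrt (q x) / sqrt (p x)"
    have u: "u > 0" using pp qp by (simp add: u_def)
    have u2: "q x / p x = u\<^sup>2" using pp qp by (simp add: u_def power_divide)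
    have "ln (p x / q x) = - ln (q x / p x)" using pp qp by (simp add: ln_div)
    also have "\<dots> = - 2 * ln u" unfolding u2 using u by (simp add: ln_realpow)
    also have "\<dots> \<ge> 2 - 2 * u" using ln_le_minus_one[OF u] by simp
    finally have "p x * ln (p x / q x) \<ge> p x * (2 - 2 * u)" using pp by (intro mult_left_mono) auto
    moreover have "p x * u = sqrt (p x) * sqrt (q x)"
      using pp by (simp add: u_def field_simps)
    moreover have "(sqrt (p x) - sqrt (q x))\<^sup>2 = p x + q x - 2 * (sqrt (p x) * sqrt (q x))"
      using pp qp by (simp add: power2_diff)
    ultimately show ?thesis by (simp add: algebra_simps)
  qed
  have hell: "(\<Sum>x\<in>X. (sqrt (p x) - sqrt (q x))\<^sup>2) \<le> (\<Sum>x\<in>X. p x * ln (p x / q x))"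
    using sum_mono[of X "\<lambda>x. (sqrt (p x) - sqrt (q x))\<^sup>2", OF pt] p(2) q(2) by (simp add: sum.distrib sum_subtractf)
  have "(\<Sum>x\<in>X. \<bar>p x - q x\<bar>) = (\<Sum>x\<in>X. \<bar>sqrt (p x) - sqrt (q x)\<bar> * (sqrt (p x) + sqrt (q x)))"
  proof (rule sum.cong)
    fix x assume x: "x \<in> X"
    have "p x - q x = (sqrt (p x) - sqrt (q x)) * (sqrt (p x) + sqrt (q x))"
      using p(1)[OF x] q(1)[OF x] by (simp add: algebra_simps)
    then show "\<bar>p x - q x\<bar> = \<bar>sqrt (p x) - sqrt (q x)\<bar> * (sqrt (p x) + sqrt (q x))"
      using p(1)[OF x] q(1)[OF x] by (simp add: abs_mult)
  qed simp
  then have "(\<Sum>x\<in>X. \<bar>p x - q x\<bar>)\<^sup>2 \<le> (\<Sum>x\<in>X. \<bar>sqrt (p x) - sqrt (q x)\<bar>\<^sup>2) * (\<Sum>x\<in>X. (sqrt (p x) + sqrt (q x))\<^sup>2)"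
    by (simp only: Cauchy_Schwarz_ineq_sum)
  also have "\<dots> \<le> (\<Sum>x\<in>X. (sqrt (p x) - sqrt (q x))\<^sup>2) * 4"
  proof -
    have "(sqrt (p x) + sqrt (q x))\<^sup>2 \<le> 2 * p x + 2 * q x" if "x \<in> X" for x
      using p(1)[OF that] q(1)[OF that] sum_squares_ge_zero[of "sqrt (p x) - sqrt (q x)" 0]
      by (simp add: power2_eq_square algebra_simps)
    then have "(\<Sum>x\<in>X. (sqrt (p x) + sqrt (q x))\<^sup>2) \<le> (\<Sum>x\<in>X. 2 * p x + 2 * q x)"
      by (rule sum_mono)
    also have "\<dots> = 4" using p(2) q(2) by (simp add: sum.distrib flip: sum_distrib_left)
    finally show ?thesis by (simp add: mult_left_mono sum_nonneg)
  qed
  also have "\<dots> \<le> 4 * (\<Sum>x\<in>X. p x * ln (p x / q x))" using hell by simp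
  finally show ?thesis .
qed

section \<open>Single-site resampling and relative entropy\<close>

locale heat_bath =
  fixes X :: "'x set" and \<rho> :: "'x \<Rightarrow> real" and key :: "'i \<Rightarrow> 'x \<Rightarrow> 'k"
  assumes fin: "finite X" and pos: "\<And>x. x \<in> X \<Longrightarrow> 0 < \<rho> x"
begin

text \<open>\<open>key w\<close> records what a resampling of \<open>w\<close> leaves unchanged, so
  these are the states that one update at \<open>w\<close> can reach from \<open>x\<close>.\<close>

definition fib :: "'i \<Rightarrow> 'x \<Rightarrow> 'x set" where
  "fib w x = {y \<in> X. key w y = key w x}"

text \<open>The kernel \<open>K\<^sub>w\<close> acting on measures; \<open>cond\<close> is the same
  kernel acting on functions.\<close>

definition resample :: "'i \<Rightarrow> ('x \<Rightarrow> real) \<Rightarrow> 'x \<Rightarrow> real" where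
  "resample w \<zeta> x = \<rho> x / sum \<rho> (fib w x) * sum \<zeta> (fib w x)"

definition cond :: "'i \<Rightarrow> ('x \<Rightarrow> real) \<Rightarrow> 'x \<Rightarrow> real" where
  "cond w \<phi> x = (\<Sum>y\<in>fib w x. \<rho> y * \<phi> y) / sum \<rho> (fib w x)"

text \<open>The weight \<open>\<rho>\<close> is not normalised: for
  \<open>\<rho> = exp (- U)\<close> this is the free energy
  \<open>\<zeta>(U) - H(\<zeta>)\<close>.\<close>

definition relent :: "('x \<Rightarrow> real) \<Rightarrow> real" where
  "relent \<zeta> = (\<Sum>x\<in>X. \<zeta> x * ln (\<zeta> x / \<rho> x))"

definition is_prob :: "('x \<Rightarrow> real) \<Rightarrow> bool" where
  "is_prob \<zeta> \<longleftrightarrow> (\<forall>x\<in>X. 0 \<le> \<zeta> x) \<and> sum \<zeta> X = 1"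

definition defect :: "'i \<Rightarrow> ('x \<Rightarrow> real) \<Rightarrow> real" where
  "defect w \<zeta> = (\<Sum>x\<in>X. \<bar>\<zeta> x - resample w \<zeta> x\<bar>)"

lemma fib_sub: "fib w x \<subseteq> X" and fin_fib: "finite (fib w x)"
  using fin by (auto simp: fib_def)

lemma fibD: "y \<in> fib w x \<Longrightarrow> y \<in> X"
  by (simp add: fib_def)

lemma fib_pos: "y \<in> fib w x \<Longrightarrow> 0 < \<rho> y"
  using pos by (simp add: fib_def)

lemma sum_fib: "(\<Sum>x\<in>X. if key w x = key w y then f x else 0) = sum f (fib w y)"
  unfolding fib_def using fin by (rule sum.inter_filter[symmetric])

lemma self_fib: "x \<in> X \<Longrightarrow> x \<in> fib w x"
  by (simp add: fib_def)

lemma fib_eq: "y \<in> fib w x \<Longrightarrow> fib w y = fib w x"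
  by (auto simp: fib_def)

lemma sum_fib_pos: "x \<in> X \<Longrightarrow> 0 < sum \<rho> (fib w x)"
  using self_fib[of x w] pos fin_fib fib_pos by (intro sum_pos2[where i = x]) (auto intro: less_imp_le)

text \<open>Both sides sum \<open>\<rho> y / sum \<rho> (fib w y) * \<zeta> x * \<phi> y\<close>
  over the pairs \<open>x\<close>, \<open>y\<close> lying in a common fibre.\<close>

lemma duality: "(\<Sum>y\<in>X. resample w \<zeta> y * \<phi> y) = (\<Sum>x\<in>X. \<zeta> x * cond w \<phi> x)"
proof -
  let ?t = "\<lambda>x y. if key w x = key w y then \<rho> y / sum \<rho> (fib w y) * \<zeta> x * \<phi> y else 0"
  have "(\<Sum>y\<in>X. resample w \<zeta> y * \<phi> y) = (\<Sum>y\<in>X. \<Sum>x\<in>X. ?t x y)"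
    by (simp add: sum_fib resample_def sum_distrib_left sum_distrib_right)
  also have "\<dots> = (\<Sum>x\<in>X. \<Sum>y\<in>X. ?t x y)" by (rule sum.swap)
  also have "\<dots> = (\<Sum>x\<in>X. \<zeta> x * cond w \<phi> x)"
  proof (intro sum.cong refl)
    fix x assume x: "x \<in> X"
    have "(\<Sum>y\<in>X. ?t x y) = (\<Sum>y\<in>fib w x. \<rho> y / sum \<rho> (fib w y) * \<zeta> x * \<phi> y)"
      by (subst sum_fib[symmetric]) (auto intro!: sum.cong)
    also have "\<dots> = (\<Sum>y\<in>fib w x. \<rho> y / sum \<rho> (fib w x) * \<zeta> x * \<phi> y)"
      using fib_eq by (intro sum.cong) auto
    also have "\<dots> = \<zeta> x * cond w \<phi> x"
      by (simp add: cond_def sum_distrib_left sum_divide_distrib mult_ac)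
    finally show "(\<Sum>y\<in>X. ?t x y) = \<zeta> x * cond w \<phi> x" .
  qed
  finally show ?thesis .
qed

lemma cond_const:
  assumes "x \<in> X" "\<And>y. y \<in> fib w x \<Longrightarrow> \<phi> y = \<phi> x"
  shows "cond w \<phi> x = \<phi> x"
proof -
  have "(\<Sum>y\<in>fib w x. \<rho> y * \<phi> y) = (\<Sum>y\<in>fib w x. \<rho> y) * \<phi> x"
    unfolding sum_distrib_right using assms(2) by (intro sum.cong) auto
  then show ?thesis using sum_fib_pos[OF assms(1), of w] by (simp add: cond_def)
qed

lemma abs_cond_le:
  assumes "x \<in> X" "\<And>y. y \<in> X \<Longrightarrow> \<bar>\<phi> y\<bar> \<le> B"
  shows "\<bar>cond w \<phi> x\<bar> \<le> B"
proof -
  have "\<bar>\<Sum>y\<in>fib w x. \<rho> y * \<phi> y\<bar> \<le> (\<Sum>y\<in>fib w x. \<rho> y * B)"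
    using assms(2) fibD fib_pos
    by (intro order.trans[OF sum_abs] sum_mono) (auto simp: abs_mult abs_of_pos intro!: mult_left_mono less_imp_le)
  also have "\<dots> = sum \<rho> (fib w x) * B" by (simp add: sum_distrib_right)
  finally show ?thesis using sum_fib_pos[OF assms(1), of w]
    by (simp add: cond_def abs_divide pos_divide_le_eq mult.commute)
qed

lemma sum_resample: "sum (resample w \<zeta>) X = sum \<zeta> X"
  using duality[of w \<zeta> "\<lambda>_. 1"] cond_const[of _ w "\<lambda>_. 1"] by (simp cong: sum.cong)

lemma resample_nonneg: "(\<And>x. x \<in> X \<Longrightarrow> 0 \<le> \<zeta> x) \<Longrightarrow> x \<in> X \<Longrightarrow> 0 \<le> resample w \<zeta> x"
  using fibD pos[of x] sum_fib_pos[of x w] sum_nonneg[of "fib w x" \<zeta>]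
  by (auto simp: resample_def less_imp_le)

lemma resample_pos:
  assumes "\<And>x. x \<in> X \<Longrightarrow> 0 \<le> \<zeta> x" "x \<in> X" "0 < \<zeta> x"
  shows "0 < resample w \<zeta> x"
proof -
  have "0 < sum \<zeta> (fib w x)"
    using self_fib[OF assms(2)] assms fibD fin_fib by (intro sum_pos2[where i = x]) auto
  then show ?thesis using pos[OF assms(2)] sum_fib_pos[OF assms(2), of w] by (simp add: resample_def)
qed

lemma is_prob_resample: "is_prob \<zeta> \<Longrightarrow> is_prob (resample w \<zeta>)"
  using resample_nonneg sum_resample by (auto simp: is_prob_def)

text \<open>The logarithmic density of \<open>resample w \<zeta>\<close> is constant on fibres, so
  by \<open>duality\<close> it has the same mean under \<open>\<zeta>\<close>. The entropy drop is
  therefore exactly the relative entropy of \<open>\<zeta>\<close> with respect to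
  \<open>resample w \<zeta>\<close>, and \<open>kl_lower_bound\<close> applies.\<close>

lemma relent_resample:
  assumes "is_prob \<zeta>"
  shows "relent (resample w \<zeta>) + (defect w \<zeta>)\<^sup>2 / 4 \<le> relent \<zeta>"
proof -
  have nn: "\<And>x. x \<in> X \<Longrightarrow> 0 \<le> \<zeta> x" using assms by (simp add: is_prob_def)
  let ?g = "\<lambda>x. ln (resample w \<zeta> x / \<rho> x)"
  have g: "?g x = ln (sum \<zeta> (fib w x) / sum \<rho> (fib w x))" if "x \<in> X" for x
    using pos[OF that] by (simp add: resample_def)
  have "relent (resample w \<zeta>) = (\<Sum>x\<in>X. \<zeta> x * cond w ?g x)"
    by (simp add: relent_def flip: duality)
  also have "\<dots> = (\<Sum>x\<in>X. \<zeta> x * ?g x)"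
  proof (intro sum.cong refl)
    fix x assume x: "x \<in> X"
    show "\<zeta> x * cond w ?g x = \<zeta> x * ?g x"
    proof (subst cond_const)
      fix y assume y: "y \<in> fib w x"
      then show "?g y = ?g x" using g[of y] g[of x] x fib_sub fib_eq[OF y] by auto
    qed (use x in auto)
  qed
  finally have eq: "relent \<zeta> - relent (resample w \<zeta>) = (\<Sum>x\<in>X. \<zeta> x * ln (\<zeta> x / \<rho> x) - \<zeta> x * ?g x)"
    by (simp add: relent_def sum_subtractf)
  also have "\<dots> = (\<Sum>x\<in>X. \<zeta> x * ln (\<zeta> x / resample w \<zeta> x))"
  proof (intro sum.cong refl)
    fix x assume x: "x \<in> X"
    show "\<zeta> x * ln (\<zeta> x / \<rho> x) - \<zeta> x * ?g x = \<zeta> x * ln (\<zeta> x / resample w \<zeta> x)"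
    proof (cases "\<zeta> x = 0")
      case False
      then have "0 < \<zeta> x" using nn[OF x] by simp
      then show ?thesis using resample_pos[of \<zeta> x w] nn x pos[OF x]
        by (simp add: ln_div algebra_simps)
    qed simp
  qed
  finally have eq: "relent \<zeta> - relent (resample w \<zeta>) = (\<Sum>x\<in>X. \<zeta> x * ln (\<zeta> x / resample w \<zeta> x))" .
  have "(defect w \<zeta>)\<^sup>2 \<le> 4 * (\<Sum>x\<in>X. \<zeta> x * ln (\<zeta> x / resample w \<zeta> x))"
    unfolding defect_def
  proof (rule kl_lower_bound)
    show "\<zeta> x = 0" if "x \<in> X" "resample w \<zeta> x = 0" for x
      using resample_pos[of \<zeta> x w] nn that by fastforce
  qed (use assms is_prob_resample[OF assms, of w] in \<open>auto simp: is_prob_def\<close>)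
  then show ?thesis using eq by simp
qed

section \<open>The backward Euler step: existence, dissipation and weak form\<close>

text \<open>\<open>implicit_euler I \<tau> \<zeta> \<xi>\<close>: \<open>\<xi>\<close> arises from \<open>\<zeta>\<close> by one backward Euler step of length \<open>\<tau>\<close> for the
  dynamics that resamples each \<open>w \<in> I\<close> at rate 1.\<close>

definition implicit_euler :: "'i set \<Rightarrow> real \<Rightarrow> ('x \<Rightarrow> real) \<Rightarrow> ('x \<Rightarrow> real) \<Rightarrow> bool" where
  "implicit_euler I \<tau> \<zeta> \<xi> \<longleftrightarrow>
    (\<forall>x\<in>X. (1 + \<tau> * card I) * \<xi> x = \<zeta> x + \<tau> * (\<Sum>w\<in>I. resample w \<xi> x))"

lemma sums_resample:
  assumes "\<And>x. x \<in> X \<Longrightarrow> (\<lambda>j. f j x) sums F x"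
  shows "(\<lambda>j. resample w (f j) x) sums resample w F x"
  unfolding resample_def using fib_sub assms by (intro sums_mult sums_sum) auto

lemma resample_divide: "resample w (\<lambda>x. f x / c) x = resample w f x / c"
  by (simp add: resample_def flip: sum_divide_distrib)

text \<open>A Neumann series: \<open>F = (1 + \<tau> * N) \<xi>\<close> has to solve
  \<open>F = \<zeta> + c A F\<close>. The map \<open>A\<close> preserves positivity and multiplies
  the total mass by \<open>N\<close>, so the series has nonnegative terms and converges
  geometrically because \<open>c * N < 1\<close>.\<close>

lemma implicit_euler_exists:
  assumes "is_prob \<zeta>" "finite I" "0 < \<tau>"
  obtains \<xi> where "is_prob \<xi>" "implicit_euler I \<tau> \<zeta> \<xi>"
proof -
  define A where "A \<zeta> x = (\<Sum>w\<in>I. resample w \<zeta> x)" for \<zeta> x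
  define N where "N = real (card I)"
  define c where "c = \<tau> / (1 + \<tau> * N)"
  have N: "N \<ge> 0" by (simp add: N_def)
  have c: "c \<ge> 0" "c * N < 1" using assms(3) N
    by (auto simp: c_def divide_simps add_pos_nonneg)
  define f where "f j x = c ^ j * (A ^^ j) \<zeta> x" for j x
  have A: "(\<forall>x\<in>X. 0 \<le> (A ^^ j) \<zeta> x) \<and> sum ((A ^^ j) \<zeta>) X = N ^ j" for j
  proof (induction j)
    case 0
    then show ?case using assms(1) by (simp add: is_prob_def)
  next
    case (Suc j)
    have "sum (A ((A ^^ j) \<zeta>)) X = (\<Sum>w\<in>I. sum (resample w ((A ^^ j) \<zeta>)) X)"
      unfolding A_def by (rule sum.swap)
    then show ?case using Suc resample_nonneg
      by (auto simp: sum_resample N_def A_def[of "(A ^^ j) \<zeta>"] intro!: sum_nonneg)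
  qed
  have sm: "summable (\<lambda>j. f j x)" if "x \<in> X" for x
  proof (rule summable_comparison_test)
    \<comment> \<open>A nonnegative function is bounded pointwise by its total mass.\<close>
    have "(A ^^ j) \<zeta> x \<le> N ^ j" for j
      using A[of j] member_le_sum[of x X "(A ^^ j) \<zeta>"] that fin by auto
    then show "\<exists>n0. \<forall>j\<ge>n0. norm (f j x) \<le> (c * N) ^ j"
      using A that c by (auto simp: f_def abs_mult power_mult_distrib intro!: mult_left_mono)
    show "summable (\<lambda>j. (c * N) ^ j)" using c N by (intro summable_geometric) auto
  qed
  define F where "F x = (\<Sum>j. f j x)" for x
  have Fs: "(\<lambda>j. f j x) sums F x" if "x \<in> X" for x
    using sm[OF that] by (simp add: F_def summable_sums)
  have Fe: "F x = \<zeta> x + c * A F x" if x: "x \<in> X" for x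
  proof -
    have "(\<lambda>j. c * (\<Sum>w\<in>I. resample w (f j) x)) sums (c * A F x)"
      unfolding A_def using Fs by (intro sums_mult sums_sum sums_resample) auto
    moreover have "c * (\<Sum>w\<in>I. resample w (f j) x) = f (Suc j) x" for j
      by (simp add: f_def A_def[of "(A ^^ j) \<zeta>"] resample_def sum_distrib_left sum_divide_distrib mult_ac)
    ultimately have "(\<lambda>j. f (Suc j) x) sums (c * A F x)" by simp
    then have "(\<lambda>j. f j x) sums (c * A F x + f 0 x)" by (rule sums_Suc)
    then show ?thesis using Fs[OF x] sums_unique2 by (fastforce simp: f_def)
  qed
  define \<xi> where "\<xi> x = F x / (1 + \<tau> * N)" for x
  have p: "1 + \<tau> * N > 0" using N assms(3) by (simp add: add_pos_nonneg)
  have eq: "(1 + \<tau> * N) * \<xi> x = \<zeta> x + \<tau> * A \<xi> x" if x: "x \<in> X" for x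
  proof -
    have "A \<xi> x = A F x / (1 + \<tau> * N)"
      by (simp add: A_def \<xi>_def[abs_def] resample_divide sum_divide_distrib)
    then show ?thesis using Fe[OF x] p by (simp add: \<xi>_def c_def)
  qed
  have "implicit_euler I \<tau> \<zeta> \<xi>" using eq by (simp add: implicit_euler_def A_def N_def)
  moreover have "is_prob \<xi>"
  proof -
    have "0 \<le> F x" if "x \<in> X" for x
      unfolding F_def using sm[OF that] A that c by (intro suminf_nonneg) (auto simp: f_def)
    then have nn: "\<forall>x\<in>X. 0 \<le> \<xi> x" using p by (simp add: \<xi>_def)
    have "(1 + \<tau> * N) * sum \<xi> X = (\<Sum>x\<in>X. \<zeta> x + \<tau> * A \<xi> x)"
      using eq by (simp add: sum_distrib_left)
    also have "\<dots> = 1 + \<tau> * (\<Sum>w\<in>I. sum (resample w \<xi>) X)"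
      using assms(1) sum.swap[of "\<lambda>x w. resample w \<xi> x" I X]
      by (simp add: sum.distrib A_def is_prob_def flip: sum_distrib_left)
    also have "\<dots> = 1 + \<tau> * N * sum \<xi> X" by (simp add: sum_resample N_def)
    finally have "sum \<xi> X = 1" by (simp add: algebra_simps)
    then show ?thesis using nn by (simp add: is_prob_def)
  qed
  ultimately show thesis using that by blast
qed

text \<open>Gibbs' inequality: the difference of the two sides is the relative entropy of
  \<open>\<zeta>\<close> with respect to \<open>\<xi>\<close>.\<close>

lemma relent_ge_cross:
  assumes "is_prob \<zeta>" "is_prob \<xi>" "\<And>x. x \<in> X \<Longrightarrow> \<xi> x = 0 \<Longrightarrow> \<zeta> x = 0"
  shows "(\<Sum>x\<in>X. \<zeta> x * ln (\<xi> x / \<rho> x)) \<le> relent \<zeta>"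
proof -
  have "0 \<le> 4 * (\<Sum>x\<in>X. \<zeta> x * ln (\<zeta> x / \<xi> x))"
    using assms by (intro order.trans[OF _ kl_lower_bound]) (auto simp: is_prob_def)
  also have "(\<Sum>x\<in>X. \<zeta> x * ln (\<zeta> x / \<xi> x)) = (\<Sum>x\<in>X. \<zeta> x * ln (\<zeta> x / \<rho> x) - \<zeta> x * ln (\<xi> x / \<rho> x))"
  proof (intro sum.cong refl)
    fix x assume x: "x \<in> X"
    show "\<zeta> x * ln (\<zeta> x / \<xi> x) = \<zeta> x * ln (\<zeta> x / \<rho> x) - \<zeta> x * ln (\<xi> x / \<rho> x)"
    proof (cases "\<zeta> x = 0")
      case False
      then have "0 < \<zeta> x" "0 < \<xi> x" using assms x by (force simp: is_prob_def less_le)+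
      then show ?thesis using pos[OF x] by (simp add: ln_div algebra_simps)
    qed simp
  qed
  finally show ?thesis by (simp add: relent_def sum_subtractf)
qed

text \<open>The Euler equation writes \<open>\<xi>\<close> as a convex combination of \<open>\<zeta>\<close> and the \<open>resample w \<xi>\<close>;
  convexity of the relative entropy does the rest.\<close>

lemma relent_implicit_euler:
  assumes \<zeta>: "is_prob \<zeta>" and \<xi>: "is_prob \<xi>" and "finite I" and "0 < \<tau>"
    and e: "implicit_euler I \<tau> \<zeta> \<xi>"
  shows "relent \<xi> + \<tau> / 4 * (\<Sum>w\<in>I. (defect w \<xi>)\<^sup>2) \<le> relent \<zeta>"
proof -
  let ?g = "\<lambda>x. ln (\<xi> x / \<rho> x)"
  have nn: "0 \<le> \<zeta> x" "0 \<le> \<xi> x" "0 \<le> resample w \<xi> x" if "x \<in> X" for x w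
    using that \<zeta> \<xi> is_prob_resample[OF \<xi>, of w] by (auto simp: is_prob_def)
  \<comment> \<open>Both terms on the right of the Euler equation are nonnegative, so they vanish
    where \<open>\<xi>\<close> does; this is the absolute continuity that
    \<open>relent_ge_cross\<close> asks for.\<close>
  have z: "\<zeta> x = 0 \<and> (\<forall>w\<in>I. resample w \<xi> x = 0)" if "x \<in> X" "\<xi> x = 0" for x
  proof -
    have "\<zeta> x + \<tau> * (\<Sum>w\<in>I. resample w \<xi> x) = 0" using e that by (auto simp: implicit_euler_def)
    moreover have s: "0 \<le> (\<Sum>w\<in>I. resample w \<xi> x)" using nn that by (intro sum_nonneg) auto
    moreover have "0 \<le> \<tau> * (\<Sum>w\<in>I. resample w \<xi> x)" using s assms(4) by simp
    ultimately have "\<zeta> x = 0" "\<tau> * (\<Sum>w\<in>I. resample w \<xi> x) = 0" using nn(1)[OF that(1)] by linarith+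
    then show ?thesis using assms(3,4) nn that(1) by (auto simp: sum_nonneg_eq_0_iff)
  qed
  have 1: "(\<Sum>x\<in>X. \<zeta> x * ?g x) \<le> relent \<zeta>" using \<zeta> \<xi> z by (intro relent_ge_cross) auto
  have 2: "(\<Sum>x\<in>X. resample w \<xi> x * ?g x) \<le> relent \<xi> - (defect w \<xi>)\<^sup>2 / 4" if "w \<in> I" for w
    using relent_ge_cross[OF is_prob_resample[OF \<xi>] \<xi>, of w] z that relent_resample[OF \<xi>, of w] by fastforce
  have "(1 + \<tau> * card I) * relent \<xi> = (\<Sum>x\<in>X. ((1 + \<tau> * card I) * \<xi> x) * ?g x)"
    by (simp add: relent_def sum_distrib_left mult_ac)
  also have "\<dots> = (\<Sum>x\<in>X. (\<zeta> x + \<tau> * (\<Sum>w\<in>I. resample w \<xi> x)) * ?g x)"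
    using e by (intro sum.cong refl) (simp add: implicit_euler_def)
  also have "\<dots> = (\<Sum>x\<in>X. \<zeta> x * ?g x) + \<tau> * (\<Sum>x\<in>X. \<Sum>w\<in>I. resample w \<xi> x * ?g x)"
    by (simp add: ring_distribs sum.distrib sum_distrib_left sum_distrib_right mult_ac)
  also have "(\<Sum>x\<in>X. \<Sum>w\<in>I. resample w \<xi> x * ?g x) = (\<Sum>w\<in>I. \<Sum>x\<in>X. resample w \<xi> x * ?g x)"
    by (rule sum.swap)
  also have "(\<Sum>x\<in>X. \<zeta> x * ?g x) + \<tau> * \<dots> \<le> relent \<zeta> + \<tau> * (\<Sum>w\<in>I. relent \<xi> - (defect w \<xi>)\<^sup>2 / 4)"
    using 1 2 assms(4) by (intro add_mono mult_left_mono sum_mono) auto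
  also have "\<dots> = relent \<zeta> + \<tau> * card I * relent \<xi> - \<tau> / 4 * (\<Sum>w\<in>I. (defect w \<xi>)\<^sup>2)"
    by (simp add: sum_subtractf algebra_simps flip: sum_divide_distrib)
  finally show ?thesis by (simp add: algebra_simps)
qed

text \<open>The weak form of the Euler equation; \<open>duality\<close> moves each kernel from
  \<open>\<xi>\<close> to \<open>\<phi>\<close>.\<close>

lemma implicit_euler_pairing:
  assumes "implicit_euler I \<tau> \<zeta> \<xi>" "finite I"
  shows "(\<Sum>x\<in>X. \<zeta> x * \<phi> x) = (\<Sum>x\<in>X. \<xi> x * (\<phi> x - \<tau> * (\<Sum>w\<in>I. cond w \<phi> x - \<phi> x)))"
proof -
  have "(\<Sum>x\<in>X. \<zeta> x * \<phi> x) = (\<Sum>x\<in>X. ((1 + \<tau> * card I) * \<xi> x - \<tau> * (\<Sum>w\<in>I. resample w \<xi> x)) * \<phi> x)"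
    using assms by (intro sum.cong refl) (simp add: implicit_euler_def)
  also have "\<dots> = (1 + \<tau> * card I) * (\<Sum>x\<in>X. \<xi> x * \<phi> x) - \<tau> * (\<Sum>x\<in>X. \<Sum>w\<in>I. resample w \<xi> x * \<phi> x)"
    unfolding sum_distrib_left sum_subtractf[symmetric]
    by (intro sum.cong refl) (simp add: algebra_simps sum_distrib_left)
  also have "(\<Sum>x\<in>X. \<Sum>w\<in>I. resample w \<xi> x * \<phi> x) = (\<Sum>w\<in>I. \<Sum>x\<in>X. \<xi> x * cond w \<phi> x)"
    by (subst sum.swap) (simp add: duality)
  also have "\<dots> = (\<Sum>x\<in>X. \<Sum>w\<in>I. \<xi> x * cond w \<phi> x)"
    by (rule sum.swap)
  finally show ?thesis
    by (simp add: algebra_simps sum.distrib sum_subtractf sum_distrib_left)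
qed

text \<open>By \<open>duality\<close>, \<open>\<phi>\<close> is paired with
  \<open>resample w \<zeta> - \<zeta>\<close>, whose l1 norm is the defect.\<close>

lemma defect_bound:
  assumes "\<And>x. x \<in> X \<Longrightarrow> \<bar>\<phi> x\<bar> \<le> B"
  shows "\<bar>\<Sum>x\<in>X. \<zeta> x * (cond w \<phi> x - \<phi> x)\<bar> \<le> B * defect w \<zeta>"
proof -
  have "(\<Sum>x\<in>X. \<zeta> x * (cond w \<phi> x - \<phi> x)) = (\<Sum>x\<in>X. (resample w \<zeta> x - \<zeta> x) * \<phi> x)"
    using duality[of w \<zeta> \<phi>] by (simp add: algebra_simps sum_subtractf)
  also have "\<bar>\<dots>\<bar> \<le> (\<Sum>x\<in>X. B * \<bar>\<zeta> x - resample w \<zeta> x\<bar>)"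
    using assms by (intro order.trans[OF sum_abs] sum_mono)
      (auto simp: abs_mult abs_minus_commute mult.commute[of B] intro!: mult_left_mono)
  finally show ?thesis by (simp add: defect_def sum_distrib_left)
qed

end


section \<open>Fixed points in sofic approximations\<close>

text \<open>Words in the generators and their inverses trace paths, which is what a ball isomorphism
  can see.\<close>

lemma generated_sum_list:
  assumes "g \<in> generated_subgroup X"
  shows "\<exists>l. set l \<subseteq> X \<union> uminus ` X \<and> sum_list l = g"
  using assms
proof induction
  case zero
  then show ?case by (intro exI[of _ "[]"]) auto
next
  case (incl x)
  then show ?case by (intro exI[of _ "[x]"]) auto
next
  case (minus x)
  then obtain l where l: "set l \<subseteq> X \<union> uminus ` X" "sum_list l = x" by blast
  have "sum_list (rev (map uminus l)) = - sum_list l" for l :: "'a list"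
    by (induction l) (auto simp: minus_add)
  then show ?case using l by (intro exI[of _ "rev (map uminus l)"]) force
next
  case (plus x y)
  then obtain l l' where "set l \<subseteq> X \<union> uminus ` X" "sum_list l = x"
    "set l' \<subseteq> X \<union> uminus ` X" "sum_list l' = y" by blast
  then show ?case by (intro exI[of _ "l @ l'"]) auto
qed

lemma hom_add: "hom_to_Sym V \<sigma> \<Longrightarrow> \<sigma> (a + b) v = \<sigma> a (\<sigma> b v)"
  by (simp add: hom_to_Sym_def)

lemma hom_in: "hom_to_Sym V \<sigma> \<Longrightarrow> v \<in> V \<Longrightarrow> \<sigma> g v \<in> V"
  by (simp add: hom_to_Sym_def permutes_in_image)

lemma hom_zero: assumes "hom_to_Sym V \<sigma>" shows "\<sigma> 0 v = v"
proof -
  have "inj (\<sigma> 0)" using assms by (auto simp: hom_to_Sym_def intro: permutes_inj)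
  then show ?thesis using hom_add[OF assms, of 0 0 v] by (simp add: inj_eq)
qed

lemma hom_inv: "hom_to_Sym V \<sigma> \<Longrightarrow> \<sigma> (- g) (\<sigma> g v) = v" "hom_to_Sym V \<sigma> \<Longrightarrow> \<sigma> g (\<sigma> (- g) v) = v"
  by (simp_all add: hom_zero flip: hom_add)

lemma hom_bij: "hom_to_Sym V \<sigma> \<Longrightarrow> bij_betw (\<sigma> g) V V"
  by (auto simp: hom_to_Sym_def permutes_imp_bij)

lemma word_path:
  assumes "hom_to_Sym V \<sigma>" "v \<in> V" "set l \<subseteq> s ` {1..r} \<union> uminus ` s ` {1..r}"
  shows "(v, \<sigma> (sum_list l) v) \<in> adjacency (action_graph r s V \<sigma>) ^^ length l"
  using assms(3)
proof (induction l)
  case Nil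
  then show ?case using hom_zero[OF assms(1)] by simp
next
  case (Cons y l)
  let ?u = "\<sigma> (sum_list l) v"
  have u: "?u \<in> V" using hom_in[OF assms(1,2)] .
  obtain i where i: "i \<in> {1..r}" "y = s i \<or> y = - s i" using Cons.prems by auto
  have "(?u, \<sigma> y ?u) \<in> adjacency (action_graph r s V \<sigma>)"
  proof (cases "y = s i")
    case True
    then show ?thesis using i u by (auto simp: adjacency_def action_graph_def)
  next
    case False
    then have "y = - s i" using i by simp
    then show ?thesis using i hom_in[OF assms(1) u] hom_inv[OF assms(1)]
      by (auto simp: adjacency_def action_graph_def intro!: exI[of _ i])
  qed
  then show ?case using Cons by (auto simp: hom_add[OF assms(1)])
qed

lemma graph_ballI: "(v, w) \<in> adjacency E ^^ k \<Longrightarrow> k \<le> R \<Longrightarrow> w \<in> graph_ball E v R"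
  unfolding graph_ball_def graph_dist_def
  by (auto intro!: INF_lower2[of k])

text \<open>A ball isomorphism intertwines the two actions along words staying in the ball; it need not
  map \<open>v\<close> to \<open>0\<close> for this.\<close>

lemma word_not_fixed:
  assumes \<sigma>: "hom_to_Sym V \<sigma>" and v: "v \<in> V"
    and iso: "induced_isomorphic (action_graph r s V \<sigma>) (graph_ball (action_graph r s V \<sigma>) v R)
                (cayley_graph r s) (graph_ball (cayley_graph r s) 0 R)"
    and l: "set l \<subseteq> s ` {1..r} \<union> uminus ` s ` {1..r}" "length l \<le> R"
    and fix_v: "\<sigma> (sum_list l) v = v"
  shows "sum_list l = 0"
proof -
  let ?B = "graph_ball (action_graph r s V \<sigma>) v R"
  obtain \<phi> where \<phi>: "\<And>x y i. x \<in> ?B \<Longrightarrow> y \<in> ?B \<Longrightarrow>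
      (x, i, y) \<in> action_graph r s V \<sigma> \<longleftrightarrow> (\<phi> x, i, \<phi> y) \<in> cayley_graph r s"
    using iso by (auto simp: induced_isomorphic_def)
  have "\<phi> (\<sigma> (sum_list l) v) = sum_list l + \<phi> v"
    using l
  proof (induction l)
    case Nil
    then show ?case using hom_zero[OF \<sigma>] by simp
  next
    case (Cons y l)
    let ?u = "\<sigma> (sum_list l) v"
    have u: "?u \<in> V" "\<sigma> y ?u \<in> V" using hom_in[OF \<sigma>] v by auto
    have uB: "?u \<in> ?B" by (rule graph_ballI[OF word_path[OF \<sigma> v, of l s r]]) (use Cons.prems in auto)
    have yB: "\<sigma> y ?u \<in> ?B"
    proof -
      have "(v, \<sigma> (sum_list (y # l)) v) \<in> adjacency (action_graph r s V \<sigma>) ^^ length (y # l)"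
        using Cons.prems by (intro word_path[OF \<sigma> v])
      from graph_ballI[OF this Cons.prems(2)] show ?thesis by (simp add: hom_add[OF \<sigma>])
    qed
    obtain i where i: "i \<in> {1..r}" "y = s i \<or> y = - s i" using Cons.prems by auto
    have "\<phi> (\<sigma> y ?u) = y + \<phi> ?u"
    proof (cases "y = s i")
      case True
      have "(?u, i, \<sigma> y ?u) \<in> action_graph r s V \<sigma>" using True i u by (auto simp: action_graph_def)
      then show ?thesis using \<phi>[OF uB yB] True by (auto simp: cayley_graph_def)
    next
      case False
      then have y: "y = - s i" using i by simp
      have "(\<sigma> y ?u, i, ?u) \<in> action_graph r s V \<sigma>"
        using y i u hom_inv[OF \<sigma>] by (auto simp: action_graph_def)
      then have "\<phi> ?u = s i + \<phi> (\<sigma> y ?u)" using \<phi>[OF yB uB] by (auto simp: cayley_graph_def)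
      then show ?thesis using y by (simp add: add.assoc[symmetric])
    qed
    then show ?case using Cons by (simp add: hom_add[OF \<sigma>] add.assoc)
  qed
  then have "0 + \<phi> v = sum_list l + \<phi> v" using fix_v by simp
  then show ?thesis by (metis add_right_cancel)
qed

text \<open>A radius \<open>R\<close> witnessing that \<open>sofic_Delta\<close> is small has small
  \<open>sofic_delta\<close> and, as \<open>9 * (2/3) ^ R\<close> is small too, exceeds the length
  of a word for \<open>g\<close>. By \<open>word_not_fixed\<close>, every vertex fixed by
  \<open>g\<close> then has a degenerate ball of radius \<open>R\<close>.\<close>

lemma sofic_fixed_fraction:
  fixes s :: "nat \<Rightarrow> 'g::group_add"
  assumes gen: "generated_subgroup (s ` {1..r}) = UNIV"
    and \<sigma>: "\<And>n. finite (V n)" "\<And>n. V n \<noteq> {}" "\<And>n. hom_to_Sym (V n) (\<sigma> n)"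
    and D: "(\<lambda>n. sofic_Delta r s (V n) (\<sigma> n)) \<longlonglongrightarrow> 0"
    and g: "g \<noteq> 0"
  shows "(\<lambda>n. real (card {v \<in> V n. \<sigma> n g v = v}) / card (V n)) \<longlonglongrightarrow> 0"
proof -
  have "g \<in> generated_subgroup (s ` {1..r})" using gen by simp
  from generated_sum_list[OF this]
  obtain l where l: "set l \<subseteq> s ` {1..r} \<union> uminus ` s ` {1..r}" "sum_list l = g" by blast
  show ?thesis
  proof (rule LIMSEQ_I, goal_cases)
    case (1 e)
    \<comment> \<open>The first entry makes the fraction smaller than \<open>e\<close>; the second
      forces \<open>length l < R\<close> by comparing powers of 2/3.\<close>
    define \<eta> where "\<eta> = min e (9 * (2/3) ^ length l)"
    have "\<eta> > 0" using 1 by (simp add: \<eta>_def)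
    from order_tendstoD(2)[OF D this] obtain n0
      where n0: "\<And>n. n \<ge> n0 \<Longrightarrow> sofic_Delta r s (V n) (\<sigma> n) < \<eta>"
      by (auto simp: eventually_sequentially)
    show ?case
    proof (intro exI[of _ n0] allI impI)
      fix n assume "n \<ge> n0"
      let ?d = "sofic_delta r s (V n) (\<sigma> n)"
      have d0: "0 \<le> ?d R" for R by (simp add: sofic_delta_def)
      obtain R where R: "9 * (2/3) ^ R + 6 * ?d R < \<eta>"
        using n0[OF \<open>n \<ge> n0\<close>] cInf_lessD[of "range (\<lambda>R. 9 * (2/3) ^ R + 6 * ?d R)" \<eta>]
        unfolding sofic_Delta_def by blast
      have "\<eta> \<le> 9 * (2/3) ^ length l" by (simp add: \<eta>_def)
      then have "9 * (2/3::real) ^ R < 9 * (2/3) ^ length l" using R d0[of R] by linarith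
      then have "length l < R"
        using power_decreasing[of R "length l" "2/3::real"] by (cases "R \<le> length l") auto
      have "real (card {v \<in> V n. \<sigma> n g v = v}) / card (V n) \<le> ?d R"
        unfolding sofic_delta_def
      proof (intro divide_right_mono of_nat_mono card_mono subsetI CollectI)
        fix v assume "v \<in> {v \<in> V n. \<sigma> n g v = v}"
        then show "v \<in> V n \<and> \<not> induced_isomorphic (action_graph r s (V n) (\<sigma> n))
            (graph_ball (action_graph r s (V n) (\<sigma> n)) v R) (cayley_graph r s)
            (graph_ball (cayley_graph r s) 0 R)"
          using word_not_fixed[OF \<sigma>(3), of v n r s R l] l g \<open>length l < R\<close> by auto
      qed (use \<sigma> in auto)
      also have "\<dots> < e"
      proof -
        have "6 * ?d R < e" using R by (simp add: \<eta>_def) (smt (verit) zero_le_power divide_nonneg_nonneg)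
        then show ?thesis using d0[of R] by linarith
      qed
      finally show "norm (real (card {v \<in> V n. \<sigma> n g v = v}) / real (card (V n)) - 0) < e"
        by simp
    qed
  qed
qed

lemma sofic_fixed_fraction_finite:
  fixes s :: "nat \<Rightarrow> 'g::group_add"
  assumes gen: "generated_subgroup (s ` {1..r}) = UNIV"
    and \<sigma>: "\<And>n. finite (V n)" "\<And>n. V n \<noteq> {}" "\<And>n. hom_to_Sym (V n) (\<sigma> n)"
    and D: "(\<lambda>n. sofic_Delta r s (V n) (\<sigma> n)) \<longlonglongrightarrow> 0"
    and E: "finite E" "0 \<notin> E"
  shows "(\<lambda>n. real (card {v \<in> V n. \<exists>g\<in>E. \<sigma> n g v = v}) / card (V n)) \<longlonglongrightarrow> 0"
proof (rule tendsto_sandwich[OF _ _ tendsto_const])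
  show "(\<lambda>n. \<Sum>g\<in>E. real (card {v \<in> V n. \<sigma> n g v = v}) / card (V n)) \<longlonglongrightarrow> 0"
    using E(2) by (intro tendsto_null_sum sofic_fixed_fraction[OF gen \<sigma> D]) metis+
  have "real (card {v \<in> V n. \<exists>g\<in>E. \<sigma> n g v = v}) \<le> (\<Sum>g\<in>E. real (card {v \<in> V n. \<sigma> n g v = v}))" for n
  proof -
    have "{v \<in> V n. \<exists>g\<in>E. \<sigma> n g v = v} = (\<Union>g\<in>E. {v \<in> V n. \<sigma> n g v = v})" by auto
    then show ?thesis using card_UN_le[OF E(1), of "\<lambda>g. {v \<in> V n. \<sigma> n g v = v}"]
      by (simp flip: of_nat_sum)
  qed
  then show "\<forall>\<^sub>F n in sequentially. real (card {v \<in> V n. \<exists>g\<in>E. \<sigma> n g v = v}) / card (V n)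
      \<le> (\<Sum>g\<in>E. real (card {v \<in> V n. \<sigma> n g v = v}) / card (V n))"
    by (intro always_eventually allI) (simp add: divide_right_mono flip: sum_divide_distrib)
qed auto


section \<open>Local functions and measures on configurations\<close>

definition depends_on :: "'g set \<Rightarrow> (('g \<Rightarrow> 'a) \<Rightarrow> 'b) \<Rightarrow> bool" where
  "depends_on W f \<longleftrightarrow> (\<forall>x y. (\<forall>\<beta>\<in>W. x \<beta> = y \<beta>) \<longrightarrow> f x = f y)"

definition local :: "(('g \<Rightarrow> 'a) \<Rightarrow> 'b) \<Rightarrow> bool" where
  "local f \<longleftrightarrow> (\<exists>W. finite W \<and> depends_on W f)"

lemma depends_onD: "depends_on W f \<Longrightarrow> (\<And>\<beta>. \<beta> \<in> W \<Longrightarrow> x \<beta> = y \<beta>) \<Longrightarrow> f x = f y"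
  by (simp add: depends_on_def)

lemma depends_on_mono: "depends_on W f \<Longrightarrow> W \<subseteq> W' \<Longrightarrow> depends_on W' f"
  unfolding depends_on_def by blast

lemma local_comp2:
  assumes "local f" "local g"
  shows "local (\<lambda>x. F (f x) (g x))"
proof -
  obtain W W' where "finite W" "depends_on W f" "finite W'" "depends_on W' g"
    using assms by (auto simp: local_def)
  moreover have "F (f x) (g x) = F (f y) (g y)" if "\<forall>\<beta>\<in>W \<union> W'. x \<beta> = y \<beta>" for x y
    using that depends_onD[OF \<open>depends_on W f\<close>, of x y] depends_onD[OF \<open>depends_on W' g\<close>, of x y] by simp
  ultimately have "finite (W \<union> W')" "depends_on (W \<union> W') (\<lambda>x. F (f x) (g x))"
    by (auto simp: depends_on_def)
  then show ?thesis unfolding local_def by blast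
qed

lemma local_const [simp]: "local (\<lambda>x. c)"
  unfolding local_def depends_on_def by auto

lemma local_comp: "local f \<Longrightarrow> local (\<lambda>x. F (f x))"
  using local_comp2[of f f "\<lambda>a b. F a"] by simp

lemma local_apply [simp]: "local (\<lambda>x. x \<gamma>)"
  unfolding local_def depends_on_def by (intro exI[of _ "{\<gamma>}"]) auto

lemma local_sum: "(\<And>i. i \<in> I \<Longrightarrow> local (f i)) \<Longrightarrow> local (\<lambda>x. \<Sum>i\<in>I. f i x)"
  by (induction I rule: infinite_finite_induct) (auto intro: local_comp2)

lemma local_upd: assumes "local f" shows "local (\<lambda>x. f (x(\<gamma> := a)))"
proof -
  obtain W where "finite W" "depends_on W f" using assms by (auto simp: local_def)
  then show ?thesis unfolding local_def by (intro exI[of _ W]) (auto simp: depends_on_def)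
qed

lemma local_open:
  fixes P :: "('g \<Rightarrow> 'a::discrete_topology) \<Rightarrow> bool"
  assumes "local P"
  shows "open {x. P x}"
proof -
  obtain W where W: "finite W" "depends_on W P" using assms by (auto simp: local_def)
  have "{x. P x} = (\<Union>x\<in>{x. P x}. {y. \<forall>\<beta>\<in>W. y \<beta> \<in> {x \<beta>}})"
    using W(2) by (auto simp: depends_on_def)
  also have "open \<dots>"
    using W(1) discrete_topology_class.open_discrete
    by (intro open_UN ballI product_topology_basis'[of W _ id, simplified]) auto
  finally show ?thesis .
qed

lemma local_continuous:
  fixes f :: "('g \<Rightarrow> 'a::discrete_topology) \<Rightarrow> 'b::topological_space"
  assumes "local f"
  shows "continuous_on UNIV f"
  unfolding continuous_on_open_vimage[OF open_UNIV]
proof (intro allI impI)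
  fix B :: "'b set"
  have "open {x. f x \<in> B}" by (rule local_open[OF local_comp[OF assms, of "\<lambda>a. a \<in> B"]])
  then show "open (f -` B \<inter> UNIV)" by (simp add: vimage_def)
qed

lemma local_finite_range:
  fixes f :: "('g \<Rightarrow> 'a::finite) \<Rightarrow> 'b"
  assumes "local f"
  shows "finite (range f)"
proof -
  obtain W where W: "finite W" "depends_on W f" using assms by (auto simp: local_def)
  let ?S = "{x. \<forall>\<beta>. (\<beta> \<in> W \<longrightarrow> x \<beta> \<in> (UNIV :: 'a set)) \<and> (\<beta> \<notin> W \<longrightarrow> x \<beta> = undefined)}"
  have "f x \<in> f ` ?S" for x
  proof
    show "f x = f (\<lambda>\<beta>. if \<beta> \<in> W then x \<beta> else undefined)"
      by (rule depends_onD[OF W(2)]) simp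
  qed auto
  moreover have "finite ?S" using W(1) by (rule finite_set_of_finite_funs) simp
  ultimately show ?thesis by (meson finite_imageI finite_subset image_subsetI)
qed

section \<open>Continuous functions on the configuration space and their local approximation\<close>

definition loc_bcontfun :: "(('g \<Rightarrow> 'a::finite_discrete) \<Rightarrow> real) \<Rightarrow> ('g \<Rightarrow> 'a) \<Rightarrow>\<^sub>C real" where
  "loc_bcontfun f = Bcontfun f"

lemma apply_loc_bcontfun:
  assumes "local f" shows "apply_bcontfun (loc_bcontfun f) = f"
  unfolding loc_bcontfun_def
  using local_continuous[OF assms] local_finite_range[OF assms]
  by (intro Bcontfun_inverse) (auto simp: bcontfun_def finite_imp_bounded)

lemma compact_configurations: "compact (UNIV :: ('g \<Rightarrow> 'a::finite_discrete) set)"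
proof -
  have "compact_space (product_topology (\<lambda>_::'g. euclidean :: 'a topology) UNIV)"
    unfolding compact_space_product_topology by (auto simp: compact_space_def finite_imp_compact)
  then show ?thesis by (simp add: euclidean_product_topology compact_space_def)
qed

lemma open_contains_cylinder:
  fixes U :: "('g \<Rightarrow> 'a::topological_space) set"
  assumes "open U" "x \<in> U"
  shows "\<exists>W. finite W \<and> (\<forall>y. (\<forall>\<beta>\<in>W. y \<beta> = x \<beta>) \<longrightarrow> y \<in> U)"
proof -
  have "openin (product_topology (\<lambda>_::'g. euclidean :: 'a topology) UNIV) U"
    using assms(1) by (simp add: euclidean_product_topology)
  from product_topology_open_contains_basis[OF this assms(2)]
  obtain X where X: "x \<in> Pi\<^sub>E UNIV X" "finite {i. X i \<noteq> UNIV}" "Pi\<^sub>E UNIV X \<subseteq> U" by auto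
  show ?thesis
  proof (intro exI conjI allI impI)
    fix y assume y: "\<forall>\<beta>\<in>{i. X i \<noteq> UNIV}. y \<beta> = x \<beta>"
    have "y \<beta> \<in> X \<beta>" for \<beta> using y X(1) by (cases "X \<beta> = UNIV") (auto simp: PiE_def Pi_def)
    then show "y \<in> U" using X(3) by auto
  qed (rule X(2))
qed

text \<open>By compactness, finitely many cylinders cover the space on each of which
  \<open>f\<close> stays within \<open>e / 2\<close> of its value at a centre; \<open>W\<close>
  collects the coordinates that define them.\<close>

lemma uniformly_local:
  fixes f :: "('g \<Rightarrow> 'a::finite_discrete) \<Rightarrow> real"
  assumes "continuous_on UNIV f" "0 < e"
  obtains W where "finite W" "\<And>x y. (\<And>\<beta>. \<beta> \<in> W \<Longrightarrow> x \<beta> = y \<beta>) \<Longrightarrow> \<bar>f x - f y\<bar> < e"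
proof -
  have "\<exists>W. finite W \<and> (\<forall>y. (\<forall>\<beta>\<in>W. y \<beta> = x \<beta>) \<longrightarrow> y \<in> f -` ball (f x) (e / 2))" for x
    using assms by (intro open_contains_cylinder) (auto simp: continuous_on_open_vimage[OF open_UNIV])
  then obtain W where W: "\<And>x. finite (W x)"
    "\<And>x y. (\<And>\<beta>. \<beta> \<in> W x \<Longrightarrow> y \<beta> = x \<beta>) \<Longrightarrow> y \<in> f -` ball (f x) (e / 2)"
    by metis
  have op: "open {y. \<forall>\<beta>\<in>W x. y \<beta> = x \<beta>}" for x
  proof (rule local_open)
    show "local (\<lambda>y. \<forall>\<beta>\<in>W x. y \<beta> = x \<beta>)"
      unfolding local_def depends_on_def using W(1)[of x] by (intro exI[of _ "W x"]) auto
  qed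
  obtain D where D: "finite D" "UNIV \<subseteq> (\<Union>x\<in>D. {y. \<forall>\<beta>\<in>W x. y \<beta> = x \<beta>})"
    by (rule compactE_image[OF compact_configurations, of UNIV "\<lambda>x. {y. \<forall>\<beta>\<in>W x. y \<beta> = x \<beta>}"])
       (use op in auto)
  show thesis
  proof
    show "finite (\<Union>x\<in>D. W x)" using D(1) W(1) by auto
    fix x y :: "'g \<Rightarrow> 'a" assume xy: "\<And>\<beta>. \<beta> \<in> (\<Union>x\<in>D. W x) \<Longrightarrow> x \<beta> = y \<beta>"
    obtain z where z: "z \<in> D" "\<forall>\<beta>\<in>W z. x \<beta> = z \<beta>" using D(2) by auto
    have "x \<in> f -` ball (f z) (e / 2)" using z by (intro W(2)) auto
    moreover have "y \<in> f -` ball (f z) (e / 2)" using z xy by (intro W(2)) (metis UN_I)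
    ultimately have "\<bar>f z - f x\<bar> < e / 2" "\<bar>f z - f y\<bar> < e / 2" by (auto simp: dist_real_def)
    then show "\<bar>f x - f y\<bar> < e" by linarith
  qed
qed

text \<open>Composing a function with this map makes it depend on \<open>W\<close> only, without
  enlarging its oscillation at any site.\<close>

definition freeze :: "'g set \<Rightarrow> ('g \<Rightarrow> 'a) \<Rightarrow> 'g \<Rightarrow> 'a" where
  "freeze W x = (\<lambda>\<beta>. if \<beta> \<in> W then x \<beta> else undefined)"

lemma depends_on_freeze: "depends_on W (\<lambda>x. f (freeze W x))"
  unfolding depends_on_def freeze_def by (auto intro!: arg_cong[where f = f])

lemma local_freeze: "finite W \<Longrightarrow> local (\<lambda>x. f (freeze W x))"
  using depends_on_freeze local_def by blast

lemma local_approx: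
  fixes f :: "('g \<Rightarrow> 'a::finite_discrete) \<Rightarrow>\<^sub>C real"
  assumes "0 < e"
  obtains W where "finite W" "norm (loc_bcontfun (\<lambda>x. f (freeze W x)) - f) \<le> e"
proof -
  obtain W where W: "finite W" "\<And>x y. (\<And>\<beta>. \<beta> \<in> W \<Longrightarrow> x \<beta> = y \<beta>) \<Longrightarrow> \<bar>f x - f y\<bar> < e"
    using uniformly_local[OF continuous_on_apply_bcontfun[of UNIV f] assms] by blast
  show thesis
  proof
    show "norm (loc_bcontfun (\<lambda>x. f (freeze W x)) - f) \<le> e"
    proof (rule norm_bound)
      fix x
      have "\<bar>f (freeze W x) - f x\<bar> < e" by (rule W(2)) (simp add: freeze_def)
      then show "norm (apply_bcontfun (loc_bcontfun (\<lambda>x. f (freeze W x)) - f) x) \<le> e"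
        by (simp add: apply_loc_bcontfun[OF local_freeze[OF W(1)]])
    qed
  qed (rule W(1))
qed


section \<open>Cylinder sets, Borel probability measures and Riesz representation\<close>

definition local_sets :: "('g \<Rightarrow> 'a) set set" where
  "local_sets = {C. local (\<lambda>x. x \<in> C)}"

lemma algebra_local_sets: "algebra UNIV local_sets"
  unfolding algebra_iff_Un local_sets_def
  using local_comp2[of "\<lambda>x. x \<in> _" "\<lambda>x. x \<in> _" "(\<or>)"] local_comp[of "\<lambda>x. x \<in> _" "Not"] by auto

lemma local_sets_borel: "C \<in> local_sets \<Longrightarrow> C \<in> sets borel"
  for C :: "('g \<Rightarrow> 'a::discrete_topology) set"
  using local_open[of "\<lambda>x. x \<in> C"] by (auto simp: local_sets_def)

text \<open>As the index type is countable, the Borel sigma-algebra of the product is the product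
  sigma-algebra, which is generated by single coordinates.\<close>

lemma sets_borel_local:
  "sets borel = sigma_sets UNIV (local_sets :: ('g::countable \<Rightarrow> 'a::finite_discrete) set set)"
proof
  show "sigma_sets UNIV (local_sets :: ('g \<Rightarrow> 'a) set set) \<subseteq> sets borel"
    using sets.sigma_sets_subset[of local_sets borel] local_sets_borel by (auto simp: subset_iff)
  have "sets borel = sets (Pi\<^sub>M UNIV (\<lambda>_::'g. borel :: 'a measure))"
    by (rule sets_PiM_equal_borel[symmetric])
  also have "\<dots> \<subseteq> sigma_sets UNIV local_sets"
    unfolding sets_PiM_single
  proof (simp, rule sigma_sets_mono, safe)
    fix i :: 'g and A :: "'a set"
    show "{f. f i \<in> A} \<in> sigma_sets UNIV local_sets"
      by (intro sigma_sets.Basic) (simp add: local_sets_def local_comp[OF local_apply, of "\<lambda>a. a \<in> A"])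
  qed
  finally show "sets borel \<subseteq> sigma_sets UNIV (local_sets :: ('g \<Rightarrow> 'a) set set)" .
qed

lemma Prob_iff: "\<nu> \<in> Prob \<longleftrightarrow> sets \<nu> = sets borel \<and> prob_space \<nu>"
  by (simp add: space_prob_algebra)

lemma integrable_bcontfun:
  fixes f :: "'x::topological_space \<Rightarrow>\<^sub>C real"
  assumes "\<nu> \<in> Prob" shows "integrable \<nu> (apply_bcontfun f)"
proof -
  interpret prob_space \<nu> using assms by (simp add: Prob_iff)
  have "apply_bcontfun f \<in> borel_measurable \<nu>"
    using assms borel_measurable_continuous_onI[OF continuous_on_apply_bcontfun]
    by (simp add: Prob_iff cong: measurable_cong_sets)
  then show ?thesis by (rule integrable_const_bound[where B = "norm f", rotated])
    (use norm_bounded[of f] in auto)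
qed

lemma integrable_local:
  fixes f :: "('g \<Rightarrow> 'a::finite_discrete) \<Rightarrow> real"
  shows "\<nu> \<in> Prob \<Longrightarrow> local f \<Longrightarrow> integrable \<nu> f"
  using integrable_bcontfun[of \<nu> "loc_bcontfun f"] by (simp add: apply_loc_bcontfun)

text \<open>Indicators of cylinder sets are continuous, and cylinder sets form an Int-stable
  generator of the Borel sets.\<close>

lemma Prob_eqI:
  fixes \<mu> \<nu> :: "('g::countable \<Rightarrow> 'a::finite_discrete) measure"
  assumes "\<mu> \<in> Prob" "\<nu> \<in> Prob"
    and eq: "\<And>f :: ('g \<Rightarrow> 'a) \<Rightarrow>\<^sub>C real. (\<integral>x. f x \<partial>\<mu>) = (\<integral>x. f x \<partial>\<nu>)"
  shows "\<mu> = \<nu>"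
proof (rule measure_eqI_generator_eq[where E = local_sets and \<Omega> = UNIV and A = "\<lambda>_. UNIV"])
  interpret M: prob_space \<mu> using assms by (simp add: Prob_iff)
  interpret N: prob_space \<nu> using assms by (simp add: Prob_iff)
  interpret algebra UNIV "local_sets :: ('g \<Rightarrow> 'a) set set" by (rule algebra_local_sets)
  show "Int_stable (local_sets :: ('g \<Rightarrow> 'a) set set)" by (auto simp: Int_stable_def)
  show "sets \<mu> = sigma_sets UNIV local_sets" "sets \<nu> = sigma_sets UNIV local_sets"
    using assms by (auto simp: Prob_iff sets_borel_local)
  show "range (\<lambda>_. UNIV) \<subseteq> (local_sets :: ('g \<Rightarrow> 'a) set set)" using top by auto
  show "emeasure \<mu> UNIV \<noteq> \<infinity>" by simp
  fix C :: "('g \<Rightarrow> 'a) set" assume C: "C \<in> local_sets"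
  then have "local (indicator C :: _ \<Rightarrow> real)"
    using local_comp[of "\<lambda>x. x \<in> C" "of_bool :: _ \<Rightarrow> real"] by (simp add: local_sets_def indicator_def[abs_def])
  then have "(\<integral>x. indicator C x \<partial>\<mu>) = (\<integral>x. indicator C x \<partial>\<nu> :: real)"
    using eq[of "loc_bcontfun (indicator C)"] by (simp add: apply_loc_bcontfun)
  then have "measure \<mu> C = measure \<nu> C"
    using assms by (simp add: Prob_iff sets_eq_imp_space_eq[of _ borel])
  then show "emeasure \<mu> C = emeasure \<nu> C" by (simp add: M.emeasure_eq_measure N.emeasure_eq_measure)
qed auto

lemma positive_functional_le_norm:
  fixes L :: "('x::topological_space \<Rightarrow>\<^sub>C real) \<Rightarrow> real"
  assumes "linear L" "\<And>f. (\<And>x. 0 \<le> apply_bcontfun f x) \<Longrightarrow> 0 \<le> L f" "L (const_bcontfun 1) = 1"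
  shows "\<bar>L f\<bar> \<le> norm f"
proof -
  have "\<bar>apply_bcontfun f x\<bar> \<le> norm f" for x using norm_bounded[of f x] by simp
  then have "0 \<le> L (norm f *\<^sub>R const_bcontfun 1 - f)" "0 \<le> L (norm f *\<^sub>R const_bcontfun 1 + f)"
    by (auto intro!: assms(2) simp: abs_le_iff) (smt (verit))
  then show ?thesis using assms(1,3) by (auto simp: linear_diff linear_add linear_scale)
qed

lemma apply_bcontfun_sum: "apply_bcontfun (sum f A) x = (\<Sum>i\<in>A. apply_bcontfun (f i) x)"
  for f :: "'i \<Rightarrow> 'x::topological_space \<Rightarrow>\<^sub>C real"
  by (induction A rule: infinite_finite_induct) auto

text \<open>On the zero-dimensional space \<open>A\<^sup>\<Gamma>\<close> the Riesz measure comes from Caratheodory's extension applied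
  to the algebra of clopen sets; compactness makes continuity at the empty set vacuous.\<close>

lemma riesz_configurations:
  fixes L :: "(('g::countable \<Rightarrow> 'a::finite_discrete) \<Rightarrow>\<^sub>C real) \<Rightarrow> real"
  assumes lin: "linear L" and pos: "\<And>f. (\<And>x. 0 \<le> apply_bcontfun f x) \<Longrightarrow> 0 \<le> L f"
    and one: "L (const_bcontfun 1) = 1"
  obtains \<nu> where "\<nu> \<in> Prob" "\<And>f. (\<integral>x. apply_bcontfun f x \<partial>\<nu>) = L f"
proof -
  let ?i = "\<lambda>C :: ('g \<Rightarrow> 'a) set. loc_bcontfun (indicator C)"
  interpret algebra UNIV "local_sets :: ('g \<Rightarrow> 'a) set set" by (rule algebra_local_sets)
  have loc: "local (indicator C :: _ \<Rightarrow> real)" if "C \<in> local_sets" for C :: "('g \<Rightarrow> 'a) set"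
    using that local_comp[of "\<lambda>x. x \<in> C" "of_bool :: _ \<Rightarrow> real"] by (simp add: local_sets_def indicator_def[abs_def])
  have ap: "apply_bcontfun (?i C) = indicator C" if "C \<in> local_sets" for C
    using loc[OF that] by (rule apply_loc_bcontfun)
  have Lnn: "0 \<le> L (?i C)" if "C \<in> local_sets" for C using that by (intro pos) (simp add: ap)
  have i0: "?i {} = 0" by (rule bcontfun_eqI) (simp add: ap)
  have L0: "L 0 = 0" using lin by (rule linear_0)
  define m where "m C = ennreal (L (?i C))" for C
  have "\<exists>\<mu>. (\<forall>C\<in>local_sets. \<mu> C = m C) \<and> measure_space UNIV (sigma_sets UNIV local_sets) \<mu>"
  proof (rule caratheodory_empty_continuous)
    show "positive local_sets m" using i0 L0 by (simp add: positive_def m_def)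
    show "additive local_sets m"
      unfolding additive_def
    proof (intro ballI impI)
      fix A B :: "('g \<Rightarrow> 'a) set" assume AB: "A \<in> local_sets" "B \<in> local_sets" "A \<inter> B = {}"
      then have "?i (A \<union> B) = ?i A + ?i B"
        using Un[OF AB(1,2)] by (intro bcontfun_eqI) (auto simp: ap indicator_def)
      then show "m (A \<union> B) = m A + m B"
        using AB Lnn lin by (simp add: m_def linear_add ennreal_plus)
    qed
    show "m A \<noteq> \<infinity>" for A by (simp add: m_def)
    fix A :: "nat \<Rightarrow> ('g \<Rightarrow> 'a) set"
    assume A: "range A \<subseteq> local_sets" "decseq A" "(\<Inter>i. A i) = {}"
    have "open (- A i)" for i
    proof -
      have "local (\<lambda>x. x \<in> A i)" using A(1) by (auto simp: local_sets_def)
      from local_open[OF local_comp[OF this, of Not]] show ?thesis by (simp add: Compl_eq)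
    qed
    then obtain D where D: "finite D" "UNIV \<subseteq> (\<Union>i\<in>D. - A i)"
    proof (rule compactE_image[OF compact_configurations, of UNIV "\<lambda>i. - A i"])
      show "UNIV \<subseteq> (\<Union>i. - A i)" using A(3) by auto
    qed auto
    obtain n where n: "D \<subseteq> {..n}" using D(1) by (meson finite_nat_iff_bounded_le)
    have "A k = {}" if "n \<le> k" for k
    proof -
      have "x \<notin> A k" for x
      proof -
        obtain i where i: "i \<in> D" "x \<notin> A i" using D(2) by auto
        then have "A k \<subseteq> A i" using n that by (intro decseqD[OF A(2)]) auto
        then show ?thesis using i(2) by auto
      qed
      then show ?thesis by blast
    qed
    then show "(\<lambda>i. m (A i)) \<longlonglongrightarrow> 0"
      using i0 L0 by (intro tendsto_eventually eventually_sequentiallyI[of n]) (simp add: m_def)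
  qed
  then obtain \<mu> where \<mu>: "\<And>C. C \<in> local_sets \<Longrightarrow> \<mu> C = m C"
    "measure_space UNIV (sigma_sets UNIV local_sets) \<mu>" by blast
  define \<nu> where "\<nu> = measure_of UNIV (sigma_sets UNIV local_sets) \<mu>"
  have sets: "sets \<nu> = sets borel" by (simp add: \<nu>_def sets_borel_local sigma_sets_sigma_sets_eq)
  have em: "emeasure \<nu> C = m C" if "C \<in> local_sets" for C
    using \<mu> that unfolding \<nu>_def measure_space_def by (subst emeasure_measure_of_sigma) auto
  have "?i UNIV = const_bcontfun 1" by (intro bcontfun_eqI) (simp add: apply_loc_bcontfun)
  then have "emeasure \<nu> (space \<nu>) = 1" using em[OF top] one sets_eq_imp_space_eq[OF sets] by (simp add: m_def)
  then interpret prob_space \<nu> by (rule prob_spaceI)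
  have P: "\<nu> \<in> Prob" using sets by (simp add: Prob_iff prob_space_axioms)
  have meas: "measure \<nu> C = L (?i C)" if "C \<in> local_sets" for C
    using em[OF that] Lnn[OF that] by (simp add: measure_def m_def)
  \<comment> \<open>A local function is a finite linear combination of indicators of its level sets,
    which are cylinder sets.\<close>
  have loc_eq: "(\<integral>x. f x \<partial>\<nu>) = L (loc_bcontfun f)" if f: "local f" for f
  proof -
    have lev: "{x. f x = r} \<in> local_sets" for r using local_comp[OF f, of "\<lambda>a. a = r"] by (simp add: local_sets_def)
    have fin: "finite (range f)" using f by (rule local_finite_range)
    have fe: "f x = (\<Sum>r\<in>range f. r * indicator {x. f x = r} x)" for x
    proof -
      have "(\<Sum>r\<in>range f. r * indicator {x. f x = r} x) = (\<Sum>r\<in>range f. if r = f x then r else 0)"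
        by (intro sum.cong) auto
      then show ?thesis using fin by simp
    qed
    have "(\<integral>x. f x \<partial>\<nu>) = (\<integral>x. (\<Sum>r\<in>range f. r * indicator {x. f x = r} x) \<partial>\<nu>)"
      by (rule Bochner_Integration.integral_cong[OF refl fe])
    also have "\<dots> = (\<Sum>r\<in>range f. r * measure \<nu> {x. f x = r})"
      using integrable_local[OF P loc[OF lev]] sets_eq_imp_space_eq[OF sets] by simp
    also have "\<dots> = L (\<Sum>r\<in>range f. r *\<^sub>R ?i {x. f x = r})"
      using lin by (simp add: meas[OF lev] linear_sum linear_scale)
    also have "(\<Sum>r\<in>range f. r *\<^sub>R ?i {x. f x = r}) = loc_bcontfun f"
    proof (rule bcontfun_eqI)
      fix x
      have "apply_bcontfun (\<Sum>r\<in>R. r *\<^sub>R ?i {x. f x = r}) x = (\<Sum>r\<in>R. r * indicator {x. f x = r} x)" for R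
        by (simp only: apply_bcontfun_sum scaleR_bcontfun.rep_eq ap[OF lev] real_scaleR_def)
      then show "apply_bcontfun (\<Sum>r\<in>range f. r *\<^sub>R ?i {x. f x = r}) x = apply_bcontfun (loc_bcontfun f) x"
        by (simp only: apply_loc_bcontfun[OF f] fe[of x, symmetric])
    qed
    finally show ?thesis .
  qed
  have "(\<integral>x. apply_bcontfun f x \<partial>\<nu>) = L f" for f
  proof (rule ccontr)
    assume "(\<integral>x. apply_bcontfun f x \<partial>\<nu>) \<noteq> L f"
    \<comment> \<open>A third of the discrepancy: replacing \<open>f\<close> by a local
      \<open>?g\<close> costs at most \<open>e\<close> on either side, which cannot bridge
      \<open>3 * e\<close>.\<close>
    define e where "e = \<bar>(\<integral>x. apply_bcontfun f x \<partial>\<nu>) - L f\<bar> / 3"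
    have "e > 0" using \<open>_ \<noteq> L f\<close> by (simp add: e_def)
    from local_approx[OF this, of f] obtain W
      where W: "finite W" "norm (loc_bcontfun (\<lambda>x. f (freeze W x)) - f) \<le> e" by blast
    let ?g = "loc_bcontfun (\<lambda>x. f (freeze W x))"
    have "\<bar>(\<integral>x. ?g x \<partial>\<nu>) - (\<integral>x. f x \<partial>\<nu>)\<bar> = \<bar>\<integral>x. ?g x - f x \<partial>\<nu>\<bar>"
      using integrable_bcontfun[OF P] by simp
    also have "\<dots> \<le> (\<integral>x. e \<partial>\<nu>)"
    proof (rule order.trans[OF integral_abs_bound integral_mono])
      show "\<bar>?g x - f x\<bar> \<le> e" for x using norm_bounded[of "?g - f" x] W(2) by simp
    qed (use integrable_bcontfun[OF P] in auto)
    also have "\<dots> = e" by (simp add: prob_space)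
    finally have 1: "\<bar>(\<integral>x. ?g x \<partial>\<nu>) - (\<integral>x. f x \<partial>\<nu>)\<bar> \<le> e" .
    have 2: "\<bar>L ?g - L f\<bar> \<le> e"
      using positive_functional_le_norm[OF lin pos one, of "?g - f"] W(2) lin by (simp add: linear_diff)
    have "(\<integral>x. ?g x \<partial>\<nu>) = L ?g" using loc_eq[OF local_freeze[OF W(1)]] by (simp add: apply_loc_bcontfun local_freeze[OF W(1)])
    then show False using 1 2 \<open>e > 0\<close> unfolding e_def by (simp add: abs_if split: if_splits)
  qed
  then show thesis using that P by blast
qed

text \<open>Existence comes from \<open>riesz_configurations\<close> and uniqueness from
  \<open>Prob_eqI\<close>, so the definite description denotes the intended measure.\<close>

lemma act_on_measure:
  fixes \<mu> :: "('g::countable \<Rightarrow> 'a::finite_discrete) measure"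
  assumes \<mu>: "\<mu> \<in> Prob" and T: "linear T" "T (const_bcontfun 1) = const_bcontfun 1"
    "\<And>f. (\<And>x. 0 \<le> apply_bcontfun f x) \<Longrightarrow> (\<And>x. 0 \<le> apply_bcontfun (T f) x)"
  shows "act_on_measure \<mu> T \<in> Prob"
    and "(\<integral>x. apply_bcontfun f x \<partial>act_on_measure \<mu> T) = (\<integral>x. apply_bcontfun (T f) x \<partial>\<mu>)"
proof -
  interpret prob_space \<mu> using \<mu> by (simp add: Prob_iff)
  have "linear (\<lambda>f. \<integral>x. apply_bcontfun (T f) x \<partial>\<mu>)"
    using T(1) integrable_bcontfun[OF \<mu>] by (intro linearI) (simp_all add: linear_add linear_scale)
  from riesz_configurations[OF this] obtain \<nu>
    where \<nu>: "\<nu> \<in> Prob" "\<And>f. (\<integral>x. apply_bcontfun f x \<partial>\<nu>) = (\<integral>x. apply_bcontfun (T f) x \<partial>\<mu>)"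
    using T(2,3) by (auto simp: prob_space)
  have "act_on_measure \<mu> T \<in> Prob \<and> (\<forall>f. (\<integral>x. apply_bcontfun f x \<partial>act_on_measure \<mu> T) = (\<integral>x. apply_bcontfun (T f) x \<partial>\<mu>))"
    unfolding act_on_measure_def by (rule theI[of _ \<nu>]) (auto intro!: Prob_eqI simp: \<nu>)
  then show "act_on_measure \<mu> T \<in> Prob"
    "(\<integral>x. apply_bcontfun f x \<partial>act_on_measure \<mu> T) = (\<integral>x. apply_bcontfun (T f) x \<partial>\<mu>)" by auto
qed

lemma openin_weak_topology:
  fixes F :: "('x::topological_space \<Rightarrow>\<^sub>C real) set"
  assumes "finite F"
  shows "openin weak_topology {\<rho> \<in> Prob. \<forall>f\<in>F. \<bar>(\<integral>x. apply_bcontfun f x \<partial>\<rho>) - c f\<bar> < e}"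
  unfolding weak_topology_def openin_pullback_topology
proof (intro exI[of _ "{H. \<forall>f\<in>F. \<bar>H f - c f\<bar> < e}"] conjI)
  have "{H :: ('x \<Rightarrow>\<^sub>C real) \<Rightarrow> real. \<forall>f\<in>F. \<bar>H f - c f\<bar> < e} = (\<Inter>f\<in>F. {H. \<bar>H f - c f\<bar> < e})" by auto
  also have "open \<dots>"
    using assms by (intro open_INT ballI open_Collect_less continuous_intros) auto
  finally show "openin euclidean {H :: ('x \<Rightarrow>\<^sub>C real) \<Rightarrow> real. \<forall>f\<in>F. \<bar>H f - c f\<bar> < e}" by simp
qed auto


section \<open>The Glauber generator\<close>

locale glauber =
  fixes r :: nat and s :: "nat \<Rightarrow> 'g::{group_add, countable}"
    and J :: "'a::finite_discrete \<Rightarrow> 'a \<Rightarrow> real" and h :: "'a \<Rightarrow> real"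
begin

abbreviation rate :: "'g \<Rightarrow> ('g \<Rightarrow> 'a) \<Rightarrow> 'a \<Rightarrow> real" where
  "rate \<equiv> flip_rate r s J h"

text \<open>The single-site kernel \<open>K_\<gamma>\<close> acting on functions of configurations
  over \<open>\<Gamma>\<close>.\<close>

definition flip_mean :: "'g \<Rightarrow> (('g \<Rightarrow> 'a) \<Rightarrow> real) \<Rightarrow> ('g \<Rightarrow> 'a) \<Rightarrow> real" where
  "flip_mean \<gamma> f x = (\<Sum>a\<in>UNIV. rate \<gamma> x a * f (x(\<gamma> := a)))"

definition gen :: "(('g \<Rightarrow> 'a) \<Rightarrow> real) \<Rightarrow> ('g \<Rightarrow> 'a) \<Rightarrow> real" where
  "gen f x = (\<Sum>\<^sub>\<infinity>\<gamma>. \<Sum>a\<in>UNIV. rate \<gamma> x a * (f (x(\<gamma> := a)) - f x))"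

lemma sum_exp_pos: "0 < (\<Sum>b\<in>UNIV. exp (f (b :: 'a)) :: real)"
  by (intro sum_pos) auto

lemma rate_nonneg: "0 \<le> rate \<gamma> x a"
  unfolding flip_rate_def using sum_exp_pos by (intro divide_nonneg_pos) auto

lemma sum_rate: "(\<Sum>a\<in>UNIV. rate \<gamma> x a) = 1"
  unfolding flip_rate_def using sum_exp_pos[of "\<lambda>b. - local_energy r s J h \<gamma> (x(\<gamma> := b))"]
  by (simp flip: sum_divide_distrib)

lemma flip_sum_eq: "(\<Sum>a\<in>UNIV. rate \<gamma> x a * (f (x(\<gamma> := a)) - f x)) = flip_mean \<gamma> f x - f x"
  using sum_rate[of \<gamma> x] by (simp add: flip_mean_def right_diff_distrib sum_subtractf flip: sum_distrib_right)

lemma local_rate: "local (\<lambda>x. rate \<gamma> x a)"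
proof -
  have e: "local (\<lambda>x. local_energy r s J h \<gamma> x)"
    unfolding local_energy_def
    by (intro local_comp2[where F = "(+)"] local_sum local_comp2[where F = J] local_comp[where F = h] local_apply)
  have *: "local (\<lambda>x. exp (- local_energy r s J h \<gamma> (x(\<gamma> := b))))" for b
    by (rule local_comp[OF local_upd[OF e], of "\<lambda>e. exp (- e)"])
  have "local (\<lambda>x. \<Sum>b\<in>UNIV. exp (- local_energy r s J h \<gamma> (x(\<gamma> := b))))"
    by (rule local_sum) (rule *)
  from local_comp2[OF *[of a] this, of "(/)"] show ?thesis by (simp add: flip_rate_def)
qed

lemma local_flip_mean: "local f \<Longrightarrow> local (flip_mean \<gamma> f)"
  unfolding flip_mean_def[abs_def]
  by (intro local_sum local_comp2[where F = "(*)"] local_rate local_upd)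

lemma flip_sum_bound:
  assumes "\<And>a. \<bar>f (x(\<gamma> := a)) - f x\<bar> \<le> B"
  shows "\<bar>\<Sum>a\<in>UNIV. rate \<gamma> x a * (f (x(\<gamma> := a)) - f x)\<bar> \<le> B"
proof -
  have "\<bar>\<Sum>a\<in>UNIV. rate \<gamma> x a * (f (x(\<gamma> := a)) - f x)\<bar> \<le> (\<Sum>a\<in>UNIV. rate \<gamma> x a * B)"
    using assms rate_nonneg
    by (intro order.trans[OF sum_abs] sum_mono) (auto simp: abs_mult intro!: mult_left_mono)
  then show ?thesis using sum_rate[of \<gamma> x] by (simp flip: sum_distrib_right)
qed

lemma gen_eq_sum:
  assumes "finite W" "depends_on W f"
  shows "gen f x = (\<Sum>\<gamma>\<in>W. flip_mean \<gamma> f x - f x)"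
proof -
  have "f (x(\<gamma> := a)) = f x" if "\<gamma> \<notin> W" for \<gamma> a
    using that by (intro depends_onD[OF assms(2)]) auto
  then have "gen f x = (\<Sum>\<^sub>\<infinity>\<gamma>\<in>W. \<Sum>a\<in>UNIV. rate \<gamma> x a * (f (x(\<gamma> := a)) - f x))"
    unfolding gen_def by (intro infsum_cong_neutral) auto
  then show ?thesis using assms(1) by (simp add: flip_sum_eq)
qed

lemma local_gen: assumes "local f" shows "local (gen f)"
proof -
  obtain W where W: "finite W" "depends_on W f" using assms by (auto simp: local_def)
  have "gen f = (\<lambda>x. \<Sum>\<gamma>\<in>W. flip_mean \<gamma> f x - f x)" using gen_eq_sum[OF W] by auto
  then show ?thesis
    using local_sum[of W "\<lambda>\<gamma> x. flip_mean \<gamma> f x - f x"]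
      local_comp2[OF local_flip_mean[OF assms] assms, of "(-)"] by simp
qed

lemma osc_upper:
  fixes f :: "('g \<Rightarrow> 'a) \<Rightarrow>\<^sub>C real"
  assumes "\<And>\<beta>. \<beta> \<noteq> \<gamma> \<Longrightarrow> x \<beta> = y \<beta>"
  shows "\<bar>f x - f y\<bar> \<le> osc f \<gamma>"
  unfolding osc_def
proof (rule cSup_upper)
  show "bdd_above {\<bar>f x - f y\<bar> |x y. \<forall>\<beta>. \<beta> \<noteq> \<gamma> \<longrightarrow> x \<beta> = y \<beta>}"
  proof (rule bdd_aboveI[where M = "2 * norm f"], safe)
    fix x y show "\<bar>f x - f y\<bar> \<le> 2 * norm f" using norm_bounded[of f x] norm_bounded[of f y] by simp
  qed
qed (use assms in blast)

lemma local_pregenerator: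
  assumes f: "local f"
  shows "(loc_bcontfun f, loc_bcontfun (gen f)) \<in> glauber_pregenerator r s J h"
proof -
  obtain W where W: "finite W" "depends_on W f" using f by (auto simp: local_def)
  have "osc f \<gamma> = 0" if "\<gamma> \<notin> W" for \<gamma>
  proof -
    have "f x = f y" if "\<forall>\<beta>. \<beta> \<noteq> \<gamma> \<longrightarrow> x \<beta> = y \<beta>" for x y
      using that \<open>\<gamma> \<notin> W\<close> by (intro depends_onD[OF W(2)]) auto
    then have "{\<bar>f x - f y\<bar> |x y. \<forall>\<beta>. \<beta> \<noteq> \<gamma> \<longrightarrow> x \<beta> = y \<beta>} = {0}" by fastforce
    then show ?thesis by (simp add: osc_def)
  qed
  then have "osc f summable_on UNIV"
    using summable_on_cong_neutral[of UNIV W "osc f" "osc f"] W(1) by auto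
  then show ?thesis
    by (simp add: glauber_pregenerator_def apply_loc_bcontfun f local_gen gen_def)
qed

text \<open>Local functions are dense in the graph norm. Freezing does not increase oscillations, so
  outside a finite \<open>W0\<close> the terms of both generator sums are dominated by the summable
  \<open>osc f\<close>; inside \<open>W0\<close> the uniform closeness of \<open>f'\<close> to
  \<open>f\<close> suffices.\<close>

lemma pregenerator_local_approx:
  assumes fg: "(f, g) \<in> glauber_pregenerator r s J h" and \<eta>: "0 < \<eta>"
  shows "\<exists>f'. local f' \<and> norm (loc_bcontfun f' - f) \<le> \<eta> \<and> norm (loc_bcontfun (gen f') - g) \<le> \<eta>"
proof -
  have sm: "osc f summable_on UNIV" and g: "\<And>x. g x = gen f x"
    using fg by (auto simp: glauber_pregenerator_def gen_def)
  obtain W0 where W0: "finite W0" "dist (sum (osc f) W0) (infsum (osc f) UNIV) \<le> \<eta> / 4"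
    using infsum_finite_approximation[OF sm, of "\<eta> / 4"] \<eta> by auto
  \<comment> \<open>Each site of \<open>W0\<close> contributes at most \<open>2 * e\<close>, hence
    \<open>W0\<close> at most \<open>\<eta> / 2\<close>, and the tail outside it adds at most
    \<open>2 * (\<eta> / 4)\<close>. The summand 1 covers an empty \<open>W0\<close>.\<close>
  define e where "e = \<eta> / (4 * (1 + card W0))"
  have e: "0 < e" "e \<le> \<eta>" "4 * e * card W0 \<le> \<eta>" "2 * (2 * e * card W0) \<le> \<eta>"
    using \<eta> by (auto simp: e_def field_simps)
  obtain W where W: "finite W" "norm (loc_bcontfun (\<lambda>x. f (freeze W x)) - f) \<le> e"
    using local_approx[OF e(1), of f] by blast
  define f' where "f' = (\<lambda>x. f (freeze W x))"
  have f': "local f'" unfolding f'_def by (rule local_freeze[OF W(1)])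
  have close: "\<bar>f' x - f x\<bar> \<le> e" for x
    using norm_bounded[of "loc_bcontfun f' - f" x] W(2) by (simp add: f'_def[symmetric] apply_loc_bcontfun[OF f'])
  define D where "D f \<gamma> x = (\<Sum>a\<in>UNIV. rate \<gamma> x a * (f (x(\<gamma> := a)) - f x))" for f :: "('g \<Rightarrow> 'a) \<Rightarrow> real" and \<gamma> x
  have Df: "\<bar>D f \<gamma> x\<bar> \<le> osc f \<gamma>" for \<gamma> x
    unfolding D_def by (intro flip_sum_bound osc_upper) auto
  have Df': "\<bar>D f' \<gamma> x\<bar> \<le> osc f \<gamma>" for \<gamma> x
    unfolding D_def f'_def by (intro flip_sum_bound osc_upper) (auto simp: freeze_def)
  have DD: "\<bar>D f' \<gamma> x - D f \<gamma> x\<bar> \<le> 2 * e" for \<gamma> x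
  proof -
    have "D f' \<gamma> x - D f \<gamma> x = (\<Sum>a\<in>UNIV. rate \<gamma> x a * ((f' (x(\<gamma> := a)) - f (x(\<gamma> := a))) - (f' x - f x)))"
      by (simp add: D_def algebra_simps flip: sum_subtractf)
    also have "\<bar>\<dots>\<bar> \<le> 2 * e"
    proof (rule flip_sum_bound)
      show "\<bar>(f' (x(\<gamma> := a)) - f (x(\<gamma> := a))) - (f' x - f x)\<bar> \<le> 2 * e" for a
        using close[of x] close[of "x(\<gamma> := a)"] by linarith
    qed
    finally show ?thesis .
  qed
  have sD: "(\<lambda>\<gamma>. D F \<gamma> x) summable_on UNIV" if "\<And>\<gamma>. \<bar>D F \<gamma> x\<bar> \<le> osc f \<gamma>" for F x
  proof (rule abs_summable_summable, rule summable_on_comparison_test[OF sm])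
    show "norm (D F \<gamma> x) \<le> osc f \<gamma>" for \<gamma> using that by simp
  qed auto
  have key: "\<bar>gen f' x - gen f x\<bar> \<le> \<eta>" for x
  proof -
    \<comment> \<open>Equals \<open>2 * e\<close> on \<open>W0\<close> and
      \<open>2 * osc f \<gamma>\<close> off it, split into two families with explicit
      totals.\<close>
    define b where "b \<gamma> = 2 * osc f \<gamma> + (if \<gamma> \<in> W0 then 2 * e - 2 * osc f \<gamma> else 0)" for \<gamma>
    have "((\<lambda>\<gamma>. D f' \<gamma> x + - D f \<gamma> x) has_sum (gen f' x + - gen f x)) UNIV"
      unfolding gen_def D_def[symmetric] using sD Df Df' by (intro has_sum_add) (auto simp: has_sum_uminus)
    moreover have "(b has_sum (2 * infsum (osc f) UNIV + (\<Sum>\<gamma>\<in>W0. 2 * e - 2 * osc f \<gamma>))) UNIV"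
      unfolding b_def
    proof (intro has_sum_add has_sum_cmult_right)
      have "((\<lambda>\<gamma>. 2 * e - 2 * osc f \<gamma>) has_sum (\<Sum>\<gamma>\<in>W0. 2 * e - 2 * osc f \<gamma>)) W0"
        using W0(1) by simp
      then show "((\<lambda>\<gamma>. if \<gamma> \<in> W0 then 2 * e - 2 * osc f \<gamma> else 0) has_sum (\<Sum>\<gamma>\<in>W0. 2 * e - 2 * osc f \<gamma>)) UNIV"
        by (rule has_sum_cong_neutral[THEN iffD1, rotated -1]) auto
    qed (use sm in auto)
    moreover have "norm (D f' \<gamma> x + - D f \<gamma> x) \<le> b \<gamma>" for \<gamma>
      using DD[of \<gamma> x] Df[of \<gamma> x] Df'[of \<gamma> x] by (auto simp: b_def)
    ultimately have "norm (gen f' x + - gen f x) \<le> 2 * infsum (osc f) UNIV + (\<Sum>\<gamma>\<in>W0. 2 * e - 2 * osc f \<gamma>)"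
      by (rule norm_infsum_le)
    also have "\<dots> = 2 * (infsum (osc f) UNIV - sum (osc f) W0) + 2 * e * card W0"
      by (simp add: sum_subtractf flip: sum_distrib_left)
    also have "\<dots> \<le> \<eta>"
    proof -
      have "2 * e * card W0 \<le> \<eta> / 2" using e(4) by simp
      then show ?thesis using W0(2) unfolding dist_real_def by argo
    qed
    finally show ?thesis by simp
  qed
  show ?thesis
  proof (intro exI conjI)
    show "norm (loc_bcontfun f' - f) \<le> \<eta>" using W(2) e(2) by (simp add: f'_def)
    show "norm (loc_bcontfun (gen f') - g) \<le> \<eta>"
      using key by (intro norm_bound) (simp add: g apply_loc_bcontfun[OF local_gen[OF f']])
  qed (rule f')
qed

lemma closure_pregenerator_local_approx:
  assumes fg: "(f, g) \<in> closure (glauber_pregenerator r s J h)" and \<eta>: "0 < \<eta>"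
  obtains f' where "local f'" "norm (loc_bcontfun f' - f) \<le> \<eta>" "norm (loc_bcontfun (gen f') - g) \<le> \<eta>"
proof -
  from fg \<eta> obtain p where p: "p \<in> glauber_pregenerator r s J h" "dist p (f, g) < \<eta> / 2"
    unfolding closure_approachable by (meson half_gt_zero)
  from pregenerator_local_approx[of "fst p" "snd p" "\<eta> / 2"] p(1) \<eta> obtain f'
    where f': "local f'" "norm (loc_bcontfun f' - fst p) \<le> \<eta> / 2" "norm (loc_bcontfun (gen f') - snd p) \<le> \<eta> / 2"
    by auto
  have "norm (fst p - f) < \<eta> / 2" "norm (snd p - g) < \<eta> / 2"
    using dist_fst_le[of p "(f, g)"] dist_snd_le[of p "(f, g)"] p(2) by (auto simp: dist_norm)
  then show thesis
    using that[of f'] f' norm_triangle_ineq[of "loc_bcontfun f' - fst p" "fst p - f"]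
      norm_triangle_ineq[of "loc_bcontfun (gen f') - snd p" "snd p - g"] by simp
qed

end

section \<open>Markov semigroups and their generators\<close>

lemma markov_semigroupD:
  assumes "markov_semigroup S" "0 \<le> t"
  shows "linear (S t)" "S t (const_bcontfun 1) = const_bcontfun 1"
    "(\<And>x. 0 \<le> apply_bcontfun f x) \<Longrightarrow> 0 \<le> apply_bcontfun (S t f) x"
  using assms by (auto simp: markov_semigroup_def)

lemma markov_semigroup_add:
  assumes "markov_semigroup S" "0 \<le> t" "0 \<le> u"
  shows "S (t + u) f = S t (S u f)"
  using assms by (simp add: markov_semigroup_def)

lemma markov_semigroup_contraction:
  fixes S :: "real \<Rightarrow> ('x::topological_space \<Rightarrow>\<^sub>C real) \<Rightarrow> 'x \<Rightarrow>\<^sub>C real"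
  assumes "markov_semigroup S" "0 \<le> t"
  shows "norm (S t f) \<le> norm f"
proof (rule norm_bound)
  fix x
  note * = markov_semigroupD[OF assms]
  have "linear (\<lambda>f. apply_bcontfun (S t f) x)"
    using *(1) by (intro linearI) (simp_all add: linear_add linear_scale)
  then show "norm (apply_bcontfun (S t f) x) \<le> norm f"
    using positive_functional_le_norm[of "\<lambda>f. apply_bcontfun (S t f) x" f] *(2,3) by simp
qed

lemma markov_semigroup_bounded_linear:
  fixes S :: "real \<Rightarrow> ('x::topological_space \<Rightarrow>\<^sub>C real) \<Rightarrow> 'x \<Rightarrow>\<^sub>C real"
  assumes "markov_semigroup S" "0 \<le> t"
  shows "bounded_linear (S t)"
  using markov_semigroupD(1)[OF assms] markov_semigroup_contraction[OF assms]
  by (intro bounded_linear_intro[where K = 1]) (auto simp: linear_add linear_scale)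

text \<open>\<open>S t\<close> is continuous and commutes with \<open>S u\<close>, so it passes
  through the difference quotient.\<close>

lemma generator_invariant:
  fixes S :: "real \<Rightarrow> ('x::topological_space \<Rightarrow>\<^sub>C real) \<Rightarrow> 'x \<Rightarrow>\<^sub>C real"
  assumes S: "markov_semigroup S" and t: "0 \<le> t" and fg: "(f, g) \<in> semigroup_generator S"
  shows "(S t f, S t g) \<in> semigroup_generator S"
proof -
  interpret bounded_linear "S t" using markov_semigroup_bounded_linear[OF S t] .
  have "((\<lambda>u. S t ((S u f - f) /\<^sub>R u)) \<longlongrightarrow> S t g) (at_right 0)"
    using fg by (intro tendsto) (simp add: semigroup_generator_def)
  moreover have "S t ((S u f - f) /\<^sub>R u) = (S u (S t f) - S t f) /\<^sub>R u" if "u > 0" for u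
    using that t markov_semigroup_add[OF S, of t u f] markov_semigroup_add[OF S, of u t f]
    by (simp add: scaleR diff add.commute)
  ultimately show ?thesis unfolding semigroup_generator_def
    by (auto elim!: Lim_transform_eventually simp: eventually_at_right_less intro: eventually_at_rightI[of 0 1])
qed

text \<open>After division by \<open>\<tau>\<close>, both the difference quotient and
  \<open>S \<tau> g\<close> tend to \<open>g\<close>. With the generator evaluated at the end of the
  step, this is the consistency error of backward Euler.\<close>

lemma semigroup_first_order:
  fixes S :: "real \<Rightarrow> ('x::topological_space \<Rightarrow>\<^sub>C real) \<Rightarrow> 'x \<Rightarrow>\<^sub>C real"
  assumes S: "markov_semigroup S" and fg: "(f, g) \<in> semigroup_generator S" and "0 < e"
  shows "\<forall>\<^sub>F \<tau> in at_right 0. norm (S \<tau> f - \<tau> *\<^sub>R S \<tau> g - f) \<le> e * \<tau>"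
proof -
  have "((\<lambda>u. S u g) \<longlongrightarrow> g) (at_right 0)"
    using S unfolding markov_semigroup_def by (metis id_apply order_refl)
  moreover have "((\<lambda>u. (S u f - f) /\<^sub>R u) \<longlongrightarrow> g) (at_right 0)"
    using fg by (simp add: semigroup_generator_def)
  ultimately have "((\<lambda>u. (S u f - f) /\<^sub>R u - S u g) \<longlongrightarrow> g - g) (at_right 0)"
    by (intro tendsto_diff)
  then have "\<forall>\<^sub>F u in at_right 0. norm ((S u f - f) /\<^sub>R u - S u g) < e"
    using \<open>0 < e\<close> by (simp add: tendsto_iff dist_norm)
  then show ?thesis
    using eventually_at_right_less[of 0]
  proof eventually_elim
    case (elim u)
    have "S u f - u *\<^sub>R S u g - f = u *\<^sub>R ((S u f - f) /\<^sub>R u - S u g)"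
      using elim(2) by (simp add: scaleR_diff_right)
    also have "norm \<dots> = u * norm ((S u f - f) /\<^sub>R u - S u g)" using elim(2) by simp
    finally show ?case using elim by (simp add: mult.commute less_imp_le)
  qed
qed


section \<open>Gibbs measures as invariant measures of single-site resampling\<close>

context glauber begin

text \<open>Overwriting the spin at \<open>\<gamma>\<close> by a fixed value makes that coordinate
  constant, so only the others enter the energies.\<close>

lemma rate_outside_measurable: "(\<lambda>y. rate \<gamma> y a) \<in> borel_measurable (outside_algebra \<gamma>)"
proof -
  have [measurable]: "(\<lambda>y. (F ((y(\<gamma> := b)) \<beta>) :: real)) \<in> borel_measurable (outside_algebra \<gamma>)" for F b \<beta>
  proof (cases "\<beta> = \<gamma>")
    case False
    show ?thesis
    proof (rule measurableI)
      fix B :: "real set"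
      have "{y. y \<beta> \<in> F -` B} \<in> sets (outside_algebra \<gamma>)"
        unfolding outside_algebra_def using False by (intro in_measure_of) blast+
      then show "(\<lambda>y. F ((y(\<gamma> := b)) \<beta>)) -` B \<inter> space (outside_algebra \<gamma>) \<in> sets (outside_algebra \<gamma>)"
        using False by (simp add: vimage_def outside_algebra_def)
    qed simp
  qed simp
  have [measurable]: "(\<lambda>y. local_energy r s J h \<gamma> (y(\<gamma> := b))) \<in> borel_measurable (outside_algebra \<gamma>)" for b
    unfolding local_energy_def fun_upd_same by measurable
  show ?thesis unfolding flip_rate_def by measurable
qed

text \<open>Invariance tested on the indicator of \<open>x \<gamma> = a\<close> times that of a
  cylinder event \<open>C\<close> not involving \<open>\<gamma>\<close> is the conditional
  probability identity on \<open>C\<close>. Such events are Int-stable and their sigma-algebra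
  contains the outside algebra, so a Dynkin argument extends the identity.\<close>

lemma gibbsI:
  assumes \<nu>: "\<nu> \<in> Prob"
    and inv: "\<And>\<gamma> f. local f \<Longrightarrow> (\<integral>x. flip_mean \<gamma> f x - f x \<partial>\<nu>) = 0"
  shows "\<nu> \<in> gibbs_measures r s J h"
proof -
  interpret prob_space \<nu> using \<nu> by (simp add: Prob_iff)
  have sets_nu: "sets \<nu> = sets borel" "space \<nu> = UNIV" using \<nu> sets_eq_imp_space_eq[of \<nu> borel] by (auto simp: Prob_iff)
  have "AE y in \<nu>. real_cond_exp \<nu> (outside_algebra \<gamma>) (indicator {x. x \<gamma> = a}) y = rate \<gamma> y a" for \<gamma> a
  proof -
    \<comment> \<open>Insensitivity to updates at \<open>\<gamma>\<close> expresses locality off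
      \<open>\<gamma>\<close> without naming a set of coordinates.\<close>
    let ?E = "{C :: ('g \<Rightarrow> 'a) set. local (\<lambda>x. x \<in> C) \<and> (\<forall>x b. x(\<gamma> := b) \<in> C \<longleftrightarrow> x \<in> C)}"
    let ?g = "\<lambda>x. indicator {x. x \<gamma> = a} x - rate \<gamma> x a :: real"
    have sets_out: "sets (outside_algebra \<gamma>) = sigma_sets UNIV {{x :: 'g \<Rightarrow> 'a. x \<beta> \<in> B} | \<beta> B. \<beta> \<noteq> \<gamma>}"
      unfolding outside_algebra_def by (rule sets_measure_of) auto
    have gen_E: "{{x :: 'g \<Rightarrow> 'a. x \<beta> \<in> B} | \<beta> B. \<beta> \<noteq> \<gamma>} \<subseteq> ?E"
      using local_comp[OF local_apply] by auto
    have sub: "subalgebra \<nu> (outside_algebra \<gamma>)"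
      unfolding subalgebra_def
    proof
      have "sigma_sets UNIV {{x :: 'g \<Rightarrow> 'a. x \<beta> \<in> B} | \<beta> B. \<beta> \<noteq> \<gamma>} \<subseteq> sets borel"
        by (rule sets.sigma_sets_subset[where M = borel, simplified])
           (use gen_E local_sets_borel in \<open>auto simp: local_sets_def subset_iff\<close>)
      then show "sets (outside_algebra \<gamma>) \<subseteq> sets \<nu>" by (simp add: sets_out sets_nu)
    qed (simp add: sets_nu outside_algebra_def)
    interpret fs: finite_measure_subalgebra \<nu> "outside_algebra \<gamma>"
      by unfold_locales (rule sub)
    have li: "local (\<lambda>x. indicator {x. x \<gamma> = a} x :: real)"
      using local_comp[OF local_apply, of "\<lambda>b. of_bool (b = a) :: real" \<gamma>] by (simp add: indicator_def)
    have int_g: "integrable \<nu> ?g"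
      by (intro integrable_local[OF \<nu>] local_comp2[where F = "(-)"] li local_rate)
    have zero: "(\<integral>x\<in>A. ?g x \<partial>\<nu>) = 0" if "A \<in> sets (outside_algebra \<gamma>)" for A
    proof -
      have A: "A \<in> sigma_sets UNIV ?E"
        using that sigma_sets_mono'[OF gen_E] by (auto simp: sets_out)
      have E_sets: "C \<in> sets \<nu>" if "C \<in> sigma_sets UNIV ?E" for C
      proof -
        have "?E \<subseteq> sets borel" using local_sets_borel by (auto simp: local_sets_def)
        from sets.sigma_sets_subset[OF this] that show ?thesis by (auto simp: sets_nu)
      qed
      have basic: "(\<integral>x\<in>C. ?g x \<partial>\<nu>) = 0" if C: "C \<in> ?E" for C
      proof -
        define f where "f x = (indicator {x. x \<gamma> = a} x * indicator C x :: real)" for x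
        have "local (\<lambda>x. indicator C x :: real)"
          using C local_comp[of "\<lambda>x. x \<in> C" "of_bool :: _ \<Rightarrow> real"] by (simp add: indicator_def)
        then have f: "local f" unfolding f_def by (intro local_comp2[where F = "(*)"] li)
        have "flip_mean \<gamma> f x = rate \<gamma> x a * indicator C x" for x
        proof -
          \<comment> \<open>\<open>C\<close> ignores the coordinate \<open>\<gamma>\<close>, so
            among the overwritten spins only \<open>b = a\<close> survives.\<close>
          have "rate \<gamma> x b * f (x(\<gamma> := b)) = (if b = a then rate \<gamma> x a * indicator C x else 0)" for b
            using C by (auto simp: f_def indicator_def)
          then show ?thesis by (simp add: flip_mean_def)
        qed
        then have "(\<integral>x\<in>C. ?g x \<partial>\<nu>) = (\<integral>x. - (flip_mean \<gamma> f x - f x) \<partial>\<nu>)"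
          unfolding set_lebesgue_integral_def by (intro Bochner_Integration.integral_cong) (auto simp: f_def algebra_simps)
        then show ?thesis using inv[OF f, of \<gamma>] by (simp only: integral_minus)
      qed
      have int: "set_integrable \<nu> C ?g" if "C \<in> sets \<nu>" for C
        using int_g that unfolding set_integrable_def by (rule integrable_mult_indicator[rotated])
      have stable: "Int_stable ?E"
        using local_comp2[of "\<lambda>x. x \<in> _" "\<lambda>x. x \<in> _" "(\<and>)"] by (auto simp: Int_stable_def)
      have pow: "?E \<subseteq> Pow UNIV" by simp
      from stable pow A show ?thesis
      proof (induction rule: sigma_sets_induct_disjoint)
        case (compl C)
        have C: "C \<in> sets \<nu>" using E_sets compl by blast
        have "(\<integral>x\<in>UNIV. ?g x \<partial>\<nu>) = (\<integral>x\<in>C. ?g x \<partial>\<nu>) + (\<integral>x\<in>UNIV - C. ?g x \<partial>\<nu>)"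
        proof (subst set_integral_Un[symmetric])
          show "set_integrable \<nu> C ?g" "set_integrable \<nu> (UNIV - C) ?g"
            using C sets.compl_sets[OF C] by (intro int; simp add: sets_nu)+
        qed auto
        then show ?case using compl basic[of UNIV] by simp
      next
        case (union D)
        have D: "D i \<in> sets \<nu>" for i using E_sets union by blast
        have "(\<integral>x\<in>(\<Union>i. D i). ?g x \<partial>\<nu>) = (\<Sum>i. (\<integral>x\<in>D i. ?g x \<partial>\<nu>))"
          using D union by (intro lebesgue_integral_countable_add int) (auto simp: disjoint_family_on_def)
        then show ?case using union by simp
      qed (use basic in \<open>auto simp: set_lebesgue_integral_def\<close>)
    qed
    show ?thesis
    proof (rule fs.real_cond_exp_charact)
      show i1: "integrable \<nu> (indicator {x. x \<gamma> = a} :: _ \<Rightarrow> real)" using integrable_local[OF \<nu> li] by simp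
      show i2: "integrable \<nu> (\<lambda>y. rate \<gamma> y a)" by (rule integrable_local[OF \<nu> local_rate])
      show "(\<lambda>y. rate \<gamma> y a) \<in> borel_measurable (outside_algebra \<gamma>)" by (rule rate_outside_measurable)
      fix A :: "('g \<Rightarrow> 'a) set" assume A: "A \<in> sets (outside_algebra \<gamma>)"
      then have "A \<in> sets \<nu>" using sub by (auto simp: subalgebra_def)
      then have "(\<integral>x\<in>A. ?g x \<partial>\<nu>) = (\<integral>x\<in>A. indicator {x. x \<gamma> = a} x \<partial>\<nu>) - (\<integral>x\<in>A. rate \<gamma> x a \<partial>\<nu>)"
        using i1 i2 by (intro set_integral_diff) (auto simp only: set_integrable_def intro!: integrable_mult_indicator)
      then show "(\<integral>x\<in>A. indicator {x. x \<gamma> = a} x \<partial>\<nu>) = (\<integral>x\<in>A. rate \<gamma> x a \<partial>\<nu>)"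
        using zero[OF A] by simp
    qed
  qed
  then show ?thesis using \<nu> rate_outside_measurable by (auto simp: gibbs_measures_def)
qed

end


section \<open>Glauber dynamics on a finite model\<close>

text \<open>A bound per vertex for \<open>loop_energy\<close>; the factor 2 pays for loops being
  counted twice.\<close>

definition (in glauber) energy_bound :: real where
  "energy_bound = (\<Sum>a\<in>UNIV. \<bar>h a\<bar>) + real r * (2 * (\<Sum>a\<in>UNIV. \<Sum>b\<in>UNIV. \<bar>J a b\<bar>))"

text \<open>If none of these fixes \<open>v\<close>, then \<open>good W v\<close> holds: the first
  kind would identify two sites in the image of \<open>W\<close>, the second would create a loop at
  one of them.\<close>

definition (in glauber) forbidden :: "'g set \<Rightarrow> 'g set" where
  "forbidden W = {g. g \<noteq> 0 \<and> ((\<exists>\<beta>\<in>W. \<exists>\<gamma>\<in>W. g = - \<beta> + \<gamma>) \<or> (\<exists>\<gamma>\<in>W. \<exists>i\<in>{1..r}. g = - \<gamma> + s i + \<gamma>))}"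

lemma (in glauber) finite_forbidden: assumes "finite W" shows "finite (forbidden W)"
proof (rule finite_subset)
  show "forbidden W \<subseteq> (\<lambda>(\<beta>, \<gamma>). - \<beta> + \<gamma>) ` (W \<times> W) \<union> (\<lambda>(\<gamma>, i). - \<gamma> + s i + \<gamma>) ` (W \<times> {1..r})"
    by (auto simp: forbidden_def)
qed (use assms in auto)

text \<open>Serves as \<open>key\<close>: two configurations have equal erasures exactly when they
  agree off \<open>w\<close>.\<close>

definition erase :: "'v \<Rightarrow> ('v \<Rightarrow> 'a) \<Rightarrow> 'v \<Rightarrow> 'a" where
  "erase w x = x(w := undefined)"

locale finite_glauber = glauber r s J h
  for r :: nat and s :: "nat \<Rightarrow> 'g::{group_add, countable}"
    and J :: "'a::finite_discrete \<Rightarrow> 'a \<Rightarrow> real" and h :: "'a \<Rightarrow> real" +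
  fixes V :: "'v set" and \<sigma> :: "'g \<Rightarrow> 'v \<Rightarrow> 'v"
  assumes fin_V: "finite V" and V_ne: "V \<noteq> {}" and hom: "hom_to_Sym V \<sigma>"
    and J_sym: "J a b = J b a"
begin

abbreviation conf :: "('v \<Rightarrow> 'a) set" where
  "conf \<equiv> V \<rightarrow>\<^sub>E UNIV"

text \<open>A generator \<open>s i = 0\<close> contributes \<open>2 * J a a\<close> to \<^const>\<open>local_energy\<close> but only \<open>J a a\<close> per vertex to
  \<^const>\<open>energy\<close>, so reversibility needs the loops counted twice.\<close>

definition loop_energy :: "('v \<Rightarrow> 'a) \<Rightarrow> real" where
  "loop_energy x = (\<Sum>v\<in>V. h (x v)) +
    (\<Sum>i=1..r. \<Sum>v\<in>V. if s i = 0 then 2 * J (x v) (x v) else J (x v) (x (\<sigma> (s i) v)))"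

definition site_energy :: "'v \<Rightarrow> ('v \<Rightarrow> 'a) \<Rightarrow> 'a \<Rightarrow> real" where
  "site_energy w x a = h a + (\<Sum>i=1..r. if s i = 0 then 2 * J a a
     else J a (x (\<sigma> (s i) w)) + J a (x (\<sigma> (- s i) w)))"

sublocale hb: heat_bath conf "\<lambda>x. exp (- loop_energy x)" erase
  using fin_V by unfold_locales (auto intro: finite_PiE)

abbreviation name :: "'v \<Rightarrow> ('v \<Rightarrow> 'a) \<Rightarrow> 'g \<Rightarrow> 'a" where
  "name v x \<equiv> pullback_name \<sigma> x v"

definition loop_free :: "'v \<Rightarrow> bool" where
  "loop_free w \<longleftrightarrow> (\<forall>i\<in>{1..r}. s i \<noteq> 0 \<longrightarrow> \<sigma> (s i) w \<noteq> w)"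

text \<open>At such a vertex the model looks like \<open>\<Gamma>\<close> on \<open>W\<close>: a
  flip at \<open>\<sigma> \<gamma> v\<close> with \<open>\<gamma> \<in> W\<close> changes no other
  coordinate of the name in \<open>W\<close>, and the resampling rates coincide.\<close>

definition good :: "'g set \<Rightarrow> 'v \<Rightarrow> bool" where
  "good W v \<longleftrightarrow> inj_on (\<lambda>\<gamma>. \<sigma> \<gamma> v) W \<and> (\<forall>\<gamma>\<in>W. loop_free (\<sigma> \<gamma> v))"

definition bad_fraction :: "'g set \<Rightarrow> real" where
  "bad_fraction W = card {v \<in> V. \<not> good W v} / card V"

text \<open>The integral of \<open>f\<close> against the empirical distribution of \<open>x\<close>;
  \<open>pair\<close> is its mean over \<open>\<zeta>\<close>, that is
  \<open>P_\<zeta>(f)\<close>.\<close>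

definition emp :: "(('g \<Rightarrow> 'a) \<Rightarrow> real) \<Rightarrow> ('v \<Rightarrow> 'a) \<Rightarrow> real" where
  "emp f x = (\<Sum>v\<in>V. f (name v x)) / card V"

definition pair :: "(('v \<Rightarrow> 'a) \<Rightarrow> real) \<Rightarrow> (('g \<Rightarrow> 'a) \<Rightarrow> real) \<Rightarrow> real" where
  "pair \<zeta> f = (\<Sum>x\<in>conf. \<zeta> x * emp f x)"

lemma card_V_pos: "0 < real (card V)"
  using fin_V V_ne by (simp add: card_gt_0_iff)

section \<open>Resampling in the model against flips on the group\<close>

lemma conf_update: "x \<in> conf \<Longrightarrow> w \<in> V \<Longrightarrow> x(w := a) \<in> conf"
  by (auto simp: PiE_def extensional_def)

lemma fib_image:
  assumes "x \<in> conf" "w \<in> V"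
  shows "hb.fib w x = (\<lambda>a. x(w := a)) ` UNIV"
proof (rule set_eqI, rule iffI)
  fix y assume "y \<in> hb.fib w x"
  then have "y(w := undefined) = x(w := undefined)" by (simp add: hb.fib_def erase_def)
  then have "y u = (x(w := y w)) u" for u by (cases "u = w") (auto dest: fun_cong[where x = u])
  then show "y \<in> (\<lambda>a. x(w := a)) ` UNIV" by blast
qed (use conf_update[OF assms] in \<open>auto simp: hb.fib_def erase_def\<close>)

lemma sum_fib_update:
  assumes "x \<in> conf" "w \<in> V"
  shows "(\<Sum>y\<in>hb.fib w x. F y) = (\<Sum>a\<in>UNIV. F (x(w := a)))"
proof -
  have "inj (\<lambda>a. x(w := a))" by (intro injI) (metis fun_upd_same)
  then show ?thesis by (simp add: fib_image[OF assms] sum.reindex)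
qed

text \<open>Besides the field, the spin at \<open>w\<close> enters through the edges leaving and
  entering \<open>w\<close>, which have the same form since \<open>J\<close> is symmetric.
  \<open>loop_free\<close> makes the two edges of one label distinct unless \<open>s i = 0\<close>,
  where the doubled loop matches \<open>site_energy\<close>.\<close>

lemma loop_energy_update:
  assumes w: "w \<in> V" "loop_free w"
  shows "\<exists>C. \<forall>a. loop_energy (x(w := a)) = site_energy w x a + C"
proof -
  have 1: "(\<Sum>v\<in>V. h ((x(w := a)) v)) = h a + (\<Sum>v\<in>V - {w}. h (x v))" for a
    using fin_V w(1) by (simp add: sum.remove[of V w])
  define e where "e i y = (\<Sum>v\<in>V. if s i = 0 then 2 * J (y v) (y v) else J (y v) (y (\<sigma> (s i) v)))" for i y
  define t where "t i a = (if s i = 0 then 2 * J a a else J a (x (\<sigma> (s i) w)) + J a (x (\<sigma> (- s i) w)))" for i a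
  have 2: "\<exists>C. \<forall>a. e i (x(w := a)) = t i a + C" if i: "i \<in> {1..r}" for i
  proof (cases "s i = 0")
    case True
    then have "e i (x(w := a)) = t i a + (\<Sum>v\<in>V - {w}. 2 * J (x v) (x v))" for a
      using fin_V w(1) by (simp add: e_def t_def sum.remove[of V w])
    then show ?thesis by blast
  next
    case False
    define p where "p = \<sigma> (s i)"
    define q where "q = \<sigma> (- s i) w"
    have pw: "p w \<noteq> w" using w(2) i False by (simp add: loop_free_def p_def)
    have pq: "p q = w" by (simp add: p_def q_def hom_inv[OF hom])
    have qV: "q \<in> V" "q \<noteq> w" using pw pq hom_in[OF hom w(1)] by (auto simp: q_def)
    have pv: "v = q" if "p v = w" for v
      using that hom_inv(1)[OF hom, of "s i" v] by (simp add: p_def q_def)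
    let ?F = "\<lambda>a v. J ((x(w := a)) v) ((x(w := a)) (p v))"
    have "e i (x(w := a)) = t i a + (\<Sum>v\<in>V - {w} - {q}. J (x v) (x (p v)))" for a
    proof -
      have "e i (x(w := a)) = (\<Sum>v\<in>V. ?F a v)" using False by (simp add: e_def p_def)
      also have "\<dots> = ?F a w + (?F a q + (\<Sum>v\<in>V - {w} - {q}. ?F a v))"
        using fin_V w(1) qV sum.remove[of V w "?F a"] sum.remove[of "V - {w}" q "?F a"] by simp
      also have "(\<Sum>v\<in>V - {w} - {q}. ?F a v) = (\<Sum>v\<in>V - {w} - {q}. J (x v) (x (p v)))"
        using pv by (intro sum.cong refl) auto
      also have "?F a w = J a (x (p w))" using pw by simp
      also have "?F a q = J a (x q)" using qV pq J_sym by simp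
      finally show ?thesis using False by (simp add: t_def p_def q_def del: fun_upd_apply)
    qed
    then show ?thesis by blast
  qed
  then obtain C where C: "\<And>i a. i \<in> {1..r} \<Longrightarrow> e i (x(w := a)) = t i a + C i" by metis
  have "loop_energy (x(w := a)) = site_energy w x a + ((\<Sum>v\<in>V - {w}. h (x v)) + (\<Sum>i=1..r. C i))" for a
  proof -
    have "loop_energy (x(w := a)) = h a + (\<Sum>v\<in>V - {w}. h (x v)) + (\<Sum>i=1..r. e i (x(w := a)))"
      unfolding loop_energy_def 1 e_def ..
    also have "(\<Sum>i=1..r. e i (x(w := a))) = (\<Sum>i=1..r. t i a + C i)"
      by (intro sum.cong refl C)
    finally show ?thesis by (simp add: site_energy_def t_def sum.distrib del: fun_upd_apply)
  qed
  then show ?thesis by blast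
qed

lemma cond_eq:
  assumes x: "x \<in> conf" and w: "w \<in> V" "loop_free w"
  shows "hb.cond w \<phi> x =
    (\<Sum>a\<in>UNIV. exp (- site_energy w x a) / (\<Sum>b\<in>UNIV. exp (- site_energy w x b)) * \<phi> (x(w := a)))"
proof -
  obtain C where C: "\<And>a. loop_energy (x(w := a)) = site_energy w x a + C"
    using loop_energy_update[OF w] by blast
  have "hb.cond w \<phi> x = (\<Sum>a\<in>UNIV. exp (- C) * (exp (- site_energy w x a) * \<phi> (x(w := a))))
      / (\<Sum>b\<in>UNIV. exp (- C) * exp (- site_energy w x b))"
    unfolding hb.cond_def sum_fib_update[OF x w(1)] C minus_add_distrib exp_add by (simp add: mult_ac)
  then show ?thesis
    by (simp add: sum_divide_distrib flip: sum_distrib_left)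
qed

text \<open>\<open>g + \<gamma>\<close> coincides with \<open>\<gamma>\<close> only for
  \<open>g = 0\<close>, which is the case distinction made in \<open>site_energy\<close>. Hence the
  equality holds even at vertices where the model degenerates.\<close>

lemma local_energy_name:
  "local_energy r s J h \<gamma> ((name v x)(\<gamma> := a)) = site_energy (\<sigma> \<gamma> v) x a"
proof -
  have e: "((name v x)(\<gamma> := a)) (g + \<gamma>) = (if g = 0 then a else x (\<sigma> g (\<sigma> \<gamma> v)))" for g
  proof -
    have "g + \<gamma> = \<gamma> \<longleftrightarrow> g = 0" by (metis add_0 add_right_cancel)
    then show ?thesis by (simp add: pullback_name_def hom_add[OF hom])
  qed
  show ?thesis
    unfolding local_energy_def site_energy_def e fun_upd_same by (intro arg_cong2[where f = "(+)"] refl sum.cong) auto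
qed

lemma cond_name:
  assumes "x \<in> conf" "v \<in> V" "loop_free (\<sigma> \<gamma> v)"
  shows "hb.cond (\<sigma> \<gamma> v) \<phi> x = (\<Sum>a\<in>UNIV. rate \<gamma> (name v x) a * \<phi> (x(\<sigma> \<gamma> v := a)))"
  unfolding cond_eq[OF assms(1) hom_in[OF hom assms(2)] assms(3)] flip_rate_def local_energy_name ..

lemma cond_flip_mean:
  assumes f: "depends_on W f" and v: "v \<in> V" "good W v" and x: "x \<in> conf" and \<gamma>: "\<gamma> \<in> W"
  shows "hb.cond (\<sigma> \<gamma> v) (\<lambda>x. f (name v x)) x = flip_mean \<gamma> f (name v x)"
proof -
  have "f (name v (x(\<sigma> \<gamma> v := a))) = f ((name v x)(\<gamma> := a))" for a
  proof (rule depends_onD[OF f])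
    fix \<beta> assume "\<beta> \<in> W"
    then have "\<sigma> \<beta> v = \<sigma> \<gamma> v \<longleftrightarrow> \<beta> = \<gamma>" using v(2) \<gamma> by (auto simp: good_def inj_on_def)
    then show "name v (x(\<sigma> \<gamma> v := a)) \<beta> = ((name v x)(\<gamma> := a)) \<beta>" by (simp add: pullback_name_def)
  qed
  then show ?thesis using v \<gamma> x by (subst cond_name) (auto simp: good_def flip_mean_def)
qed

lemma cond_name_away:
  assumes f: "depends_on W f" and x: "x \<in> conf" and w: "w \<in> V" "w \<notin> (\<lambda>\<gamma>. \<sigma> \<gamma> v) ` W"
  shows "hb.cond w (\<lambda>x. f (name v x)) x = f (name v x)"
proof (rule hb.cond_const[OF x])
  fix y assume "y \<in> hb.fib w x"
  then obtain a where "y = x(w := a)" using fib_image[OF x w(1)] by auto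
  then show "f (name v y) = f (name v x)"
    using w(2) by (intro depends_onD[OF f]) (auto simp: pullback_name_def)
qed

lemma generator_name_restrict:
  assumes f: "finite W" "depends_on W f" and v: "v \<in> V" and x: "x \<in> conf"
  shows "(\<Sum>w\<in>V. hb.cond w (\<lambda>x. f (name v x)) x - f (name v x))
    = (\<Sum>w\<in>(\<lambda>\<gamma>. \<sigma> \<gamma> v) ` W. hb.cond w (\<lambda>x. f (name v x)) x - f (name v x))"
  using fin_V hom_in[OF hom v] cond_name_away[OF f(2) x]
  by (intro sum.mono_neutral_right) auto

lemma generator_name:
  assumes f: "finite W" "depends_on W f" and v: "v \<in> V" "good W v" and x: "x \<in> conf"
  shows "(\<Sum>w\<in>V. hb.cond w (\<lambda>x. f (name v x)) x - f (name v x)) = gen f (name v x)"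
  using generator_name_restrict[OF f v(1) x] v(2) cond_flip_mean[OF f(2) v x]
  by (simp add: sum.reindex good_def gen_eq_sum[OF f])

lemma generator_name_bound:
  fixes B :: real
  assumes f: "finite W" "depends_on W f" "\<And>y. \<bar>f y\<bar> \<le> B" and v: "v \<in> V" and x: "x \<in> conf"
  shows "\<bar>\<Sum>w\<in>V. hb.cond w (\<lambda>x. f (name v x)) x - f (name v x)\<bar> \<le> 2 * B * card W"
proof -
  have B: "0 \<le> B" using f(3)[of undefined] by linarith
  have "\<bar>hb.cond w (\<lambda>x. f (name v x)) x - f (name v x)\<bar> \<le> 2 * B" for w
  proof -
    have "\<bar>hb.cond w (\<lambda>x. f (name v x)) x\<bar> \<le> B" by (intro hb.abs_cond_le x f(3))
    then show ?thesis using f(3)[of "name v x"] by linarith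
  qed
  then have "\<bar>\<Sum>w\<in>V. hb.cond w (\<lambda>x. f (name v x)) x - f (name v x)\<bar> \<le> (\<Sum>w\<in>(\<lambda>\<gamma>. \<sigma> \<gamma> v) ` W. 2 * B)"
    unfolding generator_name_restrict[OF f(1,2) v x] by (intro order.trans[OF sum_abs] sum_mono)
  also have "\<dots> \<le> 2 * B * card W"
    using mult_right_mono[of "real (card ((\<lambda>\<gamma>. \<sigma> \<gamma> v) ` W))" "real (card W)" "2 * B"] card_image_le[OF f(1), of "\<lambda>\<gamma>. \<sigma> \<gamma> v"] B
    by (simp add: mult_ac)
  finally show ?thesis .
qed

lemma abs_flip_mean_le:
  fixes B :: real
  shows "(\<And>y. \<bar>f y\<bar> \<le> B) \<Longrightarrow> \<bar>flip_mean \<gamma> f x\<bar> \<le> B"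
proof -
  assume f: "\<And>y. \<bar>f y\<bar> \<le> B"
  have "\<bar>flip_mean \<gamma> f x\<bar> \<le> (\<Sum>a\<in>UNIV. rate \<gamma> x a * B)"
    unfolding flip_mean_def using f rate_nonneg
    by (intro order.trans[OF sum_abs] sum_mono) (auto simp: abs_mult intro!: mult_left_mono)
  then show ?thesis using sum_rate[of \<gamma> x] by (simp flip: sum_distrib_right)
qed

lemma gen_bound:
  fixes B :: real
  assumes f: "finite W" "depends_on W f" "\<And>y. \<bar>f y\<bar> \<le> B"
  shows "\<bar>gen f x\<bar> \<le> 2 * B * card W"
proof -
  have "\<bar>flip_mean \<gamma> f x - f x\<bar> \<le> 2 * B" for \<gamma>
    using abs_flip_mean_le[of f B \<gamma> x, OF f(3)] f(3)[of x] by linarith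
  then have "\<bar>gen f x\<bar> \<le> (\<Sum>\<gamma>\<in>W. 2 * B)"
    unfolding gen_eq_sum[OF f(1,2)] by (intro order.trans[OF sum_abs] sum_mono)
  then show ?thesis by (simp add: mult.commute)
qed

text \<open>Good vertices are charged \<open>G v\<close> and bad ones the uniform bound
  \<open>B\<close>; as \<open>G\<close> is nonnegative, its sum may run over all of
  \<open>V\<close>.\<close>

lemma average_bound:
  fixes B :: real
  assumes "\<And>v. v \<in> V \<Longrightarrow> good W v \<Longrightarrow> \<bar>F v\<bar> \<le> G v" "\<And>v. v \<in> V \<Longrightarrow> \<bar>F v\<bar> \<le> B" "\<And>v. v \<in> V \<Longrightarrow> 0 \<le> G v"
  shows "\<bar>(\<Sum>v\<in>V. F v) / card V\<bar> \<le> (\<Sum>v\<in>V. G v) / card V + B * bad_fraction W"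
proof -
  have "\<bar>\<Sum>v\<in>V. F v\<bar> \<le> (\<Sum>v\<in>V. G v + (if \<not> good W v then B else 0))"
  proof (rule order.trans[OF sum_abs sum_mono])
    fix v assume "v \<in> V"
    then show "\<bar>F v\<bar> \<le> G v + (if \<not> good W v then B else 0)" using assms(1-3)[of v] by auto
  qed
  also have "\<dots> = (\<Sum>v\<in>V. G v) + B * card {v \<in> V. \<not> good W v}"
    using fin_V by (simp add: sum.distrib flip: sum.inter_filter)
  finally show ?thesis using card_V_pos
    by (simp add: abs_divide bad_fraction_def field_simps)
qed

text \<open>By linearity the model's generator acts on \<open>emp f\<close> vertex by vertex, and at
  good vertices it agrees with \<open>gen\<close>. At a bad vertex each of the two generators is at
  most \<open>2 * B * card W\<close>.\<close>

lemma generator_emp: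
  fixes B :: real
  assumes f: "finite W" "depends_on W f" "\<And>y. \<bar>f y\<bar> \<le> B" and x: "x \<in> conf"
  shows "\<bar>(\<Sum>w\<in>V. hb.cond w (emp f) x - emp f x) - emp (gen f) x\<bar> \<le> 4 * B * card W * bad_fraction W"
proof -
  have c: "hb.cond w (emp f) x = (\<Sum>v\<in>V. hb.cond w (\<lambda>x. f (name v x)) x) / card V" for w
    unfolding hb.cond_def emp_def sum_divide_distrib[symmetric] sum_distrib_left
    by (subst sum.swap) (simp add: sum_distrib_left sum_divide_distrib mult_ac)
  have "(\<Sum>w\<in>V. hb.cond w (emp f) x - emp f x) - emp (gen f) x
    = (\<Sum>v\<in>V. (\<Sum>w\<in>V. hb.cond w (\<lambda>x. f (name v x)) x - f (name v x)) - gen f (name v x)) / card V"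
  proof -
    have "(\<Sum>v\<in>V. (\<Sum>w\<in>V. hb.cond w (\<lambda>x. f (name v x)) x - f (name v x)) - gen f (name v x))
      = (\<Sum>v\<in>V. \<Sum>w\<in>V. hb.cond w (\<lambda>x. f (name v x)) x - f (name v x)) - (\<Sum>v\<in>V. gen f (name v x))"
      by (rule sum_subtractf)
    also have "(\<Sum>v\<in>V. \<Sum>w\<in>V. hb.cond w (\<lambda>x. f (name v x)) x - f (name v x))
      = (\<Sum>w\<in>V. \<Sum>v\<in>V. hb.cond w (\<lambda>x. f (name v x)) x - f (name v x))"
      by (rule sum.swap)
    finally show ?thesis
      by (simp only: c emp_def sum_subtractf diff_divide_distrib sum_divide_distrib)
  qed
  also have "\<bar>\<dots>\<bar> \<le> (\<Sum>v\<in>V. 0) / card V + (4 * B * card W) * bad_fraction W"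
  proof (rule average_bound)
    fix v assume v: "v \<in> V"
    show "\<bar>(\<Sum>w\<in>V. hb.cond w (\<lambda>x. f (name v x)) x - f (name v x)) - gen f (name v x)\<bar> \<le> 4 * B * card W"
      using generator_name_bound[OF f v x] gen_bound[OF f, of "name v x"] by linarith
    show "\<bar>(\<Sum>w\<in>V. hb.cond w (\<lambda>x. f (name v x)) x - f (name v x)) - gen f (name v x)\<bar> \<le> 0" if "good W v"
      using generator_name[OF f(1,2) v that x] by simp
  qed simp
  finally show ?thesis by simp
qed

lemma emp_bound:
  fixes B :: real
  assumes "\<And>y. \<bar>f y\<bar> \<le> B" shows "\<bar>emp f x\<bar> \<le> B"
proof -
  have "\<bar>\<Sum>v\<in>V. f (name v x)\<bar> \<le> (\<Sum>v\<in>V. B)" using assms by (intro order.trans[OF sum_abs] sum_mono)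
  then show ?thesis using card_V_pos by (simp add: emp_def abs_divide field_simps)
qed

lemma prob_sum_bound:
  fixes B :: real
  assumes "hb.is_prob \<zeta>" "\<And>x. x \<in> conf \<Longrightarrow> \<bar>F x\<bar> \<le> B"
  shows "\<bar>\<Sum>x\<in>conf. \<zeta> x * F x\<bar> \<le> B"
proof -
  have "\<bar>\<Sum>x\<in>conf. \<zeta> x * F x\<bar> \<le> (\<Sum>x\<in>conf. \<zeta> x * B)"
    using assms by (intro order.trans[OF sum_abs] sum_mono)
      (auto simp: hb.is_prob_def abs_mult intro!: mult_left_mono)
  then show ?thesis using assms(1) by (simp add: hb.is_prob_def flip: sum_distrib_right)
qed

lemma not_good:
  assumes "\<not> good W v" shows "\<exists>g\<in>forbidden W. \<sigma> g v = v"
proof (cases "inj_on (\<lambda>\<gamma>. \<sigma> \<gamma> v) W")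
  case False
  then obtain \<beta> \<gamma> where g: "\<beta> \<in> W" "\<gamma> \<in> W" "\<beta> \<noteq> \<gamma>" "\<sigma> \<beta> v = \<sigma> \<gamma> v" by (auto simp: inj_on_def)
  have "- \<beta> + \<gamma> \<noteq> 0" using g(3) by (metis add.right_neutral add_minus_cancel)
  moreover have "\<sigma> (- \<beta> + \<gamma>) v = v" using g(4) hom_inv(1)[OF hom, of \<beta> v] by (simp add: hom_add[OF hom])
  ultimately show ?thesis using g by (auto simp: forbidden_def)
next
  case True
  then obtain \<gamma> i where g: "\<gamma> \<in> W" "i \<in> {1..r}" "s i \<noteq> 0" "\<sigma> (s i) (\<sigma> \<gamma> v) = \<sigma> \<gamma> v"
    using assms by (auto simp: good_def loop_free_def)
  have "- \<gamma> + s i + \<gamma> \<noteq> 0"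
    using g(3) by (metis add.assoc add.right_neutral add_minus_cancel add_0 add_right_cancel)
  moreover have "\<sigma> (- \<gamma> + s i + \<gamma>) v = v" using g(4) by (simp add: hom_add[OF hom] hom_inv[OF hom])
  moreover have "- \<gamma> + s i + \<gamma> \<in> forbidden W"
    using calculation(1) g(1,2) unfolding forbidden_def by blast
  ultimately show ?thesis by blast
qed

lemma bad_fraction_le: "bad_fraction W \<le> card {v \<in> V. \<exists>g\<in>forbidden W. \<sigma> g v = v} / card V"
  unfolding bad_fraction_def using not_good fin_V
  by (intro divide_right_mono of_nat_mono card_mono) auto

section \<open>Empirical means along Euler chains\<close>

lemma pair_bound:
  fixes B :: real
  shows "hb.is_prob \<zeta> \<Longrightarrow> (\<And>y. \<bar>f y\<bar> \<le> B) \<Longrightarrow> \<bar>pair \<zeta> f\<bar> \<le> B"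
  unfolding pair_def by (intro prob_sum_bound emp_bound)

lemma pair_diff: "pair \<zeta> (\<lambda>y. f y - g y) = pair \<zeta> f - pair \<zeta> g"
  by (simp add: pair_def emp_def sum_subtractf right_diff_distrib diff_divide_distrib)

lemma pair_scale: "pair \<zeta> (\<lambda>y. c * f y) = c * pair \<zeta> f"
  by (simp add: pair_def emp_def sum_distrib_left mult_ac)

text \<open>The weak Euler equation for \<open>emp f\<close>; \<open>generator_emp\<close> is the
  price of replacing the model's generator by \<open>gen\<close>.\<close>

lemma pair_implicit_euler:
  fixes B :: real
  assumes e: "hb.implicit_euler V \<tau> \<zeta> \<xi>" and \<xi>: "hb.is_prob \<xi>" and "0 \<le> \<tau>"
    and f: "finite W" "depends_on W f" "\<And>y. \<bar>f y\<bar> \<le> B"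
  shows "\<bar>pair \<zeta> f - (pair \<xi> f - \<tau> * pair \<xi> (gen f))\<bar> \<le> \<tau> * (4 * B * card W * bad_fraction W)"
proof -
  define L where "L x = (\<Sum>w\<in>V. hb.cond w (emp f) x - emp f x)" for x
  have "pair \<zeta> f = (\<Sum>x\<in>conf. \<xi> x * (emp f x - \<tau> * L x))"
    unfolding pair_def hb.implicit_euler_pairing[OF e fin_V] L_def ..
  then have "pair \<zeta> f - (pair \<xi> f - \<tau> * pair \<xi> (gen f)) = (\<Sum>x\<in>conf. \<xi> x * (- \<tau> * (L x - emp (gen f) x)))"
    by (simp add: pair_def algebra_simps sum_subtractf sum.distrib sum_distrib_left)
  also have "\<bar>\<dots>\<bar> \<le> \<tau> * (4 * B * card W * bad_fraction W)"
  proof (rule prob_sum_bound[OF \<xi>])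
    fix x assume "x \<in> conf"
    then show "\<bar>- \<tau> * (L x - emp (gen f) x)\<bar> \<le> \<tau> * (4 * B * card W * bad_fraction W)"
      using generator_emp[OF f] \<open>0 \<le> \<tau>\<close> by (simp add: abs_mult mult_left_mono L_def)
  qed
  finally show ?thesis .
qed

lemma pair_close:
  fixes B :: real
  assumes "hb.is_prob \<zeta>" "\<And>y. \<bar>f y - g y\<bar> \<le> B"
  shows "\<bar>pair \<zeta> f - pair \<zeta> g\<bar> \<le> B"
  using pair_bound[OF assms] by (simp add: pair_diff)

text \<open>\<open>U i\<close> stands for \<open>S (i * \<tau>) U\<^sub>0\<close> and \<open>H i\<close> for its image under the generator. The chain \<open>Z\<close> solves
  the backward Euler scheme, as \<open>U\<close> does up to \<open>e * \<tau>\<close>, so one step costs no second derivative.\<close>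

lemma euler_tracking:
  fixes U H g :: "nat \<Rightarrow> ('g \<Rightarrow> 'a) \<Rightarrow> real" and B e \<eta> \<tau> :: real
  assumes Z: "\<And>j. hb.is_prob (Z j)" "\<And>j. hb.implicit_euler V \<tau> (Z j) (Z (Suc j))" and \<tau>: "0 < \<tau>"
    and g: "finite W" "\<And>i. i \<le> M \<Longrightarrow> depends_on W (g i)" "\<And>i y. \<bar>g i y\<bar> \<le> B"
    and gU: "\<And>i y. \<bar>g i y - U i y\<bar> \<le> \<eta>" and gH: "\<And>i y. \<bar>gen (g i) y - H i y\<bar> \<le> \<eta>"
    and UH: "\<And>i y. \<bar>U (Suc i) y - \<tau> * H (Suc i) y - U i y\<bar> \<le> e * \<tau>"
  shows "i + j \<le> M \<Longrightarrow> \<bar>pair (Z j) (U i) - pair (Z 0) (U (i + j))\<bar>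
    \<le> j * (e * \<tau> + (2 + \<tau>) * \<eta> + \<tau> * (4 * B * card W * bad_fraction W))"
proof (induction j arbitrary: i)
  case (Suc j)
  \<comment> \<open>One backward step trades \<open>Z (Suc j)\<close> against \<open>U i\<close> for
    \<open>Z j\<close> against \<open>U (Suc i)\<close>. The generator is applied to the local
    substitute \<open>g (Suc i)\<close>, whose index stays in range by
    \<open>i + Suc j \<le> M\<close>.\<close>
  let ?k = "Suc i" and ?a = "pair (Z (Suc j))" and ?b = "pair (Z j)"
  let ?\<delta> = "e * \<tau> + (2 + \<tau>) * \<eta> + \<tau> * (4 * B * card W * bad_fraction W)"
  have "\<bar>?b (g ?k) - (?a (g ?k) - \<tau> * ?a (gen (g ?k)))\<bar> \<le> \<tau> * (4 * B * card W * bad_fraction W)"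
    using Suc.prems \<tau> g(3) by (intro pair_implicit_euler Z g(1,2)) auto
  moreover have "\<bar>?b (g ?k) - ?b (U ?k)\<bar> \<le> \<eta>" "\<bar>?a (g ?k) - ?a (U ?k)\<bar> \<le> \<eta>"
    by (intro pair_close Z gU)+
  moreover have "\<bar>\<tau> * ?a (gen (g ?k)) - \<tau> * ?a (H ?k)\<bar> \<le> \<tau> * \<eta>"
  proof -
    have "\<bar>?a (gen (g ?k)) - ?a (H ?k)\<bar> \<le> \<eta>" by (intro pair_close Z gH)
    then show ?thesis using \<tau> by (simp add: abs_mult flip: right_diff_distrib)
  qed
  moreover have "\<bar>?a (U ?k) - \<tau> * ?a (H ?k) - ?a (U i)\<bar> \<le> e * \<tau>"
  proof -
    have "\<bar>?a (\<lambda>y. U ?k y - \<tau> * H ?k y - U i y)\<bar> \<le> e * \<tau>" by (intro pair_bound Z UH)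
    then show ?thesis by (simp add: pair_diff pair_scale)
  qed
  moreover have "(2 + \<tau>) * \<eta> = 2 * \<eta> + \<tau> * \<eta>" by (simp add: algebra_simps)
  ultimately have "\<bar>?a (U i) - ?b (U ?k)\<bar> \<le> ?\<delta>" by linarith
  moreover have "\<bar>?b (U ?k) - pair (Z 0) (U (?k + j))\<bar> \<le> j * ?\<delta>"
    using Suc.prems by (intro Suc.IH) simp
  moreover have "real (Suc j) * ?\<delta> = ?\<delta> + j * ?\<delta>" by (simp add: algebra_simps)
  ultimately show ?case by simp
qed simp

lemma euler_chain_exists:
  assumes "hb.is_prob \<zeta>" "0 < \<tau>"
  obtains Z where "Z 0 = \<zeta>" "\<And>j. hb.is_prob (Z j)" "\<And>j. hb.implicit_euler V \<tau> (Z j) (Z (Suc j))"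
proof -
  have "\<exists>Z. \<forall>n. (hb.is_prob (Z n) \<and> (n = 0 \<longrightarrow> Z n = \<zeta>)) \<and> hb.implicit_euler V \<tau> (Z n) (Z (Suc n))"
  proof (rule dependent_nat_choice)
    show "\<exists>x. hb.is_prob x \<and> (0 = (0::nat) \<longrightarrow> x = \<zeta>)" using assms by blast
    fix x and n :: nat assume "hb.is_prob x \<and> (n = 0 \<longrightarrow> x = \<zeta>)"
    then show "\<exists>y. (hb.is_prob y \<and> (Suc n = 0 \<longrightarrow> y = \<zeta>)) \<and> hb.implicit_euler V \<tau> x y"
      using hb.implicit_euler_exists[of x V \<tau>] fin_V assms(2) by auto
  qed
  then show thesis using that by blast
qed

text \<open>At a good vertex \<open>v\<close>, flipping \<open>\<gamma>\<close> in the name is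
  resampling \<open>\<sigma> \<gamma> v\<close>, so \<open>defect_bound\<close> applies; since
  \<open>\<sigma> \<gamma>\<close> permutes \<open>V\<close>, summing over \<open>v\<close> counts
  each defect once.\<close>

lemma pair_flip_defect:
  fixes B :: real
  assumes \<zeta>: "hb.is_prob \<zeta>" and f: "depends_on W f" "\<And>y. \<bar>f y\<bar> \<le> B" and \<gamma>: "\<gamma> \<in> W"
  shows "\<bar>pair \<zeta> (\<lambda>y. flip_mean \<gamma> f y - f y)\<bar>
    \<le> B * ((\<Sum>w\<in>V. hb.defect w \<zeta>) / card V) + 2 * B * bad_fraction W"
proof -
  have B: "0 \<le> B" using f(2)[of undefined] by linarith
  let ?F = "\<lambda>v. \<Sum>x\<in>conf. \<zeta> x * (flip_mean \<gamma> f (name v x) - f (name v x))"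
  have "pair \<zeta> (\<lambda>y. flip_mean \<gamma> f y - f y) = (\<Sum>v\<in>V. ?F v) / card V"
    unfolding pair_def emp_def
    by (subst sum.swap) (simp add: sum_distrib_left sum_divide_distrib)
  also have "\<bar>\<dots>\<bar> \<le> (\<Sum>v\<in>V. B * hb.defect (\<sigma> \<gamma> v) \<zeta>) / card V + (2 * B) * bad_fraction W"
  proof (rule average_bound)
    fix v assume v: "v \<in> V"
    have "\<bar>flip_mean \<gamma> f y - f y\<bar> \<le> 2 * B" for y
      using abs_flip_mean_le[of f B \<gamma> y, OF f(2)] f(2)[of y] by linarith
    then show "\<bar>?F v\<bar> \<le> 2 * B" by (intro prob_sum_bound[OF \<zeta>])
    show "0 \<le> B * hb.defect (\<sigma> \<gamma> v) \<zeta>" using B by (simp add: hb.defect_def sum_nonneg)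
    show "\<bar>?F v\<bar> \<le> B * hb.defect (\<sigma> \<gamma> v) \<zeta>" if "good W v"
    proof -
      have "?F v = (\<Sum>x\<in>conf. \<zeta> x * (hb.cond (\<sigma> \<gamma> v) (\<lambda>x. f (name v x)) x - f (name v x)))"
        using cond_flip_mean[OF f(1) v that _ \<gamma>] by (intro sum.cong) auto
      then show ?thesis using hb.defect_bound[of "\<lambda>x. f (name v x)" B] f(2) by simp
    qed
  qed
  also have "(\<Sum>v\<in>V. B * hb.defect (\<sigma> \<gamma> v) \<zeta>) = B * (\<Sum>w\<in>V. hb.defect w \<zeta>)"
    unfolding sum_distrib_left[symmetric]
    using sum.reindex_bij_betw[OF hom_bij[OF hom], of "\<lambda>w. hb.defect w \<zeta>" \<gamma>] by simp
  finally show ?thesis by simp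
qed

section \<open>Entropy bounds and the dissipation budget\<close>

lemma loop_energy_bound: "\<bar>loop_energy x\<bar> \<le> energy_bound * card V"
proof -
  let ?H = "\<Sum>a\<in>UNIV. \<bar>h a\<bar>" and ?J = "\<Sum>a\<in>UNIV. \<Sum>b\<in>UNIV. \<bar>J a b\<bar>"
  have h: "\<bar>h a\<bar> \<le> ?H" for a by (rule member_le_sum) auto
  have j: "\<bar>J a b\<bar> \<le> ?J" for a b
    by (rule order.trans[OF member_le_sum[of b UNIV] member_le_sum[of a UNIV]]) (auto intro: sum_nonneg)
  have j': "\<bar>J a b\<bar> \<le> 2 * ?J" "\<bar>2 * J a b\<bar> \<le> 2 * ?J" for a b using j[of a b] by auto
  have "\<bar>loop_energy x\<bar> \<le> (\<Sum>v\<in>V. ?H) + (\<Sum>i=1..r. \<Sum>v\<in>V. 2 * ?J)"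
    unfolding loop_energy_def using h j'
    by (intro order.trans[OF abs_triangle_ineq] add_mono order.trans[OF sum_abs] sum_mono) auto
  also have "\<dots> = energy_bound * card V" by (simp add: energy_bound_def algebra_simps)
  finally show ?thesis .
qed

text \<open>The entropy part lies between \<open>- card V * ln (CARD('a))\<close> and 0, the lower
  end by nonnegativity of the relative entropy with respect to the uniform distribution.\<close>

lemma relent_bounds:
  assumes \<zeta>: "hb.is_prob \<zeta>"
  shows "hb.relent \<zeta> \<le> energy_bound * card V"
    and "- (energy_bound + ln (CARD('a))) * card V \<le> hb.relent \<zeta>"
proof -
  have nn: "0 \<le> \<zeta> x" "\<zeta> x \<le> 1" if "x \<in> conf" for x
    using \<zeta> that member_le_sum[of x conf \<zeta>] hb.fin by (auto simp: hb.is_prob_def)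
  have eq: "hb.relent \<zeta> = (\<Sum>x\<in>conf. \<zeta> x * ln (\<zeta> x)) + (\<Sum>x\<in>conf. \<zeta> x * loop_energy x)"
    unfolding hb.relent_def sum.distrib[symmetric]
  proof (intro sum.cong refl)
    fix x assume "x \<in> conf"
    then show "\<zeta> x * ln (\<zeta> x / exp (- loop_energy x)) = \<zeta> x * ln (\<zeta> x) + \<zeta> x * loop_energy x"
      using nn[of x] by (cases "\<zeta> x = 0") (auto simp: ln_div algebra_simps)
  qed
  have E: "\<bar>\<Sum>x\<in>conf. \<zeta> x * loop_energy x\<bar> \<le> energy_bound * card V"
    by (intro prob_sum_bound[OF \<zeta>] loop_energy_bound)
  have "(\<Sum>x\<in>conf. \<zeta> x * ln (\<zeta> x)) \<le> 0"
  proof (rule sum_nonpos)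
    fix x assume "x \<in> conf"
    then show "\<zeta> x * ln (\<zeta> x) \<le> 0"
      using nn[of x] by (cases "\<zeta> x = 0") (auto intro: mult_nonneg_nonpos)
  qed
  then show "hb.relent \<zeta> \<le> energy_bound * card V" using E eq by linarith
  define N where "N = real (card conf)"
  have N: "0 < N" using hb.fin \<zeta> by (auto simp: N_def card_gt_0_iff hb.is_prob_def)
  have lnN: "ln N = card V * ln (CARD('a))"
    using fin_V by (simp add: N_def card_PiE ln_realpow)
  have "0 \<le> 4 * (\<Sum>x\<in>conf. \<zeta> x * ln (\<zeta> x / (1 / N)))"
    using \<zeta> N by (intro order.trans[OF _ kl_lower_bound[of conf \<zeta> "\<lambda>_. 1 / N"]]) (auto simp: hb.is_prob_def N_def)
  also have "(\<Sum>x\<in>conf. \<zeta> x * ln (\<zeta> x / (1 / N))) = (\<Sum>x\<in>conf. \<zeta> x * ln (\<zeta> x) + \<zeta> x * ln N)"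
  proof (intro sum.cong refl)
    fix x assume "x \<in> conf"
    then show "\<zeta> x * ln (\<zeta> x / (1 / N)) = \<zeta> x * ln (\<zeta> x) + \<zeta> x * ln N"
      using nn[of x] N by (cases "\<zeta> x = 0") (auto simp: ln_mult algebra_simps)
  qed
  also have "\<dots> = (\<Sum>x\<in>conf. \<zeta> x * ln (\<zeta> x)) + ln N"
    using \<zeta> by (simp add: sum.distrib hb.is_prob_def flip: sum_distrib_right)
  finally show "- (energy_bound + ln (CARD('a))) * card V \<le> hb.relent \<zeta>"
    using E eq lnN by (simp add: algebra_simps)
qed

text \<open>The drops from \<open>relent_implicit_euler\<close> telescope, and
  \<open>relent_bounds\<close> limits their total to a multiple of \<open>card V\<close>. Division
  by \<open>card V\<close> leaves a bound independent of the model and of \<open>M\<close>.\<close>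

lemma dissipation_budget:
  fixes \<kappa> :: real
  assumes Z: "\<And>j. hb.is_prob (Z j)" "\<And>j. hb.implicit_euler V \<tau> (Z j) (Z (Suc j))" and \<tau>: "0 < \<tau>"
    and D: "\<And>j. j \<in> D \<Longrightarrow> \<kappa> * card V \<le> (\<Sum>w\<in>V. (hb.defect w (Z j))\<^sup>2)" "D \<subseteq> {1..M}"
  shows "\<tau> / 4 * \<kappa> * card D \<le> 2 * energy_bound + ln (CARD('a))"
proof -
  let ?d = "\<lambda>j. \<Sum>w\<in>V. (hb.defect w (Z j))\<^sup>2"
  have "hb.relent (Z M) + \<tau> / 4 * (\<Sum>j=1..M. ?d j) \<le> hb.relent (Z 0)" for M
  proof (induction M)
    case (Suc M)
    have "hb.relent (Z (Suc M)) + \<tau> / 4 * ?d (Suc M) \<le> hb.relent (Z M)"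
      using Z \<tau> fin_V by (intro hb.relent_implicit_euler)
    moreover have "(\<Sum>j=1..Suc M. ?d j) = (\<Sum>j=1..M. ?d j) + ?d (Suc M)" by simp
    ultimately show ?case using Suc by (simp only: distrib_left)
  qed simp
  from this[of M] have 1: "\<tau> / 4 * (\<Sum>j=1..M. ?d j) \<le> (2 * energy_bound + ln (CARD('a))) * card V"
    using relent_bounds(1)[OF Z(1), of 0] relent_bounds(2)[OF Z(1), of M] by (simp add: algebra_simps)
  have "\<kappa> * card V * card D = (\<Sum>j\<in>D. \<kappa> * card V)" by simp
  also have "\<dots> \<le> (\<Sum>j\<in>D. ?d j)" by (intro sum_mono D(1))
  also have "\<dots> \<le> (\<Sum>j=1..M. ?d j)" using D(2) by (intro sum_mono2) (auto intro: sum_nonneg)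
  finally have "\<tau> / 4 * (\<kappa> * card V * card D) \<le> \<tau> / 4 * (\<Sum>j=1..M. ?d j)"
    using \<tau> by (intro mult_left_mono) auto
  with 1 have "(\<tau> / 4 * \<kappa> * card D) * card V \<le> (2 * energy_bound + ln (CARD('a))) * card V"
    by (simp add: mult_ac)
  then show ?thesis using card_V_pos by simp
qed

lemma bad_fraction_nonneg: "0 \<le> bad_fraction W"
  by (simp add: bad_fraction_def)

text \<open>Cauchy-Schwarz over the vertices turns a large average defect into dissipation.\<close>

lemma defect_square_sum:
  fixes c :: real
  assumes "c * card V \<le> (\<Sum>w\<in>V. hb.defect w \<zeta>)" "0 \<le> c"
  shows "c\<^sup>2 * card V \<le> (\<Sum>w\<in>V. (hb.defect w \<zeta>)\<^sup>2)"
proof -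
  have "(c * card V)\<^sup>2 \<le> (\<Sum>w\<in>V. hb.defect w \<zeta>)\<^sup>2" using assms by (intro power_mono) auto
  also have "\<dots> \<le> (\<Sum>w\<in>V. (hb.defect w \<zeta>)\<^sup>2) * (\<Sum>w\<in>V. 1\<^sup>2)"
    using Cauchy_Schwarz_ineq_sum[of "\<lambda>w. hb.defect w \<zeta>" "\<lambda>_. 1" V] by simp
  finally show ?thesis using card_V_pos by (simp add: power2_eq_square mult_ac)
qed

lemma integral_mean_empirical:
  fixes f :: "('g \<Rightarrow> 'a) \<Rightarrow>\<^sub>C real"
  assumes "set_pmf \<zeta> \<subseteq> conf"
  shows "(\<integral>y. apply_bcontfun f y \<partial>mean_empirical V \<sigma> \<zeta>) = pair (pmf \<zeta>) (apply_bcontfun f)"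
proof -
  have meas: "apply_bcontfun f \<in> borel_measurable borel"
    by (intro borel_measurable_continuous_onI) simp
  have P: "prob_space (empirical V \<sigma> x)" for x :: "'v \<Rightarrow> 'a"
    unfolding empirical_def by (intro prob_space.prob_space_distr measure_pmf.prob_space_axioms) simp
  have e: "(\<integral>y. apply_bcontfun f y \<partial>empirical V \<sigma> x) = emp (apply_bcontfun f) x" for x
    unfolding empirical_def using meas fin_V V_ne
    by (simp add: integral_distr integral_pmf_of_set emp_def)
  have "(\<integral>y. apply_bcontfun f y \<partial>mean_empirical V \<sigma> \<zeta>) = (\<integral>x. (\<integral>y. apply_bcontfun f y \<partial>empirical V \<sigma> x) \<partial>measure_pmf \<zeta>)"
    unfolding mean_empirical_def
  proof (rule integral_bind[where K = borel and B = "norm f" and B' = 1])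
    show "empirical V \<sigma> \<in> measurable (measure_pmf \<zeta>) (subprob_algebra borel)"
      using P by (auto simp: measurable_pmf_measure1 space_subprob_algebra empirical_def prob_space_imp_subprob_space)
  qed (use meas P norm_bounded[of f] in \<open>auto simp: prob_space.emeasure_space_1\<close>)
  also have "\<dots> = (\<Sum>x\<in>conf. pmf \<zeta> x * emp (apply_bcontfun f) x)"
    unfolding e using assms hb.fin by (subst integral_measure_pmf[of conf]) auto
  finally show ?thesis by (simp add: pair_def)
qed

lemma is_prob_pmf: "set_pmf \<zeta> \<subseteq> conf \<Longrightarrow> hb.is_prob (pmf \<zeta>)"
  using hb.fin by (simp add: hb.is_prob_def sum_pmf_eq_1)

end


section \<open>Dissipation along the evolution\<close>

text \<open>An infimum over the empty set is \<open>\<infinity>\<close>, so a limsup below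
  \<open>\<infinity>\<close> allows only finitely many empty sets.\<close>

lemma Omega_set_nonempty:
  assumes "free_energy_density r s J h V \<sigma> \<mu> < \<infinity>" "openin weak_topology \<O>" "\<mu> \<in> \<O>"
  shows "\<forall>\<^sub>F n in sequentially. Omega_set (V n) (\<sigma> n) \<O> \<noteq> {}"
proof -
  let ?F = "\<lambda>n. INF \<zeta>\<in>Omega_set (V n) (\<sigma> n) \<O>.
        ereal ((measure_pmf.expectation \<zeta> (energy r s J h (V n) (\<sigma> n)) - shannon_entropy (V n) \<zeta>)
               / real (card (V n)))"
  have "limsup ?F \<le> free_energy_density r s J h V \<sigma> \<mu>"
    unfolding free_energy_density_def using assms(2,3) by (intro SUP_upper2[of \<O>]) auto
  then have "limsup ?F < \<infinity>" using assms(1) by (rule le_less_trans)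
  then have "\<forall>\<^sub>F n in sequentially. ?F n < \<infinity>" by (rule Limsup_lessD)
  then show ?thesis by eventually_elim (auto simp: top_ereal_def)
qed

lemma weak_limit_point_frequently:
  fixes f :: "'x::topological_space \<Rightarrow>\<^sub>C real"
  assumes "\<nu> \<in> weak_limit_points_at_top m" "0 < e"
  shows "\<exists>t\<ge>T. \<bar>(\<integral>x. apply_bcontfun f x \<partial>m t) - (\<integral>x. apply_bcontfun f x \<partial>\<nu>)\<bar> < e"
proof -
  have "\<exists>\<^sub>F t in at_top. m t \<in> {\<rho> \<in> Prob. \<forall>f\<in>{f}. \<bar>(\<integral>x. apply_bcontfun f x \<partial>\<rho>) - (\<integral>x. apply_bcontfun f x \<partial>\<nu>)\<bar> < e}"
    using assms openin_weak_topology[of "{f}" "\<lambda>f. \<integral>x. apply_bcontfun f x \<partial>\<nu>" e]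
    unfolding weak_limit_points_at_top_def by auto
  then show ?thesis by (auto simp: frequently_def eventually_at_top_linorder)
qed

lemma semigroup_near_identity:
  fixes S :: "real \<Rightarrow> ('x::topological_space \<Rightarrow>\<^sub>C real) \<Rightarrow> 'x \<Rightarrow>\<^sub>C real"
  assumes S: "markov_semigroup S" and "0 < e"
  obtains d where "0 < d" "\<And>\<tau>. 0 \<le> \<tau> \<Longrightarrow> \<tau> \<le> d \<Longrightarrow> norm (S \<tau> f - f) \<le> e"
proof -
  have S0: "S 0 f = f" using S by (simp add: markov_semigroup_def)
  have "((\<lambda>u. S u f) \<longlongrightarrow> f) (at_right 0)"
    using S unfolding markov_semigroup_def by (metis id_apply order_refl)
  then have "\<forall>\<^sub>F u in at_right 0. dist (S u f) f < e" using \<open>0 < e\<close> by (simp add: tendsto_iff)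
  then obtain b where b: "0 < b" "\<And>u. 0 < u \<Longrightarrow> u < b \<Longrightarrow> dist (S u f) f < e"
    by (auto simp: eventually_at_right[of 0 1])
  show thesis
  proof (rule that[of "b / 2"])
    fix \<tau> :: real assume "0 \<le> \<tau>" "\<tau> \<le> b / 2"
    then show "norm (S \<tau> f - f) \<le> e"
      using b(1) b(2)[of \<tau>] S0 \<open>0 < e\<close> by (cases "\<tau> = 0") (auto simp: dist_norm)
  qed (use b in simp)
qed

section \<open>Counting grid times in recurring windows\<close>

lemma nat_ceiling_bounds:
  fixes x :: real
  assumes "0 \<le> x" shows "x \<le> real (nat \<lceil>x\<rceil>)" "real (nat \<lceil>x\<rceil>) \<le> x + 1"
proof -
  have "real (nat \<lceil>x\<rceil>) = of_int \<lceil>x\<rceil>" using assms by simp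
  then show "x \<le> real (nat \<lceil>x\<rceil>)" "real (nat \<lceil>x\<rceil>) \<le> x + 1" using ceiling_correct[of x] by linarith+
qed

lemma nat_floor_bounds:
  fixes x :: real
  assumes "0 \<le> x" shows "real (nat \<lfloor>x\<rfloor>) \<le> x" "x \<le> real (nat \<lfloor>x\<rfloor>) + 1"
proof -
  have "real (nat \<lfloor>x\<rfloor>) = of_int \<lfloor>x\<rfloor>" using assms by simp
  then show "real (nat \<lfloor>x\<rfloor>) \<le> x" "x \<le> real (nat \<lfloor>x\<rfloor>) + 1" using floor_correct[of x] by linarith+
qed

text \<open>Induction on the number \<open>K\<close> of disjoint windows. A window of length
  \<open>d\<close> holds at least \<open>d / \<tau> - 1\<close> grid times, of total weight at least
  \<open>d - \<tau> \<ge> d / 2\<close>, and windows recur arbitrarily late. That \<open>T\<close>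
  is uniform in \<open>\<tau>\<close> and \<open>M\<close> matters, as these will be chosen after
  it.\<close>

lemma many_grid_points:
  fixes P :: "real \<Rightarrow> bool"
  assumes d: "0 < d" and P: "\<And>T. \<exists>t\<ge>T. \<forall>w\<in>{t..t + d}. P w"
  shows "\<exists>T>0. \<forall>(\<tau>::real) (M::nat). 0 < \<tau> \<longrightarrow> \<tau> \<le> d / 2 \<longrightarrow> T \<le> real M * \<tau> \<longrightarrow>
    real K * d / 2 \<le> \<tau> * card {j \<in> {1..M}. P (t0 + real j * \<tau>)}"
proof (induction K)
  case 0
  show ?case by (intro exI[of _ 1]) auto
next
  case (Suc K)
  then obtain T where T: "0 < T" "\<And>(\<tau>::real) (M::nat). 0 < \<tau> \<Longrightarrow> \<tau> \<le> d / 2 \<Longrightarrow> T \<le> real M * \<tau> \<Longrightarrow>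
    real K * d / 2 \<le> \<tau> * card {j \<in> {1..M}. P (t0 + real j * \<tau>)}" by blast
  \<comment> \<open>Starting beyond \<open>t0 + T + d\<close> leaves room for the rounding errors,
    so that the new grid indices exceed \<open>M1\<close>.\<close>
  obtain t where t: "t0 + T + d \<le> t" "\<And>w. t \<le> w \<Longrightarrow> w \<le> t + d \<Longrightarrow> P w" using P by fastforce
  show ?case
  proof (intro exI[of _ "t + d - t0"] conjI allI impI)
    show "0 < t + d - t0" using t(1) T(1) d by linarith
    fix \<tau> :: real and M :: nat assume \<tau>: "0 < \<tau>" "\<tau> \<le> d / 2" and M: "t + d - t0 \<le> real M * \<tau>"
    define M1 where "M1 = nat \<lceil>T / \<tau>\<rceil>"
    define j0 where "j0 = nat \<lceil>(t - t0) / \<tau>\<rceil>"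
    define l where "l = nat \<lfloor>d / \<tau>\<rfloor>"
    have "T / \<tau> \<le> M1" "M1 \<le> T / \<tau> + 1" using T(1) \<tau> unfolding M1_def by (auto intro!: nat_ceiling_bounds)
    then have M1: "T \<le> M1 * \<tau>" "M1 * \<tau> \<le> T + \<tau>" using \<tau> by (auto simp: field_simps)
    have "0 \<le> (t - t0) / \<tau>" using t(1) T(1) d \<tau> by simp
    then have "(t - t0) / \<tau> \<le> j0" "j0 \<le> (t - t0) / \<tau> + 1" unfolding j0_def by (auto intro!: nat_ceiling_bounds)
    then have j0: "t - t0 \<le> j0 * \<tau>" "j0 * \<tau> \<le> t - t0 + \<tau>" using \<tau> by (auto simp: field_simps)
    have "0 \<le> d / \<tau>" using d \<tau> by simp
    then have "l \<le> d / \<tau>" "d / \<tau> \<le> real l + 1" unfolding l_def by (rule nat_floor_bounds)+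
    then have l: "l * \<tau> \<le> d" "d \<le> l * \<tau> + \<tau>" using \<tau> by (auto simp: field_simps)
    \<comment> \<open>Half-open: the last index is \<open>j0 + l - 1\<close>, which compensates for
      rounding \<open>j0\<close> upwards.\<close>
    let ?D1 = "{j \<in> {1..M1}. P (t0 + real j * \<tau>)}" and ?D2 = "{j0..<j0 + l}" and ?D = "{j \<in> {1..M}. P (t0 + real j * \<tau>)}"
    have le: "a \<le> b" if "real a * \<tau> \<le> real b * \<tau>" for a b :: nat using that \<tau>(1) by simp
    have lt: "a < b" if "real a * \<tau> < real b * \<tau>" for a b :: nat using that \<tau>(1) by simp
    have "M1 \<le> M" using M M1 t(1) \<tau> d by (intro le) linarith
    have "M1 < j0" using j0 M1 t(1) \<tau> d by (intro lt) linarith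
    have "?D2 \<subseteq> ?D"
    proof
      fix j assume j: "j \<in> ?D2"
      then have "real j0 * \<tau> \<le> j * \<tau>" "(j + 1) * \<tau> \<le> (j0 + l) * \<tau>" using \<tau>(1) by (auto intro!: mult_right_mono)
      then have "t - t0 \<le> j * \<tau>" "j * \<tau> \<le> t - t0 + d" using j0 l by (auto simp: algebra_simps)
      moreover from this(2) have "j \<le> M" using M by (intro le) linarith
      ultimately show "j \<in> ?D" using j \<open>M1 < j0\<close> by (auto intro!: t(2))
    qed
    moreover have "?D1 \<subseteq> ?D" using \<open>M1 \<le> M\<close> by auto
    ultimately have "card (?D1 \<union> ?D2) \<le> card ?D" by (intro card_mono) auto
    moreover have "card (?D1 \<union> ?D2) = card ?D1 + l"
      using \<open>M1 < j0\<close> by (subst card_Un_disjoint) auto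
    ultimately have "real (card ?D1) + l \<le> card ?D" by linarith
    then have "\<tau> * (card ?D1 + l) \<le> \<tau> * card ?D" using \<tau>(1) by (intro mult_left_mono) auto
    moreover have "real K * d / 2 \<le> \<tau> * card ?D1" by (rule T(2)[OF \<tau> M1(1)])
    ultimately show "real (Suc K) * d / 2 \<le> \<tau> * card ?D" using l \<tau> by (simp add: algebra_simps)
  qed
qed

theorem theorem2:
  fixes s :: "nat \<Rightarrow> 'g::{group_add, countable}"
    and r :: nat
    and J :: "'a::finite_discrete \<Rightarrow> 'a \<Rightarrow> real"
    and h :: "'a \<Rightarrow> real"
    and S :: "real \<Rightarrow> (('g \<Rightarrow> 'a) \<Rightarrow>\<^sub>C real) \<Rightarrow> (('g \<Rightarrow> 'a) \<Rightarrow>\<^sub>C real)"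
    and \<mu> :: "('g \<Rightarrow> 'a) measure"
  assumes r: "r \<ge> 1"
    and generators: "generated_subgroup (s ` {1..r}) = UNIV"
    and J_sym: "\<forall>a b. J a b = J b a"
    and S: "glauber_semigroup r s J h S"
    and \<mu>: "\<mu> \<in> invariant_Prob"
    and finite_free_energy:
      "\<exists>t0\<ge>0. \<exists>(V :: nat \<Rightarrow> 'v set) (\<sigma> :: nat \<Rightarrow> 'g \<Rightarrow> 'v \<Rightarrow> 'v).
         (\<forall>n. finite (V n) \<and> V n \<noteq> {}) \<and>
         (\<forall>n. hom_to_Sym (V n) (\<sigma> n)) \<and>
         filterlim (\<lambda>n. card (V n)) at_top sequentially \<and>
         (\<lambda>n. sofic_Delta r s (V n) (\<sigma> n)) \<longlonglongrightarrow> 0 \<and>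
         free_energy_density r s J h V \<sigma> (act_on_measure \<mu> (S t0)) < \<infinity>"
  shows "weak_limit_points_at_top (\<lambda>t. act_on_measure \<mu> (S t)) \<subseteq> gibbs_measures r s J h"
proof
  fix \<nu> assume \<nu>: "\<nu> \<in> weak_limit_points_at_top (\<lambda>t. act_on_measure \<mu> (S t))"
  obtain t0 V \<sigma> where t0: "0 \<le> t0" and V: "\<And>n. finite (V n)" "\<And>n. V n \<noteq> {}"
    and \<sigma>: "\<And>n. hom_to_Sym (V n) (\<sigma> n)"
    and \<Delta>: "(\<lambda>n. sofic_Delta r s (V n) (\<sigma> n :: 'g \<Rightarrow> 'v \<Rightarrow> 'v)) \<longlonglongrightarrow> 0"
    and fe: "free_energy_density r s J h V \<sigma> (act_on_measure \<mu> (S t0)) < \<infinity>"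
    using finite_free_energy by blast
  interpret glauber r s J h .
  have MS: "markov_semigroup S" and generator: "semigroup_generator S = closure (glauber_pregenerator r s J h)"
    using S by (auto simp: glauber_semigroup_def)
  have \<mu>P: "\<mu> \<in> Prob" using \<mu> by (simp add: invariant_Prob_def)
  have act: "act_on_measure \<mu> (S t) \<in> Prob"
    "(\<integral>x. apply_bcontfun f x \<partial>act_on_measure \<mu> (S t)) = (\<integral>x. apply_bcontfun (S t f) x \<partial>\<mu>)" if "0 \<le> t" for t f
    using act_on_measure[OF \<mu>P markov_semigroupD[OF MS that]] by blast+
  show "\<nu> \<in> gibbs_measures r s J h"
  proof (rule gibbsI)
    show "\<nu> \<in> Prob" using \<nu> by (simp add: weak_limit_points_at_top_def)
    fix \<gamma> and f :: "('g \<Rightarrow> 'a) \<Rightarrow> real" assume f: "local f"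
    define \<psi> where "\<psi> x = flip_mean \<gamma> f x - f x" for x
    have \<psi>: "local \<psi>" unfolding \<psi>_def[abs_def] by (intro local_comp2[where F = "(-)"] local_flip_mean f)
    define \<Psi> where "\<Psi> = loc_bcontfun \<psi>"
    define G where "G = loc_bcontfun (gen \<psi>)"
    have \<Psi>: "apply_bcontfun \<Psi> = \<psi>" unfolding \<Psi>_def by (rule apply_loc_bcontfun[OF \<psi>])
    have \<Psi>G: "(\<Psi>, G) \<in> semigroup_generator S"
      unfolding generator \<Psi>_def G_def using local_pregenerator[OF \<psi>] closure_subset by blast
    define u where "u t = (\<integral>x. apply_bcontfun (S t \<Psi>) x \<partial>\<mu>)" for t
    define c where "c = (\<integral>x. \<psi> x \<partial>\<nu>)"
    show "(\<integral>x. flip_mean \<gamma> f x - f x \<partial>\<nu>) = 0"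
    proof (rule ccontr)
      assume "(\<integral>x. flip_mean \<gamma> f x - f x \<partial>\<nu>) \<noteq> 0"
      \<comment> \<open>A quarter of the limit: \<open>\<bar>u\<bar>\<close> exceeds
        \<open>3 * \<epsilon>\<close> at return times and \<open>2 * \<epsilon>\<close> on the
        windows that follow, so the chain still sees at least \<open>\<epsilon>\<close> after the
        tracking error.\<close>
      define \<epsilon> where "\<epsilon> = \<bar>c\<bar> / 4"
      have \<epsilon>: "0 < \<epsilon>" using \<open>_ \<noteq> 0\<close> by (simp add: \<epsilon>_def c_def \<psi>_def)
      obtain d where d: "0 < d" "\<And>\<tau>. 0 \<le> \<tau> \<Longrightarrow> \<tau> \<le> d \<Longrightarrow> norm (S \<tau> \<Psi> - \<Psi>) \<le> \<epsilon>"
        using semigroup_near_identity[OF MS \<epsilon>] by blast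
      \<comment> \<open>The semigroup contracts, so the window length \<open>d\<close> obtained from
        continuity at time 0 serves every starting time.\<close>
      have long: "\<exists>t\<ge>T. \<forall>w\<in>{t..t + d}. 2 * \<epsilon> < \<bar>u w\<bar>" for T
      proof -
        obtain t where t: "max T 0 \<le> t" "\<bar>(\<integral>x. apply_bcontfun \<Psi> x \<partial>act_on_measure \<mu> (S t)) - (\<integral>x. apply_bcontfun \<Psi> x \<partial>\<nu>)\<bar> < \<epsilon>"
          using weak_limit_point_frequently[OF \<nu> \<epsilon>] by blast
        have ut: "\<bar>u t - c\<bar> < \<epsilon>" using t act(2)[of t \<Psi>] by (simp add: u_def c_def \<Psi>)
        have "2 * \<epsilon> < \<bar>u w\<bar>" if w: "w \<in> {t..t + d}" for w
        proof -
          have "u w - u t = (\<integral>x. apply_bcontfun (S t (S (w - t) \<Psi> - \<Psi>)) x \<partial>\<mu>)"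
            using markov_semigroup_add[OF MS, of t "w - t" \<Psi>] w t(1) integrable_bcontfun[OF \<mu>P]
              linear_diff[OF markov_semigroupD(1)[OF MS, of t]] by (simp add: u_def)
          also have "\<bar>\<dots>\<bar> \<le> norm (S t (S (w - t) \<Psi> - \<Psi>))"
          proof -
            interpret prob_space \<mu> using \<mu>P by (simp add: Prob_iff)
            have "linear (\<lambda>f :: ('g \<Rightarrow> 'a) \<Rightarrow>\<^sub>C real. \<integral>x. apply_bcontfun f x \<partial>\<mu>)"
              using integrable_bcontfun[OF \<mu>P] by (intro linearI) simp_all
            then show ?thesis by (rule positive_functional_le_norm) (auto simp: prob_space)
          qed
          also have "\<dots> \<le> norm (S (w - t) \<Psi> - \<Psi>)" using t(1) by (intro markov_semigroup_contraction MS) simp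
          also have "\<dots> \<le> \<epsilon>" using w by (intro d(2)) auto
          finally show ?thesis using ut \<epsilon> unfolding \<epsilon>_def by argo
        qed
        then show ?thesis using t(1) by (intro exI[of _ t]) auto
      qed
      \<comment> \<open>The summand 1 keeps \<open>B\<close> positive when \<open>f\<close>
        vanishes.\<close>
      define B where "B = norm (loc_bcontfun f) + 1"
      have B: "0 < B" "\<bar>f y\<bar> \<le> B" for y
        using norm_bounded[of "loc_bcontfun f" y] by (auto simp: B_def apply_loc_bcontfun[OF f] add_nonneg_pos)
      \<comment> \<open>The square of the average defect that remains forced when bad vertices cost
        at most \<open>\<epsilon> / 2\<close>.\<close>
      define \<kappa> where "\<kappa> = (\<epsilon> / (2 * B))\<^sup>2"
      have \<kappa>: "0 < \<kappa>" using \<epsilon> B(1) by (simp add: \<kappa>_def)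
      \<comment> \<open>Enough windows for their dissipation to exceed the budget. The parameters
        \<open>T\<close>, \<open>e\<close>, \<open>\<tau>\<close>, \<open>M\<close>,
        \<open>\<eta>\<close>, \<open>W\<close> and \<open>\<theta>\<close> are then fixed in this
        order, each from earlier choices; the model comes last.\<close>
      obtain K :: nat where "(2 * energy_bound + ln (CARD('a))) / (d / 2 * (\<kappa> / 4)) < real K"
        using reals_Archimedean2 by blast
      then have K: "2 * energy_bound + ln (CARD('a)) < (real K * d / 2) * (\<kappa> / 4)"
        using d(1) \<kappa> by (simp add: pos_divide_less_eq mult_ac)
      obtain T where T: "0 < T" "\<And>(\<tau>::real) (M::nat). 0 < \<tau> \<Longrightarrow> \<tau> \<le> d / 2 \<Longrightarrow> T \<le> real M * \<tau> \<Longrightarrow>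
          real K * d / 2 \<le> \<tau> * card {j \<in> {1..M}. 2 * \<epsilon> < \<bar>u (t0 + real j * \<tau>)\<bar>}"
        using many_grid_points[OF d(1) long, of K t0] by blast
      \<comment> \<open>The elapsed time \<open>M * \<tau>\<close> will be at most
        \<open>T + d\<close>, so the consistency errors add up to at most
        \<open>\<epsilon> / 4\<close>.\<close>
      define e where "e = \<epsilon> / (4 * (T + d))"
      have e: "0 < e" using \<epsilon> T(1) d(1) by (simp add: e_def)
      obtain b where b: "0 < b" "\<And>\<tau>. 0 < \<tau> \<Longrightarrow> \<tau> < b \<Longrightarrow> norm (S \<tau> \<Psi> - \<tau> *\<^sub>R S \<tau> G - \<Psi>) \<le> e * \<tau>"
        using semigroup_first_order[OF MS \<Psi>G e] by (auto simp: eventually_at_right[of 0 1])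
      define \<tau> where "\<tau> = min (b / 2) (d / 2)"
      have \<tau>: "0 < \<tau>" "\<tau> \<le> d / 2" "norm (S \<tau> \<Psi> - \<tau> *\<^sub>R S \<tau> G - \<Psi>) \<le> e * \<tau>"
        using b(1) d(1) b(2)[of \<tau>] by (auto simp: \<tau>_def)
      define M where "M = nat \<lceil>T / \<tau>\<rceil>"
      have "T / \<tau> \<le> M" "M \<le> T / \<tau> + 1" using T(1) \<tau>(1) unfolding M_def by (auto intro!: nat_ceiling_bounds)
      then have "T \<le> M * \<tau>" "M * \<tau> \<le> T + \<tau>" using \<tau> by (auto simp: field_simps)
      then have M: "T \<le> M * \<tau>" "M * \<tau> \<le> T + d" using \<tau> d(1) by auto
      have M0: "0 < real M" using M(1) T(1) by (cases M) auto
      \<comment> \<open>Each of the \<open>M\<close> steps costs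
        \<open>(2 + \<tau>) * \<eta>\<close> in local approximation, hence
        \<open>\<epsilon> / 4\<close> altogether.\<close>
      define \<eta> where "\<eta> = \<epsilon> / (4 * M * (2 + \<tau>))"
      have \<eta>: "0 < \<eta>" using \<epsilon> M0 \<tau>(1) by (simp add: \<eta>_def)
      define U where "U i = S (real i * \<tau>) \<Psi>" for i
      define H where "H i = S (real i * \<tau>) G" for i
      have UH: "norm (U (Suc i) - \<tau> *\<^sub>R H (Suc i) - U i) \<le> e * \<tau>" for i
      proof -
        interpret bounded_linear "S (real i * \<tau>)" using \<tau>(1) by (intro markov_semigroup_bounded_linear MS) simp
        have "S (real (Suc i) * \<tau>) F = S (real i * \<tau>) (S \<tau> F)" for F
          using markov_semigroup_add[OF MS, of "real i * \<tau>" \<tau> F] \<tau>(1) by (simp add: algebra_simps)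
        then have "U (Suc i) - \<tau> *\<^sub>R H (Suc i) - U i = S (real i * \<tau>) (S \<tau> \<Psi> - \<tau> *\<^sub>R S \<tau> G - \<Psi>)"
          by (simp add: U_def H_def diff scaleR)
        then show ?thesis
          using markov_semigroup_contraction[OF MS, of "real i * \<tau>" "S \<tau> \<Psi> - \<tau> *\<^sub>R S \<tau> G - \<Psi>"] \<tau> by simp
      qed
      \<comment> \<open>The evolved function stays in the domain of the generator but need not be
        local; the comparison with the model is made through local functions close to it in the
        graph norm.\<close>
      have "\<exists>g. local g \<and> norm (loc_bcontfun g - U i) \<le> \<eta> \<and> norm (loc_bcontfun (gen g) - H i) \<le> \<eta>" for i
      proof -
        have "(U i, H i) \<in> closure (glauber_pregenerator r s J h)"
          unfolding U_def H_def generator[symmetric] using \<tau>(1) by (intro generator_invariant MS \<Psi>G) simp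
        from closure_pregenerator_local_approx[OF this \<eta>] show ?thesis by metis
      qed
      then obtain g where g: "\<And>i. local (g i)" "\<And>i. norm (loc_bcontfun (g i) - U i) \<le> \<eta>"
        "\<And>i. norm (loc_bcontfun (gen (g i)) - H i) \<le> \<eta>" by metis
      have gU: "\<bar>g i y - U i y\<bar> \<le> \<eta>" for i y
        using norm_bounded[of "loc_bcontfun (g i) - U i" y] g(2)[of i] by (simp add: apply_loc_bcontfun[OF g(1)])
      have gH: "\<bar>gen (g i) y - H i y\<bar> \<le> \<eta>" for i y
        using norm_bounded[of "loc_bcontfun (gen (g i)) - H i" y] g(3)[of i]
        by (simp add: apply_loc_bcontfun[OF local_gen[OF g(1)]])
      have UHy: "\<bar>U (Suc i) y - \<tau> * H (Suc i) y - U i y\<bar> \<le> e * \<tau>" for i y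
        using norm_bounded[of "U (Suc i) - \<tau> *\<^sub>R H (Suc i) - U i" y] UH[of i] by simp
      define Bg where "Bg = norm \<Psi> + \<eta>"
      have Bg: "\<bar>g i y\<bar> \<le> Bg" for i y
      proof -
        have "norm (U i) \<le> norm \<Psi>" unfolding U_def using \<tau>(1) by (intro markov_semigroup_contraction MS) simp
        then show ?thesis using gU[of i y] norm_bounded[of "U i" y] by (simp add: Bg_def)
      qed
      obtain Wg where Wg: "\<And>i. finite (Wg i)" "\<And>i. depends_on (Wg i) (g i)" using g(1) unfolding local_def by metis
      obtain Wf where Wf: "finite Wf" "depends_on Wf f" using f by (auto simp: local_def)
      define W where "W = (\<Union>i\<le>M. Wg i) \<union> Wf \<union> {\<gamma>}"
      have W: "finite W" "\<gamma> \<in> W" "depends_on W f" "\<And>i. i \<le> M \<Longrightarrow> depends_on W (g i)"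
        using Wg Wf by (auto simp: W_def intro: depends_on_mono)
      \<comment> \<open>The first entry limits the tracking error due to bad vertices to
        \<open>\<epsilon> / 4\<close>, with 1 added for a positive denominator; the second limits
        their cost in \<open>pair_flip_defect\<close> to \<open>\<epsilon> / 2\<close>.\<close>
      define \<theta> where "\<theta> = min (\<epsilon> / (4 * (4 * Bg * card W + 1) * (T + d))) (\<epsilon> / (4 * B))"
      have Bg0: "0 \<le> Bg" using \<eta> by (simp add: Bg_def)
      have \<theta>: "0 < \<theta>" using \<epsilon> B(1) T(1) d(1) Bg0 by (simp add: \<theta>_def add_nonneg_pos)
      \<comment> \<open>By the semigroup law, the integrals of \<open>U 0\<close> to
        \<open>U M\<close> at time \<open>t0\<close> are the values of \<open>u\<close> at the grid
        times, so this neighbourhood fixes all of them up to \<open>\<epsilon> / 4\<close>.\<close>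
      define \<O> where "\<O> = {\<rho> \<in> Prob. \<forall>f\<in>U ` {..M}. \<bar>(\<integral>x. apply_bcontfun f x \<partial>\<rho>)
          - (\<integral>x. apply_bcontfun f x \<partial>act_on_measure \<mu> (S t0))\<bar> < \<epsilon> / 4}"
      have "openin weak_topology \<O>" unfolding \<O>_def by (rule openin_weak_topology) simp
      moreover have "act_on_measure \<mu> (S t0) \<in> \<O>" using act(1)[OF t0] \<epsilon> by (simp add: \<O>_def)
      ultimately have "\<forall>\<^sub>F n in sequentially. Omega_set (V n) (\<sigma> n) \<O> \<noteq> {}"
        by (intro Omega_set_nonempty[OF fe])
      moreover have "\<forall>\<^sub>F n in sequentially. real (card {v \<in> V n. \<exists>g\<in>forbidden W. \<sigma> n g v = v}) / card (V n) < \<theta>"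
        using sofic_fixed_fraction_finite[OF generators V \<sigma> \<Delta> finite_forbidden[OF W(1)]] \<theta>
        by (intro order_tendstoD(2)) (auto simp: forbidden_def)
      ultimately have "\<forall>\<^sub>F n in sequentially. Omega_set (V n) (\<sigma> n) \<O> \<noteq> {} \<and>
          real (card {v \<in> V n. \<exists>g\<in>forbidden W. \<sigma> n g v = v}) / card (V n) < \<theta>"
        by (rule eventually_conj)
      \<comment> \<open>A single model suffices: it carries a suitable \<open>\<zeta>\<close> and
        has few bad vertices.\<close>
      then obtain n \<zeta> where n: "real (card {v \<in> V n. \<exists>g\<in>forbidden W. \<sigma> n g v = v}) / card (V n) < \<theta>"
        and \<zeta>: "\<zeta> \<in> Omega_set (V n) (\<sigma> n) \<O>"
        unfolding eventually_sequentially by blast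
      interpret F: finite_glauber r s J h "V n" "\<sigma> n" using V \<sigma> J_sym by unfold_locales auto
      have bad: "F.bad_fraction W \<le> \<theta>" using F.bad_fraction_le[of W] n by linarith
      have \<zeta>V: "set_pmf \<zeta> \<subseteq> F.conf" using \<zeta> by (simp add: Omega_set_def)
      obtain Z where Z0: "Z 0 = pmf \<zeta>" and Z: "\<And>j. F.hb.is_prob (Z j)"
          "\<And>j. F.hb.implicit_euler (V n) \<tau> (Z j) (Z (Suc j))"
        using F.euler_chain_exists[OF F.is_prob_pmf[OF \<zeta>V] \<tau>(1)] by blast
      let ?\<delta> = "e * \<tau> + (2 + \<tau>) * \<eta> + \<tau> * (4 * Bg * card W * F.bad_fraction W)"
      have \<delta>: "real M * ?\<delta> \<le> 3 * \<epsilon> / 4"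
      proof -
        have "M * (e * \<tau>) = e * (M * \<tau>)" by simp
        also have "\<dots> \<le> e * (T + d)" using M(2) e by (intro mult_left_mono) auto
        also have "\<dots> = \<epsilon> / 4"
        proof -
          have "T + d \<noteq> 0" using T(1) d(1) by simp
          then show ?thesis by (simp add: e_def divide_simps)
        qed
        finally have 1: "M * (e * \<tau>) \<le> \<epsilon> / 4" .
        have 2: "M * ((2 + \<tau>) * \<eta>) = \<epsilon> / 4" using M0 \<tau>(1) by (simp add: \<eta>_def)
        have "4 * Bg * card W * F.bad_fraction W \<le> (4 * Bg * card W + 1) * \<theta>"
          using bad Bg0 F.bad_fraction_nonneg[of W] by (intro mult_mono) auto
        moreover have "0 \<le> 4 * Bg * card W * F.bad_fraction W"
          using Bg0 F.bad_fraction_nonneg[of W] by simp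
        ultimately have "(M * \<tau>) * (4 * Bg * card W * F.bad_fraction W) \<le> (T + d) * ((4 * Bg * card W + 1) * \<theta>)"
          using M(2) T(1) d(1) by (intro mult_mono[of "M * \<tau>" "T + d" "4 * Bg * card W * F.bad_fraction W"]) auto
        also have "\<dots> \<le> (T + d) * ((4 * Bg * card W + 1) * (\<epsilon> / (4 * (4 * Bg * card W + 1) * (T + d))))"
          using T(1) d(1) Bg0 by (intro mult_left_mono) (auto simp: \<theta>_def)
        also have "\<dots> = \<epsilon> / 4"
        proof -
          define q where "q = 4 * Bg * card W + 1"
          have "q > 0" using Bg0 by (simp add: q_def add_nonneg_pos)
          moreover have "T + d > 0" using T(1) d(1) by simp
          ultimately show ?thesis unfolding q_def[symmetric] by (simp add: divide_simps)
        qed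
        finally show ?thesis using 1 2 by (simp add: distrib_left mult_ac)
      qed
      \<comment> \<open>Of the error, \<open>3 * \<epsilon> / 4\<close> accumulates along the chain
        and \<open>\<epsilon> / 4\<close> comes from the choice of \<open>\<zeta>\<close> in
        \<open>\<O>\<close>.\<close>
      have track: "\<bar>F.pair (Z j) \<psi> - u (t0 + real j * \<tau>)\<bar> \<le> \<epsilon>" if j: "j \<le> M" for j
      proof -
        have "\<bar>F.pair (Z j) (apply_bcontfun (U 0)) - F.pair (Z 0) (apply_bcontfun (U (0 + j)))\<bar> \<le> real j * ?\<delta>"
          using j by (intro F.euler_tracking[where M = M and g = g and U = "\<lambda>i. apply_bcontfun (U i)" and H = "\<lambda>i. apply_bcontfun (H i)"] Z \<tau>(1) W(1,4) Bg gU gH UHy) auto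
        also have "\<dots> \<le> real M * ?\<delta>"
          using j e \<eta> \<tau>(1) Bg0 F.bad_fraction_nonneg[of W] by (intro mult_right_mono) auto
        finally have 1: "\<bar>F.pair (Z j) (apply_bcontfun (U 0)) - F.pair (Z 0) (apply_bcontfun (U j))\<bar> \<le> 3 * \<epsilon> / 4" using \<delta> by simp
        have "U 0 = \<Psi>" using MS by (simp add: U_def markov_semigroup_def)
        then have "\<bar>F.pair (Z j) \<psi> - F.pair (Z 0) (apply_bcontfun (U j))\<bar> \<le> 3 * \<epsilon> / 4" using 1 \<Psi> by simp
        moreover have "F.pair (Z 0) (apply_bcontfun (U j)) = (\<integral>y. apply_bcontfun (U j) y \<partial>mean_empirical (V n) (\<sigma> n) \<zeta>)"
          unfolding Z0 by (rule F.integral_mean_empirical[OF \<zeta>V, symmetric])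
        moreover have "\<bar>\<dots> - (\<integral>x. apply_bcontfun (U j) x \<partial>act_on_measure \<mu> (S t0))\<bar> < \<epsilon> / 4"
          using \<zeta> j by (auto simp: Omega_set_def \<O>_def)
        moreover have "(\<integral>x. apply_bcontfun (U j) x \<partial>act_on_measure \<mu> (S t0)) = u (t0 + real j * \<tau>)"
          using t0 \<tau>(1) markov_semigroup_add[OF MS, of t0 "real j * \<tau>" \<Psi>] by (simp add: act(2) u_def U_def)
        ultimately show ?thesis by argo
      qed
      define D where "D = {j \<in> {1..M}. 2 * \<epsilon> < \<bar>u (t0 + real j * \<tau>)\<bar>}"
      have "\<kappa> * card (V n) \<le> (\<Sum>w\<in>V n. (F.hb.defect w (Z j))\<^sup>2)" if "j \<in> D" for j
        unfolding \<kappa>_def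
      proof (rule F.defect_square_sum)
        have "\<epsilon> \<le> \<bar>F.pair (Z j) \<psi>\<bar>" using track[of j] that by (auto simp: D_def)
        also have "\<dots> \<le> B * ((\<Sum>w\<in>V n. F.hb.defect w (Z j)) / card (V n)) + 2 * B * F.bad_fraction W"
          unfolding \<psi>_def[abs_def] by (rule F.pair_flip_defect[OF Z(1) W(3) B(2) W(2)])
        also have "2 * B * F.bad_fraction W \<le> 2 * B * (\<epsilon> / (4 * B))"
          using bad B(1) by (intro mult_left_mono) (auto simp: \<theta>_def)
        also have "\<dots> = \<epsilon> / 2" using B(1) by simp
        finally have "\<epsilon> / 2 \<le> B * ((\<Sum>w\<in>V n. F.hb.defect w (Z j)) / card (V n))" by linarith
        then show "\<epsilon> / (2 * B) * card (V n) \<le> (\<Sum>w\<in>V n. F.hb.defect w (Z j))"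
          using B(1) F.card_V_pos by (simp add: field_simps)
      qed (use \<epsilon> B(1) in simp)
      then have "\<tau> / 4 * \<kappa> * card D \<le> 2 * energy_bound + ln (CARD('a))"
        by (intro F.dissipation_budget[where Z = Z and M = M] Z \<tau>(1)) (auto simp: D_def)
      \<comment> \<open>The grid times in \<open>D\<close> carry total weight at least
        \<open>K * d / 2\<close>, so dissipation at rate \<open>\<kappa> / 4\<close> on them
        overdraws the budget by the choice of \<open>K\<close>.\<close>
      moreover have "(real K * d / 2) * (\<kappa> / 4) \<le> (\<tau> * card D) * (\<kappa> / 4)"
        unfolding D_def using \<kappa> by (intro mult_right_mono T(2) \<tau> M(1)) auto
      ultimately show False using K by (simp add: mult_ac)
    qed
  qed
qed

end
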